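(* Let $d\ge 2$ and $1\le k\le d$ be integers. Let $K\subset\mathbb{R}^d$ be a $C^2_+$ convex body with $0\in\operatorname{int}K$. Let $(K^t)_{t\in[0,1]}$ be an admissible deformation of $K$, i.e. for each $t\in[0,1]$, $K^t\subset\mathbb{R}^d$ is a convex body with radial function $\varrho^t:S^{d-1}\to(0,\infty)$, $K^t\supset K^0=K$, and $[0,1]\times S^{d-1}\ni(t,u)\mapsto\varrho^t(u)\in(0,\infty)$ is a $C^2$ function. Put $\alpha:=k/2$ if $1\le k\le d-1$ and $\alpha:=(d+1)/2$ if $k=d$. For a tangent hyperplane $H$ of $K$ let $H^+$ be the closed half-space bounded by $H$ and not containing $K$. Then: (1) For each tangent hyperplane $H$ of $K$, the $k$-th intrinsic volume of the cap $K^\varepsilon\cap H^+$ cut off from $K^\varepsilon$ by $H$ satisfies that the limit $$\mu(H):=\lim_{\varepsilon\to0^+}\frac{V_k(K^{\varepsilon}\cap H^+)}{\varepsilon^{\alpha}}$$ exists and is finite and non-negative. (2) The function $H\mapsto\mu(H)$, on the set of all tangent hyperplanes of $K$, uniquely determines the function $u\mapsto(\partial\varrho^t(u)/\partial t)|_{t=0}$ on $S^{d-1}$. That is, if $(K^t)_{t\in[0,1]}$ and $(\widetilde K^t)_{t\in[0,1]}$ are two admissible deformations of the same $K$, with radial functions $\varrho^t$ and $\widetilde\varrho^{\,t}$ and limits $\mu$ and $\widetilde\mu$ respectively, and $\mu(H)=\widetilde\mu(H)$ for every tangent hyperplane $H$ of $K$, then $(\partial\varrho^t(u)/\partial t)|_{t=0}=(\partial\widetilde\varrho^{\,t}(u)/\partial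 t)|_{t=0}$ for all $u\in S^{d-1}$.
   Context: A convex body in $\mathbb{R}^d$ is a compact convex set with non-empty interior. It is $C^2_+$ if its boundary is a $C^2$ submanifold of $\mathbb{R}^d$ with everywhere positive Gauss curvature. The radial function of a convex body $K$ with $0\in\operatorname{int}K$ is $\varrho(u)=\max\{r\ge 0: ru\in K\}$, $u\in S^{d-1}$. Derivatives at $t=0$ are one-sided (from $t\geq 0$). A tangent (supporting) hyperplane of $K$ is a hyperplane that intersects $K$ but not $\operatorname{int}K$. $V_k$ denotes the $k$-th intrinsic volume: for a non-empty compact convex set $C\subset\mathbb{R}^d$, the numbers $V_0(C),\dots,V_d(C)$ are defined by $V(C+rB^d)=\sum_{k=0}^d\kappa_{d-k}V_k(C)r^{d-k}$ for all $r\ge 0$, where $V$ is $d$-dimensional volume, $B^d$ is the closed unit ball and $\kappa_j$ is the volume of the unit ball of $\mathbb{R}^j$ ($\kappa_0=1$). In particular $V_d=V$. *)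

theory Defs
  imports "HOL-Analysis.Analysis"
begin

definition C2_on_open :: "('a::real_normed_vector) set \<Rightarrow> ('a \<Rightarrow> 'b::real_normed_vector) \<Rightarrow> bool" where
  "C2_on_open U f \<longleftrightarrow> open U \<and>
     (\<exists>(f' :: 'a \<Rightarrow> 'a \<Rightarrow>\<^sub>L 'b) (f'' :: 'a \<Rightarrow> 'a \<Rightarrow>\<^sub>L 'a \<Rightarrow>\<^sub>L 'b).
        (\<forall>x\<in>U. (f has_derivative blinfun_apply (f' x)) (at x)) \<and>
        (\<forall>x\<in>U. (f' has_derivative blinfun_apply (f'' x)) (at x)) \<and>
        continuous_on U f'')"

text \<open>On a set that need not be open (a submanifold, possibly with boundary), a function is
  \<open>C\<^sup>2\<close> if it locally extends to a \<open>C\<^sup>2\<close> function on an open set of the ambient space.\<close>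

definition C2_on :: "('a::real_normed_vector) set \<Rightarrow> ('a \<Rightarrow> 'b::real_normed_vector) \<Rightarrow> bool" where
  "C2_on S f \<longleftrightarrow>
     (\<forall>x\<in>S. \<exists>U g. x \<in> U \<and> C2_on_open U g \<and> (\<forall>y\<in>S \<inter> U. g y = f y))"

text \<open>Codimension-one \<open>C\<^sup>2\<close> submanifolds: locally the zero set of a \<open>C\<^sup>2\<close> function whose
  differential vanishes nowhere.\<close>

definition C2_hypersurface :: "('a::euclidean_space) set \<Rightarrow> bool" where
  "C2_hypersurface S \<longleftrightarrow>
     (\<forall>p\<in>S. \<exists>U (F :: 'a \<Rightarrow> real). p \<in> U \<and> C2_on_open U F \<and>
        (\<forall>x\<in>U. \<not> (F has_derivative (\<lambda>_. 0)) (at x)) \<and>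
        S \<inter> U = {x\<in>U. F x = 0})"

definition convex_body :: "('a::euclidean_space) set \<Rightarrow> bool" where
  "convex_body K \<longleftrightarrow> compact K \<and> convex K \<and> interior K \<noteq> {}"

text \<open>The outer unit normal at a boundary point; it is unique when the boundary is a
  \<open>C\<^sup>2\<close> hypersurface.\<close>

definition gauss_map :: "('a::euclidean_space) set \<Rightarrow> 'a \<Rightarrow> 'a" where
  "gauss_map K x = (THE n. norm n = 1 \<and> (\<forall>y\<in>K. (y - x) \<bullet> n \<le> 0))"

text \<open>The Gauss curvature is the determinant of the differential \<open>W\<close> of the Gauss map
  (the shape operator with respect to the outer normal) on the tangent space
  \<open>{v. v \<bullet> n = 0}\<close>. It is computed here as the determinant of the endomorphism of the ambient
  space that equals \<open>W\<close> on the tangent space and the identity on the normal line. A derivative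
  within the boundary is only determined on tangent vectors, and only its values there are
  used.\<close>

definition gauss_curvature :: "(real ^ 'n) set \<Rightarrow> real ^ 'n \<Rightarrow> real" where
  "gauss_curvature K x =
     (let n = gauss_map K x;
          W = frechet_derivative (gauss_map K) (at x within frontier K)
      in det (matrix (\<lambda>v. W (v - (v \<bullet> n) *\<^sub>R n) + (v \<bullet> n) *\<^sub>R n)))"

definition C2plus_convex_body :: "(real ^ 'n) set \<Rightarrow> bool" where
  "C2plus_convex_body K \<longleftrightarrow>
     convex_body K \<and> C2_hypersurface (frontier K) \<and> (\<forall>x\<in>frontier K. gauss_curvature K x > 0)"

text \<open>For a convex body \<open>K\<close> containing the origin and \<open>norm u = 1\<close>, the supremum is a maximum.\<close>

definition radial :: "('a::euclidean_space) set \<Rightarrow> 'a \<Rightarrow> real" where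
  "radial K u = Sup {r. r \<ge> 0 \<and> r *\<^sub>R u \<in> K}"

text \<open>Only the sets \<open>D t\<close> with \<open>0 \<le> t \<le> 1\<close> matter.\<close>

definition admissible_deformation ::
    "('a::euclidean_space) set \<Rightarrow> (real \<Rightarrow> 'a set) \<Rightarrow> bool" where
  "admissible_deformation K D \<longleftrightarrow>
     D 0 = K \<and> (\<forall>t\<in>{0..1}. convex_body (D t) \<and> K \<subseteq> D t) \<and>
     C2_on ({0..1} \<times> sphere 0 1) (\<lambda>(t, u). radial (D t) u)"

definition radial_speed :: "(real \<Rightarrow> ('a::euclidean_space) set) \<Rightarrow> 'a \<Rightarrow> real" where
  "radial_speed D u = vector_derivative (\<lambda>t. radial (D t) u) (at 0 within {0..1})"

text \<open>Intrinsic volumes as the coefficients in the Steiner formula; the \<open>k\<close>-th one is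
  meaningful for non-empty compact convex \<open>C\<close> and \<open>k \<le> DIM('a)\<close>.\<close>

definition intrinsic_volume :: "nat \<Rightarrow> ('a::euclidean_space) set \<Rightarrow> real" where
  "intrinsic_volume k C =
     (THE v. \<exists>c :: nat \<Rightarrow> real. c k = v \<and>
        (\<forall>r\<ge>0. measure lebesgue {x + r *\<^sub>R b | x b. x \<in> C \<and> b \<in> cball 0 1} =
           (\<Sum>j\<le>DIM('a). unit_ball_vol (real (DIM('a) - j)) * c j * r ^ (DIM('a) - j))))"

definition hyperplane :: "('a::euclidean_space) set \<Rightarrow> bool" where
  "hyperplane H \<longleftrightarrow> (\<exists>a b. a \<noteq> 0 \<and> H = {x. a \<bullet> x = b})"

definition tangent_hyperplane :: "('a::euclidean_space) set \<Rightarrow> 'a set \<Rightarrow> bool" where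
  "tangent_hyperplane K H \<longleftrightarrow> hyperplane H \<and> H \<inter> K \<noteq> {} \<and> H \<inter> interior K = {}"

definition closed_halfspace_of :: "('a::euclidean_space) set \<Rightarrow> 'a set \<Rightarrow> bool" where
  "closed_halfspace_of H P \<longleftrightarrow>
     (\<exists>a b. a \<noteq> 0 \<and> H = {x. a \<bullet> x = b} \<and> P = {x. a \<bullet> x \<ge> b})"

definition outer_halfspace :: "('a::euclidean_space) set \<Rightarrow> 'a set \<Rightarrow> 'a set" where
  "outer_halfspace K H = (THE P. closed_halfspace_of H P \<and> \<not> K \<subseteq> P)"

definition cap_exponent :: "nat \<Rightarrow> nat \<Rightarrow> real" where
  "cap_exponent d k = (if k = d then (real d + 1) / 2 else real k / 2)"

definition cap_ratio ::
    "nat \<Rightarrow> ('a::euclidean_space) set \<Rightarrow> (real \<Rightarrow> 'a set) \<Rightarrow> 'a set \<Rightarrow> real \<Rightarrow> real" where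
  "cap_ratio k K D H \<epsilon> =
     intrinsic_volume k (D \<epsilon> \<inter> outer_halfspace K H) / \<epsilon> powr cap_exponent DIM('a) k"

definition cap_limit ::
    "nat \<Rightarrow> ('a::euclidean_space) set \<Rightarrow> (real \<Rightarrow> 'a set) \<Rightarrow> 'a set \<Rightarrow> real" where
  "cap_limit k K D H = Lim (at_right 0) (cap_ratio k K D H)"

end

theory Submission
  imports Defs
begin

text \<open>
  Let \<open>x\<close> be the point of contact of the tangent hyperplane \<open>H\<close> and \<open>n\<close> its outer normal. With
  \<open>F y = norm y - radial K (sgn y)\<close>, which is \<open>\<le> 0\<close> exactly on \<open>K\<close>, second-order Taylor expansion
  gives \<open>F (x + v) = q v + o (q v)\<close> on the half-space \<open>v \<bullet> n \<ge> 0\<close>, where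
  \<open>q v = \<gamma> * (v \<bullet> n) + \<beta> v\<close> with \<open>\<gamma> > 0\<close> and \<open>\<beta>\<close> a quadratic form on the tangent space, positive
  definite because the Gauss curvature is positive. On the other hand \<open>x + v\<close> lies in the \<open>\<epsilon>\<close>-th body
  iff \<open>F (x + v) \<le> \<epsilon> * \<sigma> + o (\<epsilon>)\<close>, where \<open>\<sigma>\<close> is the radial speed at \<open>sgn x\<close>. So the cap is squeezed
  between the sets \<open>{v. 0 \<le> v \<bullet> n \<and> q v \<le> \<tau> * \<epsilon>}\<close> with \<open>\<tau>\<close> close to \<open>\<sigma>\<close>. These model caps scale like
  \<open>sqrt \<epsilon>\<close> tangentially and like \<open>\<epsilon>\<close> along \<open>n\<close>: for \<open>k < d\<close> only their limit shape, a flat ellipsoid,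
  matters, and for \<open>k = d\<close> the volume scales exactly. The limit is therefore \<open>M * \<sigma> powr \<alpha>\<close> with
  \<open>M > 0\<close> depending only on \<open>K\<close> and \<open>H\<close>, and it determines \<open>\<sigma>\<close>.

  The intrinsic volumes are controlled without polytopes. The volume of \<open>C + [0, s a]\<close> is affine in
  \<open>s\<close>, so that of \<open>C + Z\<close>, for a zonotope \<open>Z\<close>, is a multiaffine function of the lengths of the
  segments generating \<open>Z\<close>, with coefficients that are non-negative and monotone in \<open>C\<close>. The ball is a
  limit of zonotopes, which gives the Steiner formula together with the monotonicity of the
  intrinsic volumes.
\<close>

section \<open>Volumes of Minkowski sums with zonotopes\<close>

text \<open>What the local analysis delivers is only inclusions between convex sets, so the argument
  rests on monotonicity of the intrinsic volumes. This cannot be read off the Steiner formula: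
  monotone volumes do not force monotone polynomial coefficients. The multiaffine expansion repairs
  this, because each of its coefficients is by itself a limit of rescaled volumes. Moreover
  \<open>intrinsic_volume\<close> is a definite description, so it means nothing until the Steiner
  polynomial is known to exist for every body concerned, flat ones included.

  The smoothness of \<open>F\<close> near \<open>x\<close> is taken from the slice t = 0 of the
  local C2 extension of the radial functions; the same extension makes the expansion in t uniform
  for directions near \<open>sgn x\<close>. Since the error in \<open>F\<close> is measured relative
  to \<open>q\<close>, it can be absorbed into a change of the level from \<sigma> to \<tau>. When
  \<sigma> = 0 there is no inner model cap, and non-negativity of the intrinsic volumes takes its
  place.

  For the uniqueness the constant \<open>M\<close> has to be chosen before the deformation. Every
  direction \<open>u\<close> is then reached, because it is \<open>sgn x\<close> for the boundary
  point \<open>x\<close> on its ray.\<close>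

lemma compact_set_plus:
  fixes A B :: "'a::real_normed_vector set"
  assumes "compact A" "compact B"
  shows "compact (A + B)"
proof -
  have "A + B = {x + y | x y. x \<in> A \<and> y \<in> B}"
    by (auto simp: set_plus_def)
  then show ?thesis using compact_sums[OF assms] by simp
qed

lemma mem_segment_0:
  fixes a :: "'a::real_vector"
  shows "x \<in> closed_segment 0 a \<longleftrightarrow> (\<exists>t\<ge>0. t \<le> 1 \<and> x = t *\<^sub>R a)"
  by (auto simp: in_segment)

lemma mem_set_plus_segment:
  fixes a :: "'a::real_vector"
  assumes "0 \<le> s"
  shows "x \<in> C + closed_segment 0 (s *\<^sub>R a) \<longleftrightarrow> (\<exists>c\<in>C. \<exists>t\<ge>0. t \<le> s \<and> x = c + t *\<^sub>R a)"
proof -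
  have "closed_segment 0 (s *\<^sub>R a) = {t *\<^sub>R a |t. 0 \<le> t \<and> t \<le> s}"
  proof (cases "s = 0")
    case False
    have "t *\<^sub>R a \<in> closed_segment 0 (s *\<^sub>R a)" if "0 \<le> t" "t \<le> s" for t
      unfolding mem_segment_0 using that False by (intro exI[of _ "t / s"]) auto
    moreover have "\<exists>t'. x = t' *\<^sub>R a \<and> 0 \<le> t' \<and> t' \<le> s" if x: "x \<in> closed_segment 0 (s *\<^sub>R a)" for x
    proof -
      obtain t where "0 \<le> t" "t \<le> 1" "x = t *\<^sub>R s *\<^sub>R a"
        using x by (auto simp: mem_segment_0)
      then show ?thesis
        using assms by (intro exI[of _ "t * s"]) (auto simp: mult_left_le_one_le)
    qed
    ultimately show ?thesis by blast
  qed auto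
  then show ?thesis
    by (auto simp: set_plus_def)
qed

text \<open>Cauchy's functional equation. Non-negativity makes \<open>g\<close> monotone, so
  \<open>g (n * s)\<close> can be compared with \<open>g\<close> at the integers next to
  \<open>n * s\<close>.\<close>

lemma additive_nonneg_imp_linear:
  fixes g :: "real \<Rightarrow> real"
  assumes add: "\<And>s t. 0 \<le> s \<Longrightarrow> 0 \<le> t \<Longrightarrow> g (s + t) = g s + g t"
    and nonneg: "\<And>s. 0 \<le> s \<Longrightarrow> 0 \<le> g s" and "0 \<le> s"
  shows "g s = s * g 1"
proof -
  have g0: "g 0 = 0" using add[of 0 0] by simp
  have mono: "g x \<le> g y" if "0 \<le> x" "x \<le> y" for x y
    using add[of x "y - x"] nonneg[of "y - x"] that by simp
  have gn: "g (real n * x) = real n * g x" if "0 \<le> x" for n x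
    by (induction n) (use that g0 add in \<open>auto simp: algebra_simps\<close>)
  \<comment> \<open>The deviation from linearity is multiplied by \<open>n\<close> but stays within
    one step \<open>g 1\<close>, so by the Archimedean property it is zero.\<close>
  have bd: "real n * \<bar>g s - s * g 1\<bar> \<le> g 1" for n
  proof -
    define m where "m = nat \<lfloor>real n * s\<rfloor>"
    have m: "real m \<le> real n * s" "real n * s \<le> real m + 1"
      using \<open>0 \<le> s\<close> by (auto simp: m_def)
    have "real m * g 1 \<le> real n * g s" 
      using mono[of "real m" "real n * s"] m gn[of s n] gn[of 1 m] \<open>0 \<le> s\<close> by simp
    moreover have "real n * g s \<le> (real m + 1) * g 1"
      using mono[of "real n * s" "real (Suc m)"] m gn[of s n] gn[of 1 "Suc m"] \<open>0 \<le> s\<close> by (simp add: add.commute)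
    moreover have "real m * g 1 \<le> (real n * s) * g 1" "(real n * s) * g 1 \<le> (real m + 1) * g 1"
      using m nonneg[of 1] by (auto intro: mult_right_mono)
    ultimately have "\<bar>real n * g s - (real n * s) * g 1\<bar> \<le> g 1"
      by (auto simp: abs_le_iff algebra_simps)
    moreover have "real n * \<bar>g s - s * g 1\<bar> = \<bar>real n * g s - (real n * s) * g 1\<bar>"
      using abs_mult[of "real n" "g s - s * g 1"] by (simp add: algebra_simps)
    ultimately show ?thesis by simp
  qed
  show ?thesis
  proof (rule ccontr)
    assume "g s \<noteq> s * g 1"
    then obtain n where "g 1 < real n * \<bar>g s - s * g 1\<bar>"
      using reals_Archimedean3[of "\<bar>g s - s * g 1\<bar>"] by (auto simp: mult.commute)
    with bd[of n] show False by simp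
  qed
qed

text \<open>The set added when \<open>[0, s a]\<close> is lengthened to \<open>[0, (s + t) a]\<close> is the translate by \<open>s a\<close> of
  the one added when \<open>{0}\<close> is replaced by \<open>[0, t a]\<close>; so the increment of the volume is an additive
  function of the length.\<close>

lemma measure_plus_segment:
  fixes C :: "'a::euclidean_space set"
  assumes C: "compact C" "convex C" and "0 \<le> s"
  shows "measure lebesgue (C + closed_segment 0 (s *\<^sub>R a)) =
     measure lebesgue C + s * (measure lebesgue (C + closed_segment 0 a) - measure lebesgue C)"
proof -
  define D where "D s = C + closed_segment 0 (s *\<^sub>R a)" for s
  have memD: "x \<in> D s \<longleftrightarrow> (\<exists>c\<in>C. \<exists>t\<ge>0. t \<le> s \<and> x = c + t *\<^sub>R a)" if "0 \<le> s" for x s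
    unfolding D_def by (rule mem_set_plus_segment[OF that])
  have lm: "D s \<in> lmeasurable" for s
    unfolding D_def by (intro lmeasurable_compact compact_set_plus C compact_segment)
  have D0: "D 0 = C" by (simp add: D_def)
  have sub: "D s \<subseteq> D t" if "0 \<le> s" "s \<le> t" for s t
    using that memD[of s] memD[of t] by (force intro: order_trans)
  have shift: "D (s + t) - D s = (+) (s *\<^sub>R a) ` (D t - C)" if st: "0 \<le> s" "0 \<le> t" for s t
  proof (intro equalityI subsetI)
    fix x assume x: "x \<in> D (s + t) - D s"
    then obtain c r where c: "c \<in> C" "0 \<le> r" "r \<le> s + t" "x = c + r *\<^sub>R a"
      using memD st by auto
    have "s < r"
    proof (rule ccontr)
      assume "\<not> s < r"
      then have "\<exists>c\<in>C. \<exists>t\<ge>0. t \<le> s \<and> x = c + t *\<^sub>R a"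
        using c by (intro bexI[of _ c] exI[of _ r]) auto
      then have "x \<in> D s" using memD[OF \<open>0 \<le> s\<close>] by simp
      with x show False by simp
    qed
    then have "x - s *\<^sub>R a \<in> D t"
      using c st by (auto simp: memD algebra_simps intro!: bexI[of _ c] exI[of _ "r - s"])
    moreover have "x - s *\<^sub>R a \<notin> C"
    proof
      assume "x - s *\<^sub>R a \<in> C"
      then have "x \<in> D s" using st by (auto simp: memD intro!: bexI[of _ "x - s *\<^sub>R a"] exI[of _ s])
      with x show False by simp
    qed
    ultimately show "x \<in> (+) (s *\<^sub>R a) ` (D t - C)"
      by (intro image_eqI[of _ _ "x - s *\<^sub>R a"]) auto
  next
    fix x assume "x \<in> (+) (s *\<^sub>R a) ` (D t - C)"
    then obtain p where p: "p \<in> D t" "p \<notin> C" "x = s *\<^sub>R a + p" by auto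
    then obtain c r where c: "c \<in> C" "0 \<le> r" "r \<le> t" "p = c + r *\<^sub>R a"
      using memD st by auto
    have "x \<in> D (s + t)"
      using c st p by (auto simp: memD algebra_simps intro!: bexI[of _ c] exI[of _ "r + s"])
    moreover have "x \<notin> D s"
    proof
      assume "x \<in> D s"
      then obtain c' r' where c': "c' \<in> C" "0 \<le> r'" "r' \<le> s" "x = c' + r' *\<^sub>R a"
        using memD st by auto
      define q where "q = s - r'"
      have q: "0 \<le> q" "c' = p + q *\<^sub>R a" using c' p by (auto simp: q_def algebra_simps)
      \<comment> \<open>On the line through \<open>p\<close> in direction \<open>a\<close>, the
        point \<open>c\<close> sits at parameter \<open>- r\<close> and \<open>c'\<close> at
        \<open>q\<close>; so \<open>p\<close> lies between two points of the convex set
        \<open>C\<close>.\<close>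
      have "p \<in> C"
      proof (cases "r + q = 0")
        case True
        then have "r = 0" using c q by linarith
        then show ?thesis using c by simp
      next
        case False
        have "(q / (r + q)) *\<^sub>R c + (r / (r + q)) *\<^sub>R c' \<in> C"
          using c c' q False by (intro convexD[OF \<open>convex C\<close>]) (auto simp: add_divide_distrib[symmetric])
        moreover have "(q / (r + q)) *\<^sub>R c + (r / (r + q)) *\<^sub>R c' = p"
        proof -
          have "(q / (r + q)) *\<^sub>R c + (r / (r + q)) *\<^sub>R c' =
             (q / (r + q) + r / (r + q)) *\<^sub>R p + (- (q / (r + q) * r) + r / (r + q) * q) *\<^sub>R a"
            using q(2) c(4) by (simp add: algebra_simps)
          also have "q / (r + q) + r / (r + q) = 1"
            using False by (simp add: add_divide_distrib[symmetric])
          finally show ?thesis by simp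
        qed
        ultimately show ?thesis by simp
      qed
      with p show False by simp
    qed
    ultimately show "x \<in> D (s + t) - D s" by simp
  qed
  define g where "g s = measure lebesgue (D s) - measure lebesgue C" for s
  have diff: "measure lebesgue (D t - D s) = measure lebesgue (D t) - measure lebesgue (D s)"
    if "0 \<le> s" "s \<le> t" for s t
    using lm sub[OF that] by (intro measurable_measure_Diff) auto
  have "g (s + t) = g s + g t" if "0 \<le> s" "0 \<le> t" for s t
    using diff[of s "s + t"] diff[of 0 t] that shift[OF that]
    by (simp add: measure_translation g_def D0)
  moreover have "0 \<le> g s" if "0 \<le> s" for s
    using diff[of 0 s] measure_nonneg[of lebesgue "D s - C"] that by (simp add: g_def D0)
  ultimately have "g s = s * g 1"
    using additive_nonneg_imp_linear[of g s] \<open>0 \<le> s\<close> by blast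
  then show ?thesis
    by (simp add: g_def D_def algebra_simps)
qed

text \<open>The segments start at 0 instead of being centred: lengthening a generator then enlarges
  the set, and the support function is a sum of terms
  \<open>max 0 (a i \<bullet> v)\<close>.\<close>

definition zonotope :: "'i set \<Rightarrow> ('i \<Rightarrow> 'a::real_vector) \<Rightarrow> 'a set" where
  "zonotope I a = (\<Sum>i\<in>I. closed_segment 0 (a i))"

lemma zonotope_empty [simp]: "zonotope {} a = {0}"
  by (simp add: zonotope_def)

lemma zonotope_insert:
  "finite I \<Longrightarrow> i \<notin> I \<Longrightarrow> zonotope (insert i I) a = closed_segment 0 (a i) + zonotope I a"
  by (simp add: zonotope_def)

lemma mem_zonotope:
  assumes "finite I"
  shows "x \<in> zonotope I a \<longleftrightarrow> (\<exists>t. (\<forall>i\<in>I. 0 \<le> t i \<and> t i \<le> 1) \<and> x = (\<Sum>i\<in>I. t i *\<^sub>R a i))"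
proof
  assume "x \<in> zonotope I a"
  then obtain s where s: "x = sum s I" "\<And>i. i \<in> I \<Longrightarrow> s i \<in> closed_segment 0 (a i)"
    unfolding zonotope_def set_sum_alt[OF assms] by auto
  then have "\<forall>i\<in>I. \<exists>t. 0 \<le> t \<and> t \<le> 1 \<and> s i = t *\<^sub>R a i"
    by (auto simp: mem_segment_0)
  then obtain t where "\<And>i. i \<in> I \<Longrightarrow> 0 \<le> t i \<and> t i \<le> 1 \<and> s i = t i *\<^sub>R a i"
    by metis
  then show "\<exists>t. (\<forall>i\<in>I. 0 \<le> t i \<and> t i \<le> 1) \<and> x = (\<Sum>i\<in>I. t i *\<^sub>R a i)"
    using s by (intro exI[of _ t]) (auto intro: sum.cong)
next
  assume "\<exists>t. (\<forall>i\<in>I. 0 \<le> t i \<and> t i \<le> 1) \<and> x = (\<Sum>i\<in>I. t i *\<^sub>R a i)"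
  then show "x \<in> zonotope I a"
    unfolding zonotope_def set_sum_alt[OF assms] by (auto simp: mem_segment_0)
qed

lemma compact_zonotope:
  fixes a :: "'i \<Rightarrow> 'a::real_normed_vector"
  shows "finite I \<Longrightarrow> compact (zonotope I a)"
  by (induction I rule: finite_induct) (auto simp: zonotope_insert intro: compact_set_plus)

lemma convex_zonotope: "finite I \<Longrightarrow> convex (zonotope I a)"
  by (induction I rule: finite_induct) (auto simp: zonotope_insert intro: convex_set_plus)

text \<open>Induction over the generators with \<open>C\<close> arbitrary. The volume is affine in
  the length \<open>s j\<close> of the new generator; its slope is the difference of the values for
  \<open>C + [0, a j]\<close> and for \<open>C\<close>, and both are multiaffine in the other
  lengths by the induction hypothesis. Hence the coefficients \<open>c1 - c0\<close> for the sets
  containing \<open>j\<close>.\<close>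

lemma measure_plus_zonotope:
  fixes C :: "'a::euclidean_space set" and a :: "'i \<Rightarrow> 'a"
  assumes "finite I" "compact C" "convex C"
  shows "\<exists>c. \<forall>s. (\<forall>i\<in>I. 0 \<le> s i) \<longrightarrow>
    measure lebesgue (C + zonotope I (\<lambda>i. s i *\<^sub>R a i)) = (\<Sum>S\<in>Pow I. c S * (\<Prod>i\<in>S. s i))"
  using assms
proof (induction I arbitrary: C rule: finite_induct)
  case empty
  then show ?case by (intro exI[of _ "\<lambda>_. measure lebesgue C"]) (auto simp: add_0_right)
next
  case (insert j I)
  let ?Z = "\<lambda>s::'i \<Rightarrow> real. zonotope I (\<lambda>i. s i *\<^sub>R a i)"
  let ?C1 = "C + closed_segment 0 (a j)"
  have C1: "compact ?C1" "convex ?C1"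
    using insert.prems by (auto intro: compact_set_plus convex_set_plus)
  obtain c0 where c0: "\<And>s. (\<forall>i\<in>I. 0 \<le> s i) \<Longrightarrow>
      measure lebesgue (C + ?Z s) = (\<Sum>S\<in>Pow I. c0 S * (\<Prod>i\<in>S. s i))"
    using insert.IH[OF insert.prems] by blast
  obtain c1 where c1: "\<And>s. (\<forall>i\<in>I. 0 \<le> s i) \<Longrightarrow>
      measure lebesgue (?C1 + ?Z s) = (\<Sum>S\<in>Pow I. c1 S * (\<Prod>i\<in>S. s i))"
    using insert.IH[OF C1] by blast
  define c where "c S = (if j \<in> S then c1 (S - {j}) - c0 (S - {j}) else c0 S)" for S
  show ?case
  proof (intro exI[of _ c] allI impI)
    fix s :: "'i \<Rightarrow> real" assume s: "\<forall>i\<in>insert j I. 0 \<le> s i"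
    have CZ: "compact (C + ?Z s)" "convex (C + ?Z s)"
      using insert by (auto intro: compact_set_plus convex_set_plus compact_zonotope convex_zonotope)
    have "C + zonotope (insert j I) (\<lambda>i. s i *\<^sub>R a i) = (C + ?Z s) + closed_segment 0 (s j *\<^sub>R a j)"
      using insert by (simp add: zonotope_insert ac_simps)
    also have "measure lebesgue \<dots> = measure lebesgue (C + ?Z s) +
        s j * (measure lebesgue ((C + ?Z s) + closed_segment 0 (a j)) - measure lebesgue (C + ?Z s))"
      using s by (intro measure_plus_segment CZ) auto
    also have "(C + ?Z s) + closed_segment 0 (a j) = ?C1 + ?Z s"
      by (simp add: ac_simps)
    also have "measure lebesgue (C + ?Z s) + s j * (measure lebesgue \<dots> - measure lebesgue (C + ?Z s)) =
       (\<Sum>S\<in>Pow I. c0 S * (\<Prod>i\<in>S. s i)) + (\<Sum>S\<in>Pow I. (c1 S - c0 S) * (s j * (\<Prod>i\<in>S. s i)))"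
    proof -
      have eq: "measure lebesgue (C + ?Z s) = (\<Sum>S\<in>Pow I. c0 S * (\<Prod>i\<in>S. s i))"
        "measure lebesgue (?C1 + ?Z s) = (\<Sum>S\<in>Pow I. c1 S * (\<Prod>i\<in>S. s i))"
        using c0 c1 s by auto
      show ?thesis
        unfolding eq by (simp add: sum_subtractf sum_distrib_left algebra_simps)
    qed
    also have "(\<Sum>S\<in>Pow I. c0 S * (\<Prod>i\<in>S. s i)) = (\<Sum>S\<in>Pow I. c S * (\<Prod>i\<in>S. s i))"
      using insert by (intro sum.cong) (auto simp: c_def)
    also have "(\<Sum>S\<in>Pow I. (c1 S - c0 S) * (s j * (\<Prod>i\<in>S. s i))) =
       (\<Sum>S\<in>insert j ` Pow I. c S * (\<Prod>i\<in>S. s i))"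
    proof (subst sum.reindex)
      show "inj_on (insert j) (Pow I)"
      proof (rule inj_onI)
        fix x y assume "x \<in> Pow I" "y \<in> Pow I" "insert j x = insert j y"
        then have "insert j x - {j} = insert j y - {j}" "j \<notin> x" "j \<notin> y"
          using insert.hyps by auto
        then show "x = y" by simp
      qed
      have "(c1 S - c0 S) * (s j * (\<Prod>i\<in>S. s i)) = c (insert j S) * (\<Prod>i\<in>insert j S. s i)"
        if "S \<in> Pow I" for S
      proof -
        have "finite S" "j \<notin> S" using that insert.hyps finite_subset by auto
        then show ?thesis by (simp add: c_def)
      qed
      then show "(\<Sum>S\<in>Pow I. (c1 S - c0 S) * (s j * (\<Prod>i\<in>S. s i))) =
          (\<Sum>S\<in>Pow I. ((\<lambda>S. c S * (\<Prod>i\<in>S. s i)) \<circ> insert j) S)"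
        by (intro sum.cong) auto
    qed
    also have "(\<Sum>S\<in>Pow I. c S * (\<Prod>i\<in>S. s i)) + (\<Sum>S\<in>insert j ` Pow I. c S * (\<Prod>i\<in>S. s i)) =
        (\<Sum>S\<in>Pow (insert j I). c S * (\<Prod>i\<in>S. s i))"
      unfolding Pow_insert using insert by (intro sum.union_disjoint[symmetric]) auto
    finally show "measure lebesgue (C + zonotope (insert j I) (\<lambda>i. s i *\<^sub>R a i)) =
        (\<Sum>S\<in>Pow (insert j I). c S * (\<Prod>i\<in>S. s i))" .
  qed
qed

lemma tendsto_power_ratio_at_top:
  "((\<lambda>t::real. t ^ m / t ^ n) \<longlongrightarrow> (if m = n then 1 else 0)) at_top" if "m \<le> n"
proof (cases "m = n")
  case True
  have "eventually (\<lambda>t::real. t ^ m / t ^ n = 1) at_top"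
    using eventually_gt_at_top[of 0] by eventually_elim (simp add: True)
  then show ?thesis using True by (simp add: tendsto_eventually)
next
  case False
  then have "0 < n - m" using that by simp
  then have "((\<lambda>t::real. inverse (t ^ (n - m))) \<longlongrightarrow> 0) at_top"
    by (intro tendsto_inverse_0_at_top filterlim_pow_at_top filterlim_ident)
  moreover have "eventually (\<lambda>t::real. inverse (t ^ (n - m)) = t ^ m / t ^ n) at_top"
    using eventually_gt_at_top[of 0]
    by eventually_elim (use that in \<open>simp add: power_diff field_simps\<close>)
  ultimately show ?thesis using False by (simp add: tendsto_cong)
qed

text \<open>\<open>J\<close> is its only subset of full cardinality, so every other term is of lower
  order.\<close>

lemma tendsto_subset_poly_top_coeff:
  fixes e :: "'i set \<Rightarrow> real"
  assumes "finite J"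
  shows "((\<lambda>t. (\<Sum>S\<in>Pow J. e S * t ^ card S) / t ^ card J) \<longlongrightarrow> e J) at_top"
proof -
  have "((\<lambda>t. \<Sum>S\<in>Pow J. e S * (t ^ card S / t ^ card J)) \<longlongrightarrow>
      (\<Sum>S\<in>Pow J. e S * (if card S = card J then 1 else 0))) at_top"
    using assms by (intro tendsto_sum tendsto_mult tendsto_const tendsto_power_ratio_at_top card_mono) auto
  also have "(\<Sum>S\<in>Pow J. e S * (if card S = card J then 1 else 0)) = (\<Sum>S\<in>Pow J. if S = J then e S else 0)"
    using assms by (intro sum.cong) (auto dest: card_subset_eq)
  also have "\<dots> = e J" using assms by (simp add: sum.delta)
  finally show ?thesis by (simp add: sum_divide_distrib)
qed

lemma multiaffine_restrict:
  fixes c :: "'i set \<Rightarrow> real"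
  assumes "finite I" "J \<subseteq> I"
  shows "(\<Sum>S\<in>Pow I. c S * (\<Prod>i\<in>S. if i \<in> J then t else 0)) = (\<Sum>S\<in>Pow J. c S * t ^ card S)"
proof -
  have "(\<Prod>i\<in>S. if i \<in> J then t else 0) = (if S \<subseteq> J then t ^ card S else 0)" if "S \<in> Pow I" for S
  proof (cases "S \<subseteq> J")
    case True
    then have "(\<Prod>i\<in>S. if i \<in> J then t else 0) = (\<Prod>i\<in>S. t)"
      by (intro prod.cong) auto
    then show ?thesis using True by simp
  next
    case False
    then show ?thesis using that assms finite_subset[of S I] by (auto intro!: prod_zero)
  qed
  then have "(\<Sum>S\<in>Pow I. c S * (\<Prod>i\<in>S. if i \<in> J then t else 0)) =
      (\<Sum>S\<in>Pow I. if S \<in> Pow J then c S * t ^ card S else 0)"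
    by (intro sum.cong) auto
  also have "\<dots> = (\<Sum>S\<in>Pow J. c S * t ^ card S)"
    using assms by (subst sum.inter_restrict[symmetric]) (auto simp: Int_absorb1 Pow_mono)
  finally show ?thesis .
qed

lemma measure_le_ball_pow:
  fixes C :: "'a::euclidean_space set"
  assumes "C \<subseteq> cball 0 r" "C \<in> lmeasurable" "0 \<le> r"
  shows "measure lebesgue C \<le> unit_ball_vol (real DIM('a)) * r ^ DIM('a)"
proof -
  have "measure lebesgue C \<le> measure lebesgue (cball (0::'a) r)"
    using assms by (intro measure_mono_fmeasurable) auto
  then show ?thesis using assms content_cball[of r "0::'a"] by simp
qed

lemma zonotope_norm_le:
  assumes "finite I" "x \<in> zonotope I a"
  shows "norm x \<le> (\<Sum>i\<in>I. norm (a i))"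
proof -
  obtain t where t: "\<forall>i\<in>I. 0 \<le> t i \<and> t i \<le> 1" "x = (\<Sum>i\<in>I. t i *\<^sub>R a i)"
    using assms mem_zonotope by metis
  show ?thesis unfolding t(2)
    using t(1) by (intro order_trans[OF norm_sum] sum_mono) (auto intro: mult_left_le_one_le)
qed

lemma zonotope_scaleR_if:
  assumes "finite I" "J \<subseteq> I"
  shows "zonotope I (\<lambda>i. (if i \<in> J then t else 0) *\<^sub>R a i) = zonotope J (\<lambda>i. t *\<^sub>R a i)"
  unfolding zonotope_def using assms
  by (intro sum.mono_neutral_cong_right) auto

text \<open>The coefficient of \<open>\<Prod>i\<in>S. s i\<close> is the leading coefficient in \<open>t\<close> along \<open>s i = t\<close> for \<open>i \<in> S\<close>,
  \<open>s i = 0\<close> otherwise; hence it inherits positivity and monotonicity from the volume.\<close>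

lemma measure_plus_zonotope_poly:
  fixes a :: "'i \<Rightarrow> 'a::euclidean_space"
  assumes I: "finite I"
  shows "\<exists>f :: 'a set \<Rightarrow> nat \<Rightarrow> real. \<forall>C. compact C \<and> convex C \<longrightarrow>
     (\<forall>j. 0 \<le> f C j) \<and>
     (\<forall>t\<ge>0. measure lebesgue (C + zonotope I (\<lambda>i. t *\<^sub>R a i)) = (\<Sum>j\<le>DIM('a). f C j * t ^ j)) \<and>
     (\<forall>C' j. compact C' \<and> convex C' \<and> C \<subseteq> C' \<longrightarrow> f C j \<le> f C' j)"
proof -
  let ?d = "DIM('a)"
  let ?Z = "\<lambda>J t. zonotope J (\<lambda>i. t *\<^sub>R a i)"
  have "\<forall>C. \<exists>c. compact C \<and> convex C \<longrightarrow> (\<forall>s. (\<forall>i\<in>I. 0 \<le> s i) \<longrightarrow>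
    measure lebesgue (C + zonotope I (\<lambda>i. s i *\<^sub>R a i)) = (\<Sum>S\<in>Pow I. c S * (\<Prod>i\<in>S. s i)))"
    using measure_plus_zonotope[OF I] by blast
  then obtain c where c: "\<And>C s. compact C \<Longrightarrow> convex C \<Longrightarrow> (\<forall>i\<in>I. 0 \<le> s i) \<Longrightarrow>
    measure lebesgue (C + zonotope I (\<lambda>i. s i *\<^sub>R a i)) = (\<Sum>S\<in>Pow I. c C S * (\<Prod>i\<in>S. s i))"
    by metis
  have cJ: "measure lebesgue (C + ?Z J t) = (\<Sum>S\<in>Pow J. c C S * t ^ card S)"
    if "compact C" "convex C" "J \<subseteq> I" "0 \<le> t" for C J t
    using c[OF that(1,2), of "\<lambda>i. if i \<in> J then t else 0"] that
    by (simp add: zonotope_scaleR_if[OF I] multiaffine_restrict[OF I])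
  have lim: "((\<lambda>t. measure lebesgue (C + ?Z J t) / t ^ card J) \<longlongrightarrow> c C J) at_top"
    if "compact C" "convex C" "J \<subseteq> I" for C J
  proof -
    have "eventually (\<lambda>t. (\<Sum>S\<in>Pow J. c C S * t ^ card S) / t ^ card J = measure lebesgue (C + ?Z J t) / t ^ card J) at_top"
      using eventually_ge_at_top[of 0] by eventually_elim (simp add: cJ that)
    moreover have "finite J" using that I finite_subset by blast
    ultimately show ?thesis
      by (intro Lim_transform_eventually[OF tendsto_subset_poly_top_coeff[of J "c C"]])
  qed
  have lm: "C + ?Z J t \<in> lmeasurable" if "compact C" "J \<subseteq> I" for C J t
    using that I finite_subset by (intro lmeasurable_compact compact_set_plus compact_zonotope) auto
  have nonneg: "0 \<le> c C J" if "compact C" "convex C" "J \<subseteq> I" for C J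
  proof (rule tendsto_lowerbound[OF lim[OF that]])
    show "eventually (\<lambda>t. 0 \<le> measure lebesgue (C + ?Z J t) / t ^ card J) at_top"
      using eventually_ge_at_top[of 0] by eventually_elim simp
  qed simp
  have mono: "c C J \<le> c C' J"
    if "compact C" "convex C" "compact C'" "convex C'" "C \<subseteq> C'" "J \<subseteq> I" for C C' J
  proof (rule tendsto_le[OF _ lim lim])
    show "eventually (\<lambda>t. measure lebesgue (C + ?Z J t) / t ^ card J \<le> measure lebesgue (C' + ?Z J t) / t ^ card J) at_top"
      using eventually_ge_at_top[of 0]
    proof eventually_elim
      case (elim t)
      have "measure lebesgue (C + ?Z J t) \<le> measure lebesgue (C' + ?Z J t)"
        using lm that by (intro measure_mono_fmeasurable set_plus_mono2 fmeasurableD) auto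
      then show ?case using elim by (intro divide_right_mono) auto
    qed
  qed (use that in auto)
  \<comment> \<open>\<open>C + t Z\<close> fits into a ball whose radius grows linearly in
    \<open>t\<close>, so its volume is of order \<open>t ^ d\<close> at most. This bounds the degree
    by the dimension, however many generators there are.\<close>
  have vanish: "c C J = 0" if C: "compact C" "convex C" "J \<subseteq> I" and J: "?d < card J" for C J
  proof -
    have fJ: "finite J" using that I finite_subset by blast
    obtain r where r: "0 < r" "C \<subseteq> cball 0 r"
      using compact_imp_bounded[OF C(1)] by (auto simp: bounded_pos subset_iff)
    define m where "m = (\<Sum>i\<in>J. norm (a i))"
    have m: "0 \<le> m" by (auto simp: m_def sum_nonneg)
    have "measure lebesgue (C + ?Z J t) / t ^ card J \<le>
        unit_ball_vol (real ?d) * (r + m) ^ ?d * (t ^ ?d / t ^ card J)" if t: "1 \<le> t" for t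
    proof -
      have "C + ?Z J t \<subseteq> cball 0 ((r + m) * t)"
      proof
        fix x assume "x \<in> C + ?Z J t"
        then obtain y z where yz: "y \<in> C" "z \<in> ?Z J t" "x = y + z" by (auto simp: set_plus_def)
        have "norm z \<le> m * t" using zonotope_norm_le[OF fJ yz(2)] t
          by (simp add: m_def sum_distrib_left mult.commute)
        moreover have "norm y \<le> r * t"
        proof -
          have "norm y \<le> r" using r yz by auto
          also have "r * 1 \<le> r * t" using r t by (intro mult_left_mono) auto
          then have "r \<le> r * t" by simp
          finally show ?thesis .
        qed
        ultimately show "x \<in> cball 0 ((r + m) * t)"
          using norm_triangle_ineq[of y z] yz by (simp add: algebra_simps)
      qed
      then have "measure lebesgue (C + ?Z J t) \<le> unit_ball_vol (real ?d) * ((r + m) * t) ^ ?d"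
        using r m t lm that C by (intro measure_le_ball_pow) auto
      then show ?thesis using t by (simp add: divide_simps power_mult_distrib mult_ac)
    qed
    then have ev: "eventually (\<lambda>t. measure lebesgue (C + ?Z J t) / t ^ card J \<le>
        unit_ball_vol (real ?d) * (r + m) ^ ?d * (t ^ ?d / t ^ card J)) at_top"
      by (rule eventually_mono[OF eventually_ge_at_top[of 1]])
    have lim0: "((\<lambda>t. unit_ball_vol (real ?d) * (r + m) ^ ?d * (t ^ ?d / t ^ card J)) \<longlongrightarrow>
        unit_ball_vol (real ?d) * (r + m) ^ ?d * 0) at_top"
      using tendsto_power_ratio_at_top[of ?d "card J"] J by (intro tendsto_mult tendsto_const) auto
    have "c C J \<le> 0"
      using tendsto_le[OF _ lim0 lim[OF C] ev] by simp
    with nonneg[OF C] show ?thesis by simp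
  qed
  \<comment> \<open>With all lengths equal to \<open>t\<close>, the terms are collected by the
    number of generators that they involve.\<close>
  define f where "f C j = (\<Sum>S\<in>{S\<in>Pow I. card S = j}. c C S)" for C j
  show ?thesis
  proof (intro exI[of _ f] allI impI conjI; (elim conjE)?)
    fix C :: "'a set" assume C: "compact C" "convex C"
    show "0 \<le> f C j" for j unfolding f_def by (rule sum_nonneg, rule nonneg[OF C]) simp
    show "f C j \<le> f C' j" if "compact C'" "convex C'" "C \<subseteq> C'" for C' j
      unfolding f_def by (rule sum_mono, rule mono) (use C that in auto)
    fix t :: real assume t: "0 \<le> t"
    have "measure lebesgue (C + ?Z I t) = (\<Sum>S\<in>Pow I. c C S * t ^ card S)"
      using cJ[OF C order_refl t] .
    also have "\<dots> = (\<Sum>S\<in>{S\<in>Pow I. card S \<le> ?d}. c C S * t ^ card S)"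
      using I vanish[OF C] by (intro sum.mono_neutral_right) auto
    also have "\<dots> = (\<Sum>j\<le>?d. \<Sum>S\<in>{S\<in>{S\<in>Pow I. card S \<le> ?d}. card S = j}. c C S * t ^ card S)"
      using I by (intro sum.group[symmetric]) auto
    also have "\<dots> = (\<Sum>j\<le>?d. f C j * t ^ j)"
      unfolding f_def sum_distrib_right by (intro sum.cong) auto
    finally show "measure lebesgue (C + ?Z I t) = (\<Sum>j\<le>?d. f C j * t ^ j)" .
  qed
qed

section \<open>Lebesgue measure under linear and orthogonal maps\<close>

lemma open_linear_image:
  fixes T :: "'a::euclidean_space \<Rightarrow> 'a"
  assumes "linear T" "inj T" "open S"
  shows "open (T ` S)"
  using assms by (intro open_surjective_linear_image) (auto simp: linear_injective_imp_surjective)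

lemma negligible_linear_image_same_dim:
  fixes T :: "'a::euclidean_space \<Rightarrow> 'a"
  assumes "linear T" "negligible S"
  shows "negligible (T ` S)"
  using assms by (intro negligible_differentiable_image_negligible) (auto simp: linear_imp_differentiable_on)

text \<open>By Vitali's covering theorem it suffices to look at the images of balls, which are all
  homothetic to the image of the unit ball.\<close>

lemma emeasure_linear_image_open:
  fixes T :: "'a::euclidean_space \<Rightarrow> 'a"
  assumes T: "linear T" "inj T" and S: "open S"
  shows "emeasure lebesgue (T ` S) =
    emeasure lebesgue (T ` ball 0 1) / emeasure lebesgue (ball (0::'a) 1) * emeasure lebesgue S"
proof -
  let ?m = "emeasure lebesgue :: 'a set \<Rightarrow> ennreal"
  define c where "c = ?m (T ` ball 0 1) / ?m (ball 0 1)"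
  have m0: "?m (ball 0 1) \<noteq> 0" "?m (ball 0 1) \<noteq> \<infinity>"
    using emeasure_lborel_ball_finite[of "0::'a" 1] open_not_negligible[of "ball (0::'a) 1"]
    by (auto simp: negligible_iff_emeasure0)
  have c1: "?m (T ` ball 0 1) = c * ?m (ball 0 1)"
    unfolding c_def ennreal_divide_times using m0 by (simp add: ennreal_divide_self less_top)
  have ball: "?m (T ` ball x r) = c * ?m (ball x r)" if "0 < r" for x r
  proof -
    have b: "ball x r = (\<lambda>y. r *\<^sub>R y + x) ` ball 0 1"
    proof (intro equalityI subsetI)
      fix y assume "y \<in> ball x r"
      then have "norm (y - x) < r" by (simp add: dist_norm norm_minus_commute)
      then show "y \<in> (\<lambda>y. r *\<^sub>R y + x) ` ball 0 1"
        using that by (intro image_eqI[of _ _ "(1 / r) *\<^sub>R (y - x)"]) auto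
    qed (use that in \<open>auto simp: dist_norm\<close>)
    have "T ` ball x r = (\<lambda>y. r *\<^sub>R y + T x) ` (T ` ball 0 1)"
      unfolding b image_image using T(1) by (simp add: linear_add linear_scale)
    then show ?thesis
      unfolding b using emeasure_lebesgue_affine[of r "T x" "T ` ball 0 1"] emeasure_lebesgue_affine[of r x "ball 0 1"]
      by (simp add: c1 mult_ac)
  qed
  define K where "K = {p :: 'a \<times> real. 0 < snd p \<and> ball (fst p) (snd p) \<subseteq> S}"
  have "\<exists>i. i \<in> K \<and> x \<in> ball (fst i) (snd i) \<and> snd i < d" if "x \<in> S" "0 < d" for x d
  proof -
    obtain e where e: "0 < e" "ball x e \<subseteq> S" using S \<open>x \<in> S\<close> openE by blast
    show ?thesis
      using e that by (intro exI[of _ "(x, min e (d/2))"]) (auto simp: K_def)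
  qed
  then obtain C where C: "countable C" "C \<subseteq> K"
    "pairwise (\<lambda>i j. disjnt (ball (fst i) (snd i)) (ball (fst j) (snd j))) C"
    "negligible (S - (\<Union>i\<in>C. ball (fst i) (snd i)))"
    using Vitali_covering_theorem_balls[of S K fst snd] by blast
  let ?B = "\<lambda>i::'a \<times> real. ball (fst i) (snd i)"
  let ?U = "\<Union>i\<in>C. ?B i"
  have US: "?U \<subseteq> S" using C(2) by (auto simp: K_def)
  have opT: "open (T ` X)" if "open X" for X using open_linear_image[OF T that] .
  have "open ?U" by (intro open_UN ballI open_ball)
  have Us: "?U \<in> sets lebesgue" "S \<in> sets lebesgue"
    using borel_open[OF \<open>open ?U\<close>] borel_open[OF S]
    by (simp_all only: sets_completionI_sets sets_lborel)
  have "?m S = ?m ?U"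
  proof (rule antisym)
    have "?U \<union> (S - ?U) = S" using US by blast
    then have "?m S = ?m (?U \<union> (S - ?U))" by (rule arg_cong[symmetric])
    also have "\<dots> \<le> ?m ?U + ?m (S - ?U)"
      using Us by (intro emeasure_subadditive sets.Diff)
    finally show "?m S \<le> ?m ?U"
      using C(4) negligible_iff_emeasure0[OF negligible_imp_sets[OF C(4)]] by simp
    show "?m ?U \<le> ?m S" by (rule emeasure_mono[OF US Us(2)])
  qed
  also have "\<dots> = (\<integral>\<^sup>+i. ?m (?B i) \<partial>count_space C)"
    using C(1,3) by (intro emeasure_UN_countable) (auto simp: disjoint_family_on_def pairwise_def disjnt_def)
  finally have mS: "?m S = (\<integral>\<^sup>+i. ?m (?B i) \<partial>count_space C)" .
  have "?m (T ` S) = ?m (\<Union>i\<in>C. T ` ?B i)"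
  proof (rule antisym)
    have neg: "negligible (T ` (S - ?U))" by (rule negligible_linear_image_same_dim[OF T(1) C(4)])
    have op: "open (\<Union>i\<in>C. T ` ?B i)" using opT by blast
    have "?m (T ` S) \<le> ?m ((\<Union>i\<in>C. T ` ?B i) \<union> T ` (S - ?U))"
    proof (rule emeasure_mono)
      show "T ` S \<subseteq> (\<Union>i\<in>C. T ` ?B i) \<union> T ` (S - ?U)" by blast
    qed (use neg op in \<open>auto simp: negligible_imp_sets intro!: sets.Un\<close>)
    also have "\<dots> \<le> ?m (\<Union>i\<in>C. T ` ?B i) + ?m (T ` (S - ?U))"
      using neg op by (intro emeasure_subadditive) (auto simp: negligible_imp_sets)
    also have "?m (T ` (S - ?U)) = 0"
      using negligible_iff_emeasure0[OF negligible_imp_sets[OF neg]] neg by blast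
    finally show "?m (T ` S) \<le> ?m (\<Union>i\<in>C. T ` ?B i)" by simp
    show "?m (\<Union>i\<in>C. T ` ?B i) \<le> ?m (T ` S)"
      using US opT[OF S] by (intro emeasure_mono) auto
  qed
  also have "\<dots> = (\<integral>\<^sup>+i. ?m (T ` ?B i) \<partial>count_space C)"
  proof (intro emeasure_UN_countable)
    show "disjoint_family_on (\<lambda>i. T ` ?B i) C"
      unfolding disjoint_family_on_def
    proof (intro ballI impI)
      fix i j assume "i \<in> C" "j \<in> C" "i \<noteq> j"
      then have "?B i \<inter> ?B j = {}" using C(3) by (auto simp: pairwise_def disjnt_def)
      then show "T ` ?B i \<inter> T ` ?B j = {}" using T(2) by (simp add: image_Int[symmetric])
    qed
  qed (use C(1) opT in auto)
  also have "\<dots> = (\<integral>\<^sup>+i. c * ?m (?B i) \<partial>count_space C)"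
    using C(2) by (intro nn_integral_cong) (auto simp: K_def ball)
  also have "\<dots> = c * ?m S"
    unfolding mS by (intro nn_integral_cmult) auto
  finally show ?thesis by (simp add: c_def)
qed

text \<open>The frontier of a convex set is negligible and remains so under \<open>T\<close>, so the
  formula for open sets can be applied to the interior. The factor stays a ratio for the unit ball;
  it is evaluated on a convenient body wherever its value matters.\<close>

lemma measure_linear_image_convex:
  fixes T :: "'a::euclidean_space \<Rightarrow> 'a"
  assumes T: "linear T" "inj T" and S: "compact S" "convex S"
  shows "measure lebesgue (T ` S) =
    measure lebesgue (T ` ball 0 1) / measure lebesgue (ball (0::'a) 1) * measure lebesgue S"
proof -
  have im: "compact (T ` S)"
    using S T by (intro compact_continuous_image linear_continuous_on) (auto simp: linear_linear)
  have neg: "negligible (S - interior S)"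
    using negligible_convex_frontier[OF S(2)] closure_subset
    by (rule_tac negligible_subset) (auto simp: frontier_def)
  have sub: "interior S - S \<union> (S - interior S) = S - interior S"
    "T ` interior S - T ` S \<union> (T ` S - T ` interior S) \<subseteq> T ` (S - interior S)"
    using interior_subset[of S] by auto
  have 1: "measure lebesgue S = measure lebesgue (interior S)"
    using S sub(1) neg lmeasurable_compact[of S] compact_imp_bounded[of S]
    by (intro measure_negligible_symdiff) (auto intro: lmeasurable_interior)
  have bd: "bounded (T ` interior S)" "open (T ` interior S)"
    using bounded_subset[OF compact_imp_bounded[OF im] image_mono[OF interior_subset]] open_linear_image[OF T]
    by auto
  have 2: "measure lebesgue (T ` S) = measure lebesgue (T ` interior S)"
    using bd negligible_subset[OF negligible_linear_image_same_dim[OF T(1) neg] sub(2)]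
    by (intro measure_negligible_symdiff lmeasurable_open) auto
  have 3: "T ` ball 0 1 \<in> lmeasurable"
    using T by (intro lmeasurable_open open_linear_image bounded_linear_image) (auto simp: linear_linear)
  have 4: "interior S \<in> lmeasurable"
    using S by (intro lmeasurable_interior) (auto simp: compact_imp_bounded)
  have "emeasure lebesgue (T ` interior S) =
    emeasure lebesgue (T ` ball 0 1) / emeasure lebesgue (ball (0::'a) 1) * emeasure lebesgue (interior S)"
    by (rule emeasure_linear_image_open[OF T open_interior])
  moreover have "measure lebesgue (ball (0::'a) 1) > 0"
    by (metis content_ball_gt_0_iff zero_less_one measure_completion sets_lborel borel_open open_ball)
  ultimately have "ennreal (measure lebesgue (T ` interior S)) =
    ennreal (measure lebesgue (T ` ball 0 1) / measure lebesgue (ball (0::'a) 1)) * ennreal (measure lebesgue (interior S))"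
    using 3 4 bd lmeasurable_open[OF bd]
    by (simp add: emeasure_eq_measure2 divide_ennreal)
  also have "\<dots> = ennreal (measure lebesgue (T ` ball 0 1) / measure lebesgue (ball (0::'a) 1) * measure lebesgue (interior S))"
    by (rule ennreal_mult[symmetric]) auto
  finally have "measure lebesgue (T ` interior S) =
    measure lebesgue (T ` ball 0 1) / measure lebesgue (ball (0::'a) 1) * measure lebesgue (interior S)"
    by (subst (asm) ennreal_inj) auto
  then show ?thesis
    by (simp add: 1 2)
qed

text \<open>The unit ball is mapped onto itself, so the scaling factor is 1.\<close>

lemma measure_orthogonal_image_convex:
  fixes f :: "'a::euclidean_space \<Rightarrow> 'a"
  assumes f: "orthogonal_transformation f" and S: "compact S" "convex S"
  shows "measure lebesgue (f ` S) = measure lebesgue S"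
proof -
  have "f ` ball 0 1 = ball 0 1" using image_orthogonal_transformation_ball[OF f, of 0 1] f
    by (simp add: orthogonal_transformation_linear linear_0)
  moreover have "measure lebesgue (ball (0::'a) 1) > 0"
    by (metis content_ball_gt_0_iff zero_less_one measure_completion sets_lborel borel_open open_ball)
  ultimately show ?thesis
    using measure_linear_image_convex[OF _ _ S, of f] f
    by (simp add: orthogonal_transformation_linear orthogonal_transformation_inj)
qed

text \<open>Lebesgue measure is determined by its values on boxes. The preimage of a box is its
  image under the inverse map, whose factor is 1 because it preserves the unit ball. In this form
  the invariance serves as a change of variables in integrals.\<close>

lemma distr_lborel_orthogonal:
  fixes f :: "'a::euclidean_space \<Rightarrow> 'a"
  assumes f: "orthogonal_transformation f"
  shows "distr lborel borel f = lborel"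
proof -
  define g where "g = inv f"
  have g: "orthogonal_transformation g"
    unfolding g_def by (rule orthogonal_transformation_inv[OF f])
  have fm: "f \<in> borel_measurable lborel"
    using f by (auto intro!: borel_measurable_continuous_onI linear_continuous_on simp: orthogonal_transformation_linear linear_linear)
  have gb: "g ` ball 0 1 = ball 0 1" using image_orthogonal_transformation_ball[OF g, of 0 1] g
    by (simp add: orthogonal_transformation_linear linear_0)
  have "emeasure (distr lborel borel f) (box l u) = (\<Prod>b\<in>Basis. (u - l) \<bullet> b)"
    if le: "\<And>b. b \<in> Basis \<Longrightarrow> l \<bullet> b \<le> u \<bullet> b" for l u
  proof -
    have m0: "emeasure lebesgue (ball (0::'a) 1) \<noteq> 0" "emeasure lebesgue (ball (0::'a) 1) \<noteq> \<infinity>"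
      using emeasure_lborel_ball_finite[of "0::'a" 1] open_not_negligible[of "ball (0::'a) 1"]
      by (auto simp: negligible_iff_emeasure0)
    have lin: "linear g" "inj g" using g by (auto simp: orthogonal_transformation_linear orthogonal_transformation_inj)
    have "emeasure (distr lborel borel f) (box l u) = emeasure lborel (f -` box l u)"
      using fm by (simp add: emeasure_distr)
    also have "f -` box l u = g ` box l u"
      unfolding g_def by (metis bij_vimage_eq_inv_image f orthogonal_transformation_bij)
    also have "emeasure lborel (g ` box l u) = emeasure lebesgue (g ` box l u)"
      using open_linear_image[OF lin open_box, of l u] by simp
    also have "\<dots> = emeasure lebesgue (box l u)"
      using emeasure_linear_image_open[OF lin open_box, of l u] ennreal_divide_self[OF m0(1)] m0(2)
      by (simp add: gb less_top)
    finally show ?thesis using emeasure_lborel_box[OF le] by simp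
  qed
  then show ?thesis by (intro lborel_eqI[symmetric]) auto
qed

section \<open>The ball as a limit of zonotopes\<close>

lemma zonotope_inner_le:
  fixes a :: "'i \<Rightarrow> 'a::real_inner"
  assumes "finite I" "x \<in> zonotope I a"
  shows "x \<bullet> v \<le> (\<Sum>i\<in>I. max 0 (a i \<bullet> v))"
proof -
  obtain t where t: "\<forall>i\<in>I. 0 \<le> t i \<and> t i \<le> 1" "x = (\<Sum>i\<in>I. t i *\<^sub>R a i)"
    using assms mem_zonotope by metis
  have "t i * (a i \<bullet> v) \<le> max 0 (a i \<bullet> v)" if "i \<in> I" for i
  proof -
    have "t i * (a i \<bullet> v) \<le> t i * max 0 (a i \<bullet> v)"
      using t that by (intro mult_left_mono) auto
    also have "\<dots> \<le> max 0 (a i \<bullet> v)" using t that by (intro mult_left_le_one_le) auto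
    finally show ?thesis .
  qed
  then show ?thesis unfolding t(2) by (simp add: inner_sum_left sum_mono)
qed

text \<open>The sum of exactly those generators that have non-negative inner product with
  \<open>v\<close> attains the upper bound; so the bound is the support function of the
  zonotope.\<close>

lemma zonotope_inner_attained:
  fixes a :: "'i \<Rightarrow> 'a::real_inner"
  assumes "finite I"
  shows "\<exists>x\<in>zonotope I a. x \<bullet> v = (\<Sum>i\<in>I. max 0 (a i \<bullet> v))"
proof
  let ?t = "\<lambda>i. if 0 \<le> a i \<bullet> v then 1 else 0 :: real"
  show "(\<Sum>i\<in>I. ?t i *\<^sub>R a i) \<in> zonotope I a"
    unfolding mem_zonotope[OF assms] by (intro exI[of _ ?t]) auto
  show "(\<Sum>i\<in>I. ?t i *\<^sub>R a i) \<bullet> v = (\<Sum>i\<in>I. max 0 (a i \<bullet> v))"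
    unfolding inner_sum_left by (intro sum.cong) auto
qed

text \<open>Comparison of support functions. For the outer inclusion a point \<open>x\<close> of the
  zonotope is tested against \<open>v = x\<close>; for the inner one a missing point is separated
  from the compact convex zonotope by a hyperplane.\<close>

lemma zonotope_between_balls:
  fixes a :: "'i \<Rightarrow> 'a::euclidean_space"
  assumes I: "finite I" and "0 \<le> \<beta>"
    and h: "\<And>v. \<alpha> * norm v \<le> (\<Sum>i\<in>I. max 0 (a i \<bullet> v))" "\<And>v. (\<Sum>i\<in>I. max 0 (a i \<bullet> v)) \<le> \<beta> * norm v"
  shows "cball 0 \<alpha> \<subseteq> zonotope I a" "zonotope I a \<subseteq> cball 0 \<beta>"
proof -
  show "zonotope I a \<subseteq> cball 0 \<beta>"
  proof
    fix x assume "x \<in> zonotope I a"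
    then have "norm x * norm x \<le> \<beta> * norm x"
      using zonotope_inner_le[OF I, of x a x] h(2)[of x] by (simp add: dot_square_norm power2_eq_square)
    then show "x \<in> cball 0 \<beta>"
      using \<open>0 \<le> \<beta>\<close> by (cases "x = 0") auto
  qed
  show "cball 0 \<alpha> \<subseteq> zonotope I a"
  proof (rule ccontr)
    assume "\<not> cball 0 \<alpha> \<subseteq> zonotope I a"
    then obtain z where z: "z \<in> cball 0 \<alpha>" "z \<notin> zonotope I a" by blast
    obtain w b where wb: "w \<bullet> z < b" "\<forall>x\<in>zonotope I a. w \<bullet> x > b"
      using separating_hyperplane_closed_point[OF convex_zonotope[OF I] compact_imp_closed[OF compact_zonotope[OF I]] z(2)]
      by blast
    obtain x where x: "x \<in> zonotope I a" "x \<bullet> (-w) = (\<Sum>i\<in>I. max 0 (a i \<bullet> (-w)))"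
      using zonotope_inner_attained[OF I] by blast
    have "x \<bullet> (-w) < z \<bullet> (-w)" using wb x by (force simp: inner_commute)
    also have "\<dots> \<le> norm z * norm (-w)" by (rule norm_cauchy_schwarz)
    also have "\<dots> \<le> \<alpha> * norm (-w)" using z by (intro mult_right_mono) auto
    also have "\<dots> \<le> x \<bullet> (-w)" unfolding x(2) by (rule h(1))
    finally show False by simp
  qed
qed

text \<open>The ball is a zonoid: its support function is, up to a constant, the integral of
  \<open>max 0 (\<psi> x \<bullet> v)\<close> for any rotation equivariant vector field \<open>\<psi>\<close> of compact support, and the
  Riemann sums of this integral are support functions of zonotopes.\<close>

lemma rotation_invariant_integral:
  fixes e :: "real ^ 'n"
  defines "\<psi> \<equiv> \<lambda>x :: real ^ 'n. max 0 (1 - norm x) *\<^sub>R x"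
    and "Q \<equiv> cbox (- One) (One :: real ^ 'n)"
  assumes "norm e = 1"
  shows "integral Q (\<lambda>x. max 0 (\<psi> x \<bullet> v)) = norm v * integral Q (\<lambda>x. max 0 (\<psi> x \<bullet> e))"
proof -
  have zero: "\<psi> x = 0" if "x \<notin> Q" for x
  proof -
    have "\<not> norm x \<le> 1"
    proof
      assume "norm x \<le> 1"
      then have "\<bar>x \<bullet> b\<bar> \<le> 1" if "b \<in> Basis" for b
        using Basis_le_norm[OF that, of x] by linarith
      then have "x \<in> Q" by (auto simp: Q_def mem_box abs_le_iff)
      with that show False by simp
    qed
    then show ?thesis by (simp add: \<psi>_def)
  qed
  have cont: "continuous_on S (\<lambda>x. max 0 (\<psi> x \<bullet> w))" for S w
    unfolding \<psi>_def by (intro continuous_intros)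
  have int: "integrable lborel (\<lambda>x. max 0 (\<psi> x \<bullet> w))" for w
  proof -
    have "integrable lborel (\<lambda>x. indicator Q x *\<^sub>R max 0 (\<psi> x \<bullet> w))"
      by (intro borel_integrable_compact cont) (auto simp: Q_def)
    moreover have "(\<lambda>x. indicator Q x *\<^sub>R max 0 (\<psi> x \<bullet> w)) = (\<lambda>x. max 0 (\<psi> x \<bullet> w))"
      using zero by (auto simp: indicator_def fun_eq_iff)
    ultimately show ?thesis by simp
  qed
  have eq: "integral Q (\<lambda>x. max 0 (\<psi> x \<bullet> w)) = (\<integral>x. max 0 (\<psi> x \<bullet> w) \<partial>lborel)" for w
  proof -
    have "integral Q (\<lambda>x. max 0 (\<psi> x \<bullet> w)) = integral UNIV (\<lambda>x. if x \<in> Q then max 0 (\<psi> x \<bullet> w) else 0)"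
      by (rule Henstock_Kurzweil_Integration.integral_restrict_UNIV[symmetric])
    also have "(\<lambda>x. if x \<in> Q then max 0 (\<psi> x \<bullet> w) else 0) = (\<lambda>x. max 0 (\<psi> x \<bullet> w))"
      using zero by (auto simp: fun_eq_iff)
    finally show ?thesis using integral_lborel[OF int] by simp
  qed
  \<comment> \<open>The direction of \<open>v\<close>, with default \<open>e\<close> for
    \<open>v = 0\<close>: then \<open>norm u = 1\<close> always holds and scaling by
    \<open>norm v\<close> covers both cases.\<close>
  define u where "u = (if v = 0 then e else v /\<^sub>R norm v)"
  have u: "norm u = 1" "v = norm v *\<^sub>R u" using assms(3) by (auto simp: u_def)
  obtain g where g: "orthogonal_transformation g" "g e = u"
    using orthogonal_transformation_exists[of e u] u assms(3) by metis
  have gm: "g \<in> borel_measurable lborel"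
    using g by (auto intro!: borel_measurable_continuous_onI linear_continuous_on simp: orthogonal_transformation_linear linear_linear)
  have \<psi>g: "\<psi> (g x) = g (\<psi> x)" for x
    using g by (simp add: \<psi>_def orthogonal_transformation_norm orthogonal_transformation_linear linear_scale)
  have "(\<integral>x. max 0 (\<psi> x \<bullet> u) \<partial>lborel) = (\<integral>x. max 0 (\<psi> x \<bullet> u) \<partial>(distr lborel borel g))"
    by (simp add: distr_lborel_orthogonal[OF g(1)])
  also have "\<dots> = (\<integral>x. max 0 (\<psi> (g x) \<bullet> u) \<partial>lborel)"
    using gm by (intro integral_distr borel_measurable_continuous_onI cont) auto
  also have "\<dots> = (\<integral>x. max 0 (\<psi> x \<bullet> e) \<partial>lborel)"
    using g by (simp add: \<psi>g g(2)[symmetric] orthogonal_transformation_def)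
  finally have "integral Q (\<lambda>x. max 0 (\<psi> x \<bullet> u)) = integral Q (\<lambda>x. max 0 (\<psi> x \<bullet> e))"
    by (simp add: eq)
  moreover have "max 0 (\<psi> x \<bullet> v) = norm v * max 0 (\<psi> x \<bullet> u)" for x
    by (subst u(2)) (auto simp: max_def zero_le_mult_iff mult_le_0_iff)
  ultimately show ?thesis by simp
qed

text \<open>A fine tagged division serves as index set, which explains the type of \<open>I\<close>:
  pairs of a tag and a cell. The generator of a cell is \<open>\<psi>\<close> at the tag, weighted
  by the volume of the cell and normalised by the constant \<open>c\<close> of the rotation
  invariant integral. The error is uniform in the direction of \<open>v\<close> because
  \<open>max 0 (y \<bullet> v)\<close> is Lipschitz in \<open>y\<close> with constant
  \<open>norm v\<close>.\<close>

lemma ball_zonoid: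
  assumes "0 < \<delta>"
  shows "\<exists>(I :: ((real ^ 'n) \<times> (real ^ 'n) set) set) a. finite I \<and> (\<forall>v::real ^ 'n.
     (1 - \<delta>) * norm v \<le> (\<Sum>i\<in>I. max 0 (a i \<bullet> v)) \<and> (\<Sum>i\<in>I. max 0 (a i \<bullet> v)) \<le> (1 + \<delta>) * norm v)"
proof -
  define \<psi> where "\<psi> x = max 0 (1 - norm x) *\<^sub>R x" for x :: "real ^ 'n"
  define Q where "Q = cbox (- One) (One :: real ^ 'n)"
  define e :: "real ^ 'n" where "e = (SOME i. i \<in> Basis)"
  have e: "norm e = 1" using SOME_Basis by (simp add: e_def)
  define c where "c = integral Q (\<lambda>x. max 0 (\<psi> x \<bullet> e))"
  have J: "integral Q (\<lambda>x. max 0 (\<psi> x \<bullet> v)) = norm v * c" for v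
    unfolding c_def Q_def \<psi>_def by (rule rotation_invariant_integral[OF e])
  have cont: "continuous_on S (\<lambda>x. max 0 (\<psi> x \<bullet> w))" for S w
    unfolding \<psi>_def by (intro continuous_intros)
  have int: "(\<lambda>x. max 0 (\<psi> x \<bullet> w)) integrable_on Q" for w
    unfolding Q_def by (intro integrable_continuous cont)
  \<comment> \<open>Otherwise the continuous non-negative integrand would vanish throughout the
    cube, but at \<open>e /\<^sub>R 2\<close> it equals 1/4.\<close>
  have "c \<noteq> 0"
  proof
    assume "c = 0"
    have "((\<lambda>x. max 0 (\<psi> x \<bullet> e)) has_integral 0) Q"
      using integrable_integral[OF int[of e]] \<open>c = 0\<close> by (simp add: c_def)
    moreover have "e /\<^sub>R 2 \<in> Q"
    proof -
      have "\<bar>(e /\<^sub>R 2) \<bullet> b\<bar> \<le> 1" if "b \<in> Basis" for b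
        using Basis_le_norm[OF that, of "e /\<^sub>R 2"] e by (simp add: norm_divide)
      then show ?thesis by (auto simp: Q_def mem_box abs_le_iff) (smt (verit))
    qed
    moreover have "box (- One) (One :: real ^ 'n) \<noteq> {}"
      by (simp add: box_ne_empty)
    ultimately have "max 0 (\<psi> (e /\<^sub>R 2) \<bullet> e) = 0"
      unfolding Q_def by (intro has_integral_0_cbox_imp_0[OF cont]) auto
    then show False using e by (simp add: \<psi>_def dot_square_norm)
  qed
  moreover have "0 \<le> c" unfolding c_def by (intro integral_nonneg int) auto
  ultimately have c: "0 < c" by simp
  define V where "V = measure lborel Q"
  have V: "0 < V" unfolding V_def Q_def content_pos_lt_eq by simp
  \<comment> \<open>Oscillation \<eta> on every cell costs \<open>\<eta> * norm v * V\<close> in the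
    Riemann sum; after division by \<open>c\<close> this is
    \<open>\<delta> * norm v\<close>.\<close>
  define \<eta> where "\<eta> = \<delta> * c / V"
  have \<eta>: "0 < \<eta>" using c V assms by (simp add: \<eta>_def)
  have "uniformly_continuous_on Q \<psi>"
    unfolding Q_def \<psi>_def by (intro compact_uniformly_continuous continuous_intros) auto
  then obtain r where r: "0 < r" "\<And>x y. x \<in> Q \<Longrightarrow> y \<in> Q \<Longrightarrow> dist y x < r \<Longrightarrow> dist (\<psi> y) (\<psi> x) < \<eta>"
    using \<eta> unfolding uniformly_continuous_on_def by metis
  have "gauge (\<lambda>x::real ^ 'n. ball x r)" using r by (intro gauge_ball)
  then obtain p where p: "p tagged_division_of Q" "(\<lambda>x. ball x r) fine p"
    unfolding Q_def using fine_division_exists by blast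
  have fp: "finite p" using p(1) by auto
  define a :: "(real ^ 'n) \<times> (real ^ 'n) set \<Rightarrow> real ^ 'n" where "a = (\<lambda>(x, K). (measure lborel K / c) *\<^sub>R \<psi> x)"
  have sum_eq: "(\<Sum>i\<in>p. max 0 (a i \<bullet> v)) = (\<Sum>(x,K)\<in>p. measure lborel K * max 0 (\<psi> x \<bullet> v)) / c" for v
    unfolding sum_divide_distrib
  proof (intro sum.cong refl, clarify)
    fix x K
    have "max 0 (r * y) = r * max 0 y" if "0 \<le> r" for r y :: real
      using that by (cases "0 \<le> y") (auto simp: max_def mult_le_0_iff zero_le_mult_iff)
    from this[of "measure lborel K / c" "\<psi> x \<bullet> v"]
    show "max 0 (a (x, K) \<bullet> v) = measure lborel K * max 0 (\<psi> x \<bullet> v) / c"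
      using c by (simp add: a_def)
  qed
  have bound: "\<bar>norm v * c - (\<Sum>(x,K)\<in>p. measure lborel K * max 0 (\<psi> x \<bullet> v))\<bar> \<le> \<eta> * norm v * V" for v
  proof -
    let ?f = "\<lambda>x. max 0 (\<psi> x \<bullet> v)"
    have "norm v * c = (\<Sum>(x,K)\<in>p. integral K ?f)"
      unfolding J[symmetric] Q_def
      by (rule integral_combine_tagged_division_topdown) (use int p(1) in \<open>auto simp: Q_def\<close>)
    then have "norm v * c - (\<Sum>(x,K)\<in>p. measure lborel K * ?f x) = (\<Sum>(x,K)\<in>p. integral K ?f - measure lborel K * ?f x)"
      by (simp add: sum_subtractf split_def)
    also have "\<bar>\<dots>\<bar> \<le> (\<Sum>(x,K)\<in>p. \<eta> * norm v * measure lborel K)"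
    proof (rule order_trans[OF sum_abs], intro sum_mono, clarify)
      fix x K assume xK: "(x, K) \<in> p"
      obtain l u where K: "K = cbox l u" using tagged_division_ofD(4)[OF p(1) xK] by blast
      have KQ: "K \<subseteq> Q" "x \<in> K" using tagged_division_ofD(2,3)[OF p(1) xK] by auto
      have Kr: "K \<subseteq> ball x r" using p(2) xK by (auto simp: fine_def)
      have intK: "?f integrable_on cbox l u" by (intro integrable_continuous cont)
      have "((\<lambda>y. ?f y - ?f x) has_integral (integral K ?f - measure lborel K * ?f x)) (cbox l u)"
        unfolding K using has_integral_diff[OF integrable_integral[OF intK] has_integral_const[of "?f x" l u]]
        by simp
      moreover have "norm (?f y - ?f x) \<le> \<eta> * norm v" if y: "y \<in> cbox l u" for y
      proof -
        have "dist (\<psi> y) (\<psi> x) < \<eta>"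
          using y K KQ Kr by (intro r(2)) (auto simp: dist_commute subset_iff)
        then have "\<bar>(\<psi> y - \<psi> x) \<bullet> v\<bar> \<le> \<eta> * norm v"
          using Cauchy_Schwarz_ineq2[of "\<psi> y - \<psi> x" v] mult_right_mono[of "norm (\<psi> y - \<psi> x)" \<eta> "norm v"]
          by (auto simp: dist_norm)
        then show ?thesis by (auto simp: inner_diff_left max_def)
      qed
      ultimately have "norm (integral K ?f - measure lborel K * ?f x) \<le> \<eta> * norm v * measure lborel (cbox l u)"
        using \<eta> by (intro has_integral_bound) auto
      then show "\<bar>integral K ?f - measure lborel K * ?f x\<bar> \<le> \<eta> * norm v * measure lborel K"
        by (simp add: K)
    qed
    also have "\<dots> = \<eta> * norm v * (\<Sum>(x,K)\<in>p. measure lborel K)"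
      by (simp add: sum_distrib_left split_def)
    also have "(\<Sum>(x,K)\<in>p. measure lborel K) = V"
      unfolding V_def Q_def by (rule additive_content_tagged_division) (use p(1) in \<open>simp add: Q_def\<close>)
    finally show ?thesis .
  qed
  have approx: "\<bar>norm v - (\<Sum>i\<in>p. max 0 (a i \<bullet> v))\<bar> \<le> \<delta> * norm v" for v
  proof -
    have "\<bar>norm v - (\<Sum>i\<in>p. max 0 (a i \<bullet> v))\<bar> = \<bar>norm v * c - (\<Sum>(x,K)\<in>p. measure lborel K * max 0 (\<psi> x \<bullet> v))\<bar> / c"
    proof -
      have "norm v - s / c = (norm v * c - s) / c" for s using c by (simp add: field_simps)
      then show ?thesis unfolding sum_eq using c by (simp add: abs_divide)
    qed
    also have "\<dots> \<le> \<eta> * norm v * V / c" using bound c by (intro divide_right_mono) auto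
    also have "\<dots> = \<delta> * norm v" using c V by (simp add: \<eta>_def)
    finally show ?thesis .
  qed
  have "(1 - \<delta>) * norm v \<le> (\<Sum>i\<in>p. max 0 (a i \<bullet> v)) \<and> (\<Sum>i\<in>p. max 0 (a i \<bullet> v)) \<le> (1 + \<delta>) * norm v" for v
    using approx[of v] by (auto simp: abs_le_iff left_diff_distrib distrib_right)
  with fp show ?thesis by blast
qed

section \<open>The Steiner formula\<close>

text \<open>Lagrange interpolation at the nodes 0, ..., d: \<open>L i\<close> is the basis
  polynomial with factors \<open>(X - m) / (i - m)\<close>, and the weights are its coefficients.
  They do not depend on \<open>c\<close>, so each coefficient is one fixed linear functional of the
  values.\<close>

lemma ex_coeff_weights:
  "\<exists>w :: nat \<Rightarrow> nat \<Rightarrow> real. \<forall>c. \<forall>j\<le>d. c j = (\<Sum>i\<le>d. w j i * (\<Sum>l\<le>d. c l * real i ^ l))"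
proof -
  define L where "L i = (\<Prod>m\<in>{..d} - {i}. [:- (real m / (real i - real m)), 1 / (real i - real m):])" for i
  have L_eval: "poly (L i) (real m) = (if m = i then 1 else 0)" if "i \<le> d" "m \<le> d" for i m
  proof (cases "m = i")
    case True
    have "poly (L i) (real i) = (\<Prod>m\<in>{..d} - {i}. 1)"
      unfolding L_def poly_prod by (intro prod.cong) (auto simp: divide_simps)
    then show ?thesis using True by simp
  next
    case False
    then show ?thesis unfolding L_def poly_prod using that
      by (auto intro!: bexI[of _ m])
  qed
  have L_deg: "degree (L i) \<le> d" if "i \<le> d" for i
  proof -
    have "degree (L i) \<le> (\<Sum>m\<in>{..d} - {i}. 1)"
      unfolding L_def by (rule order_trans[OF degree_prod_sum_le]) (auto intro!: sum_mono)
    then show ?thesis using that by simp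
  qed
  show ?thesis
  proof (intro exI[of _ "\<lambda>j i. coeff (L i) j"] allI impI)
    fix c :: "nat \<Rightarrow> real" and j assume j: "j \<le> d"
    define p where "p = (\<Sum>l\<le>d. monom (c l) l)"
    define q where "q = (\<Sum>i\<le>d. smult (poly p (real i)) (L i))"
    have pe: "poly p x = (\<Sum>l\<le>d. c l * x ^ l)" for x
      by (simp add: p_def poly_sum poly_monom)
    have "p = q"
    proof (rule poly_eqI_degree)
      show "poly p x = poly q x" if xd: "x \<in> real ` {..d}" for x
      proof -
        obtain m where "m \<in> {..d}" and "x = real m" using xd by (rule imageE)
        then have m: "m \<le> d" "x = real m" by simp_all
        have "poly q x = (\<Sum>i\<le>d. poly p (real i) * (if m = i then 1 else 0))"
          unfolding q_def poly_sum by (intro sum.cong) (auto simp: m L_eval)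
        then show ?thesis using m by (simp add: if_distrib[where f="\<lambda>x. _ * x"] cong: if_cong)
      qed
      have "card (real ` {..d}) = Suc d" by (simp add: card_image)
      moreover have "degree p \<le> d" unfolding p_def
        by (intro degree_sum_le) (auto intro: order_trans[OF degree_monom_le])
      moreover have "degree q \<le> d" unfolding q_def
        by (intro degree_sum_le) (auto intro: order_trans[OF degree_smult_le] L_deg)
      ultimately show "card (real ` {..d}) > degree p" "card (real ` {..d}) > degree q" by auto
    qed
    have "c j = coeff p j" using j by (simp add: p_def coeff_sum)
    also have "\<dots> = coeff q j" using \<open>p = q\<close> by simp
    also have "\<dots> = (\<Sum>i\<le>d. coeff (L i) j * (\<Sum>l\<le>d. c l * real i ^ l))"
      by (simp add: q_def coeff_sum pe mult.commute)
    finally show "c j = (\<Sum>i\<le>d. coeff (L i) j * (\<Sum>l\<le>d. c l * real i ^ l))" .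
  qed
qed

definition interp_weight :: "nat \<Rightarrow> nat \<Rightarrow> nat \<Rightarrow> real" where
  "interp_weight d = (SOME w. \<forall>c. \<forall>j\<le>d. c j = (\<Sum>i\<le>d. w j i * (\<Sum>l\<le>d. c l * real i ^ l)))"

lemma interp_weight:
  assumes "j \<le> d"
  shows "c j = (\<Sum>i\<le>d. interp_weight d j i * (\<Sum>l\<le>d. c l * real i ^ l))"
  using someI_ex[OF ex_coeff_weights[of d]] assms unfolding interp_weight_def by blast

text \<open>The coefficients of the Steiner polynomial are read off by interpolation at the radii
  \<open>0, \<dots>, d\<close>; this makes them linear functionals of the parallel volumes, so every limit or
  invariance statement for volumes carries over to them.\<close>

definition steiner_coeff :: "'a::euclidean_space set \<Rightarrow> nat \<Rightarrow> real" where
  "steiner_coeff C j =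
    (\<Sum>i\<le>DIM('a). interp_weight DIM('a) j i * measure lebesgue (C + cball 0 (real i)))"

lemma steiner_coeff_unique:
  fixes C :: "'a::euclidean_space set"
  assumes "\<And>r. 0 \<le> r \<Longrightarrow> measure lebesgue (C + cball 0 r) = (\<Sum>j\<le>DIM('a). c j * r ^ j)" "j \<le> DIM('a)"
  shows "steiner_coeff C j = c j"
  unfolding steiner_coeff_def using assms interp_weight[of j "DIM('a)" c] by simp

lemma measure_scaleR_image:
  fixes C :: "'a::euclidean_space set"
  shows "measure lebesgue ((\<lambda>x. m *\<^sub>R x) ` C) = \<bar>m\<bar> ^ DIM('a) * measure lebesgue C"
  using measure_lebesgue_affine[of m 0 C] by simp

text \<open>For \<open>0 \<in> C\<close> convexity gives \<open>m C \<subseteq> C\<close>. A change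
  of the radius by a factor can thus be compensated by a dilation of the whole body, which only
  multiplies the volume by a power of the factor. This is how volumes are controlled when the added
  ball is replaced by a nearby zonotope.\<close>

lemma scaleR_parallel_subset:
  fixes C :: "'a::real_normed_vector set"
  assumes "convex C" "0 \<in> C" "0 \<le> m" "m \<le> 1"
  shows "(\<lambda>x. m *\<^sub>R x) ` (C + cball 0 t) \<subseteq> C + cball 0 (m * t)"
proof (clarify elim!: set_plus_elim)
  fix c b assume c: "c \<in> C" and b: "b \<in> cball (0::'a) t"
  have "m *\<^sub>R c + (1 - m) *\<^sub>R 0 \<in> C" using assms c by (intro convexD) auto
  then have "m *\<^sub>R c + m *\<^sub>R b \<in> C + cball 0 (m * t)"
    using b assms by (intro set_plus_intro) (auto intro: mult_left_mono)
  then show "m *\<^sub>R (c + b) \<in> C + cball 0 (m * t)" by (simp add: scaleR_add_right)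
qed

lemma parallel_subset_scaleR:
  fixes C :: "'a::real_normed_vector set"
  assumes "convex C" "0 \<in> C" "1 \<le> m"
  shows "C + cball 0 (m * t) \<subseteq> (\<lambda>x. m *\<^sub>R x) ` (C + cball 0 t)"
proof
  fix x assume x: "x \<in> C + cball 0 (m * t)"
  have "(1 / m) *\<^sub>R x \<in> C + cball 0 (1 / m * (m * t))"
    using scaleR_parallel_subset[of C "1 / m" "m * t"] assms x by auto
  then show "x \<in> (\<lambda>x. m *\<^sub>R x) ` (C + cball 0 t)"
    using assms by (intro image_eqI[of _ _ "(1 / m) *\<^sub>R x"]) auto
qed

lemma lmeasurable_parallel:
  fixes C :: "'a::euclidean_space set"
  shows "compact C \<Longrightarrow> C + cball 0 r \<in> lmeasurable"
  by (intro lmeasurable_compact compact_set_plus compact_cball)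

text \<open>By the dilation inclusions, squeezing \<open>Z m t\<close> between two balls squeezes
  the volume of \<open>C + Z m t\<close> between \<open>(1 - \<delta> m) ^ d\<close> and
  \<open>(1 + \<delta> m) ^ d\<close> times that of the parallel body. So the zonotope coefficients
  converge to \<open>steiner_coeff\<close>, and sign, polynomial identity and monotonicity survive
  in the limit.\<close>

lemma steiner_0:
  fixes C :: "(real ^ 'n) set"
  assumes C: "compact C" "convex C" "0 \<in> C"
  shows "\<And>j. j \<le> CARD('n) \<Longrightarrow> 0 \<le> steiner_coeff C j"
    and "\<And>r. 0 \<le> r \<Longrightarrow> measure lebesgue (C + cball 0 r) = (\<Sum>j\<le>CARD('n). steiner_coeff C j * r ^ j)"
    and "\<And>C' j. compact C' \<Longrightarrow> convex C' \<Longrightarrow> C \<subseteq> C' \<Longrightarrow> j \<le> CARD('n) \<Longrightarrow> steiner_coeff C j \<le> steiner_coeff C' j"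
proof -
  let ?d = "DIM(real ^ 'n)"
  \<comment> \<open>\<open>Suc (Suc m)\<close> keeps \<open>\<delta> m < 1\<close> also for
    \<open>m = 0\<close>, so the inner dilation factor stays positive.\<close>
  define \<delta> where "\<delta> m = 1 / real (Suc (Suc m))" for m
  have \<delta>: "0 < \<delta> m" "\<delta> m < 1" for m by (auto simp: \<delta>_def)
  have \<delta>0: "\<delta> \<longlonglongrightarrow> 0"
    unfolding \<delta>_def by (intro LIMSEQ_Suc lim_inverse_n')
  have "\<forall>m. \<exists>(I :: ((real ^ 'n) \<times> (real ^ 'n) set) set) a. finite I \<and> (\<forall>v::real ^ 'n.
     (1 - \<delta> m) * norm v \<le> (\<Sum>i\<in>I. max 0 (a i \<bullet> v)) \<and> (\<Sum>i\<in>I. max 0 (a i \<bullet> v)) \<le> (1 + \<delta> m) * norm v)"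
    using ball_zonoid \<delta>(1) by blast
  from choice[OF this] obtain I :: "nat \<Rightarrow> ((real ^ 'n) \<times> (real ^ 'n) set) set" where
    "\<forall>m. \<exists>a. finite (I m) \<and> (\<forall>v::real ^ 'n.
     (1 - \<delta> m) * norm v \<le> (\<Sum>i\<in>I m. max 0 (a i \<bullet> v)) \<and> (\<Sum>i\<in>I m. max 0 (a i \<bullet> v)) \<le> (1 + \<delta> m) * norm v)" ..
  from choice[OF this] obtain a where a: "\<forall>m. finite (I m) \<and> (\<forall>v::real ^ 'n.
     (1 - \<delta> m) * norm v \<le> (\<Sum>i\<in>I m. max 0 (a m i \<bullet> v)) \<and> (\<Sum>i\<in>I m. max 0 (a m i \<bullet> v)) \<le> (1 + \<delta> m) * norm v)" ..
  have Ia: "finite (I m)"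
    "(1 - \<delta> m) * norm v \<le> (\<Sum>i\<in>I m. max 0 (a m i \<bullet> v))"
    "(\<Sum>i\<in>I m. max 0 (a m i \<bullet> v)) \<le> (1 + \<delta> m) * norm v" for m v
    using a by auto
  define Z where "Z m t = zonotope (I m) (\<lambda>i. t *\<^sub>R a m i)" for m t
  have Z: "cball 0 ((1 - \<delta> m) * t) \<subseteq> Z m t" "Z m t \<subseteq> cball 0 ((1 + \<delta> m) * t)" if "0 \<le> t" for m t
  proof -
    have eq: "(\<Sum>i\<in>I m. max 0 ((t *\<^sub>R a m i) \<bullet> v)) = t * (\<Sum>i\<in>I m. max 0 (a m i \<bullet> v))" for v
      unfolding sum_distrib_left
    proof (intro sum.cong refl)
      fix i
      show "max 0 ((t *\<^sub>R a m i) \<bullet> v) = t * max 0 (a m i \<bullet> v)"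
        using that by (cases "0 \<le> a m i \<bullet> v") (auto simp: max_def mult_le_0_iff zero_le_mult_iff)
    qed
    have h: "(1 - \<delta> m) * t * norm v \<le> (\<Sum>i\<in>I m. max 0 ((t *\<^sub>R a m i) \<bullet> v))"
      "(\<Sum>i\<in>I m. max 0 ((t *\<^sub>R a m i) \<bullet> v)) \<le> (1 + \<delta> m) * t * norm v" for v
      unfolding eq using mult_left_mono[OF Ia(2)[of m v] that] mult_left_mono[OF Ia(3)[of m v] that]
      by (simp_all only: mult_ac)
    have "0 \<le> (1 + \<delta> m) * t" using that \<delta>(1)[of m] by simp
    from zonotope_between_balls[OF Ia(1) this h]
    show "cball 0 ((1 - \<delta> m) * t) \<subseteq> Z m t" "Z m t \<subseteq> cball 0 ((1 + \<delta> m) * t)"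
      by (simp_all add: Z_def)
  qed
  have lim: "(\<lambda>m. measure lebesgue (C + Z m t)) \<longlonglongrightarrow> measure lebesgue (C + cball 0 t)"
    if C: "compact C" "convex C" "0 \<in> C" and t: "0 \<le> t" for C t
  proof (rule tendsto_sandwich)
    let ?v = "measure lebesgue (C + cball 0 t)"
    have lm: "C + Z m t \<in> lmeasurable" for m
      unfolding Z_def using C Ia(1) by (intro lmeasurable_compact compact_set_plus compact_zonotope)
    show "eventually (\<lambda>m. (1 - \<delta> m) ^ ?d * ?v \<le> measure lebesgue (C + Z m t)) sequentially"
    proof (intro always_eventually allI)
      fix m
      have "(\<lambda>x. (1 - \<delta> m) *\<^sub>R x) ` (C + cball 0 t) \<subseteq> C + cball 0 ((1 - \<delta> m) * t)"
        using C \<delta>[of m] by (intro scaleR_parallel_subset) auto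
      also have "\<dots> \<subseteq> C + Z m t" using Z(1)[OF t] by (intro set_plus_mono2) auto
      finally have "measure lebesgue ((\<lambda>x. (1 - \<delta> m) *\<^sub>R x) ` (C + cball 0 t)) \<le> measure lebesgue (C + Z m t)"
        by (rule measure_mono_fmeasurable)
          (use lm C in \<open>auto intro!: fmeasurableD lmeasurable_compact compact_scaling compact_set_plus\<close>)
      then show "(1 - \<delta> m) ^ ?d * ?v \<le> measure lebesgue (C + Z m t)"
        unfolding measure_scaleR_image using \<delta>[of m] by simp
    qed
    show "eventually (\<lambda>m. measure lebesgue (C + Z m t) \<le> (1 + \<delta> m) ^ ?d * ?v) sequentially"
    proof (intro always_eventually allI)
      fix m
      have "C + Z m t \<subseteq> C + cball 0 ((1 + \<delta> m) * t)" using Z(2)[OF t] by (intro set_plus_mono2) auto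
      also have "\<dots> \<subseteq> (\<lambda>x. (1 + \<delta> m) *\<^sub>R x) ` (C + cball 0 t)"
        using C \<delta>[of m] by (intro parallel_subset_scaleR) auto
      finally have "measure lebesgue (C + Z m t) \<le> measure lebesgue ((\<lambda>x. (1 + \<delta> m) *\<^sub>R x) ` (C + cball 0 t))"
        by (rule measure_mono_fmeasurable)
          (use lm C in \<open>auto intro!: fmeasurableD lmeasurable_compact compact_scaling compact_set_plus\<close>)
      then show "measure lebesgue (C + Z m t) \<le> (1 + \<delta> m) ^ ?d * ?v"
        unfolding measure_scaleR_image using \<delta>[of m] by simp
    qed
    have "(\<lambda>m. (1 - \<delta> m) ^ ?d * ?v) \<longlonglongrightarrow> (1 - 0) ^ ?d * ?v"
      by (intro tendsto_intros \<delta>0)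
    then show "(\<lambda>m. (1 - \<delta> m) ^ ?d * ?v) \<longlonglongrightarrow> ?v" by simp
    have "(\<lambda>m. (1 + \<delta> m) ^ ?d * ?v) \<longlonglongrightarrow> (1 + 0) ^ ?d * ?v"
      by (intro tendsto_intros \<delta>0)
    then show "(\<lambda>m. (1 + \<delta> m) ^ ?d * ?v) \<longlonglongrightarrow> ?v" by simp
  qed
  have "\<forall>m. \<exists>f :: (real ^ 'n) set \<Rightarrow> nat \<Rightarrow> real. \<forall>C. compact C \<and> convex C \<longrightarrow>
     (\<forall>j. 0 \<le> f C j) \<and>
     (\<forall>t\<ge>0. measure lebesgue (C + Z m t) = (\<Sum>j\<le>?d. f C j * t ^ j)) \<and>
     (\<forall>C' j. compact C' \<and> convex C' \<and> C \<subseteq> C' \<longrightarrow> f C j \<le> f C' j)"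
  proof
    fix m show "\<exists>f :: (real ^ 'n) set \<Rightarrow> nat \<Rightarrow> real. \<forall>C. compact C \<and> convex C \<longrightarrow>
     (\<forall>j. 0 \<le> f C j) \<and>
     (\<forall>t\<ge>0. measure lebesgue (C + Z m t) = (\<Sum>j\<le>?d. f C j * t ^ j)) \<and>
     (\<forall>C' j. compact C' \<and> convex C' \<and> C \<subseteq> C' \<longrightarrow> f C j \<le> f C' j)"
    proof -
      from measure_plus_zonotope_poly[OF Ia(1)[of m], of "a m"] obtain f :: "(real ^ 'n) set \<Rightarrow> nat \<Rightarrow> real"
        where f: "\<forall>C. compact C \<and> convex C \<longrightarrow> (\<forall>j. 0 \<le> f C j) \<and>
     (\<forall>t\<ge>0. measure lebesgue (C + zonotope (I m) (\<lambda>i. t *\<^sub>R a m i)) = (\<Sum>j\<le>?d. f C j * t ^ j)) \<and>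
     (\<forall>C' j. compact C' \<and> convex C' \<and> C \<subseteq> C' \<longrightarrow> f C j \<le> f C' j)" ..
      show ?thesis
        unfolding Z_def by (intro exI[of _ f] allI impI conjI) (use f in \<open>simp_all\<close>)
    qed
  qed
  from choice[OF this] obtain f where f0: "\<forall>m. \<forall>C :: (real ^ 'n) set. compact C \<and> convex C \<longrightarrow>
     (\<forall>j. 0 \<le> (f m C j :: real)) \<and>
     (\<forall>t\<ge>0. measure lebesgue (C + Z m t) = (\<Sum>j\<le>?d. f m C j * t ^ j)) \<and>
     (\<forall>C' j. compact C' \<and> convex C' \<and> C \<subseteq> C' \<longrightarrow> f m C j \<le> f m C' j)" ..
  have f: "\<And>m C j. compact C \<Longrightarrow> convex C \<Longrightarrow> (0::real) \<le> f m C j"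
    "\<And>m C t. compact C \<Longrightarrow> convex C \<Longrightarrow> 0 \<le> t \<Longrightarrow> measure lebesgue (C + Z m t) = (\<Sum>j\<le>?d. f m C j * t ^ j)"
    "\<And>m C C' j. compact C \<Longrightarrow> convex C \<Longrightarrow> compact C' \<Longrightarrow> convex C' \<Longrightarrow> C \<subseteq> C' \<Longrightarrow> f m C j \<le> f m C' j"
    using f0 by blast+
  \<comment> \<open>Both sides are the same interpolation functional, applied to the volumes of
    \<open>C + Z m i\<close> and of \<open>C + cball 0 i\<close>; so convergence of these finitely
    many volumes is enough.\<close>
  have limf: "(\<lambda>m. f m C j) \<longlonglongrightarrow> steiner_coeff C j" if C: "compact C" "convex C" "0 \<in> C" and j: "j \<le> ?d" for C j
  proof -
    have "f m C j = (\<Sum>i\<le>?d. interp_weight ?d j i * measure lebesgue (C + Z m (real i)))" for m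
      using interp_weight[OF j, of "f m C"] f(2)[OF C(1,2)] by simp
    moreover have "(\<lambda>m. \<Sum>i\<le>?d. interp_weight ?d j i * measure lebesgue (C + Z m (real i))) \<longlonglongrightarrow> steiner_coeff C j"
      unfolding steiner_coeff_def by (intro tendsto_intros lim C) auto
    ultimately show ?thesis by simp
  qed
  show "0 \<le> steiner_coeff C j" if "j \<le> CARD('n)" for j
    using that f(1)[OF C(1,2)] by (intro LIMSEQ_le_const[OF limf[OF C]]) auto
  show "steiner_coeff C j \<le> steiner_coeff C' j" if C': "compact C'" "convex C'" "C \<subseteq> C'" and j: "j \<le> CARD('n)" for C' j
  proof (rule LIMSEQ_le[OF limf[OF C] limf[OF C'(1,2)]])
    show "\<exists>N. \<forall>n\<ge>N. f n C j \<le> f n C' j"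
      using f(3)[OF C(1,2) C'] by blast
  qed (use C C' j in auto)
  show "measure lebesgue (C + cball 0 r) = (\<Sum>j\<le>CARD('n). steiner_coeff C j * r ^ j)" if r: "0 \<le> r" for r
  proof (rule LIMSEQ_unique[OF lim[OF C r]])
    have "(\<lambda>m. \<Sum>j\<le>?d. f m C j * r ^ j) \<longlonglongrightarrow> (\<Sum>j\<le>?d. steiner_coeff C j * r ^ j)"
      by (intro tendsto_intros limf C) auto
    then show "(\<lambda>m. measure lebesgue (C + Z m r)) \<longlonglongrightarrow> (\<Sum>j\<le>CARD('n). steiner_coeff C j * r ^ j)"
      using f(2)[OF C(1,2) r] by simp
  qed
qed

lemma translation_plus: "(+) x ` A + B = (+) x ` (A + B)" for x :: "'a::ab_group_add"
proof (intro equalityI subsetI)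
  fix y assume "y \<in> (+) x ` A + B"
  then obtain a b where "a \<in> A" "b \<in> B" "y = x + a + b" by (auto simp: set_plus_def)
  then show "y \<in> (+) x ` (A + B)" by (intro image_eqI[of _ _ "a + b"]) (auto simp: add.assoc)
next
  fix y assume "y \<in> (+) x ` (A + B)"
  then obtain a b where "a \<in> A" "b \<in> B" "y = x + (a + b)" by (auto simp: set_plus_def)
  then show "y \<in> (+) x ` A + B"
    using set_plus_intro[of "x + a" "(+) x ` A" b B] by (auto simp: add.assoc)
qed

lemma steiner_coeff_translation: "steiner_coeff ((+) x ` C) j = steiner_coeff C j"
  by (simp add: steiner_coeff_def translation_plus measure_translation)

text \<open>Volumes are translation invariant, so a point of \<open>C\<close> may be moved to the
  origin.\<close>

theorem steiner_formula:
  fixes C :: "(real ^ 'n) set"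
  assumes C: "compact C" "convex C" "C \<noteq> {}"
  shows "\<And>j. j \<le> CARD('n) \<Longrightarrow> 0 \<le> steiner_coeff C j"
    and "\<And>r. 0 \<le> r \<Longrightarrow> measure lebesgue (C + cball 0 r) = (\<Sum>j\<le>CARD('n). steiner_coeff C j * r ^ j)"
    and "\<And>C' j. compact C' \<Longrightarrow> convex C' \<Longrightarrow> C \<subseteq> C' \<Longrightarrow> j \<le> CARD('n) \<Longrightarrow> steiner_coeff C j \<le> steiner_coeff C' j"
proof -
  obtain x where x: "x \<in> C" using C by auto
  define C0 where "C0 = (+) (- x) ` C"
  have C0: "compact C0" "convex C0" "0 \<in> C0"
    unfolding C0_def using compact_translation[OF C(1)] convex_translation[OF C(2)] x
    by (blast, blast, intro image_eqI[of _ _ x]) auto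
  show "0 \<le> steiner_coeff C j" if "j \<le> CARD('n)" for j
    using steiner_0(1)[OF C0 that] unfolding C0_def steiner_coeff_translation .
  show "measure lebesgue (C + cball 0 r) = (\<Sum>j\<le>CARD('n). steiner_coeff C j * r ^ j)" if "0 \<le> r" for r
    using steiner_0(2)[OF C0 that] unfolding C0_def steiner_coeff_translation translation_plus measure_translation .
  show "steiner_coeff C j \<le> steiner_coeff C' j" if C': "compact C'" "convex C'" "C \<subseteq> C'" and j: "j \<le> CARD('n)" for C' j
    using steiner_0(3)[OF C0 compact_translation[OF C'(1), of "- x"] convex_translation[OF C'(2), of "- x"] _ j]
      image_mono[OF C'(3), of "(+) (- x)"]
    unfolding C0_def steiner_coeff_translation by blast
qed

text \<open>For the definite description, existence is the Steiner formula and uniqueness is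
  interpolation. The index is reversed because the \<open>k\<close>-th intrinsic volume belongs to
  the power \<open>r ^ (d - k)\<close>.\<close>

lemma intrinsic_volume_eq_steiner_coeff:
  fixes C :: "(real ^ 'n) set"
  assumes C: "compact C" "convex C" "C \<noteq> {}" and k: "k \<le> CARD('n)"
  shows "intrinsic_volume k C = steiner_coeff C (CARD('n) - k) / unit_ball_vol (real (CARD('n) - k))"
proof -
  let ?d = "CARD('n)"
  let ?\<kappa> = "\<lambda>j. unit_ball_vol (real j)"
  have par: "{x + r *\<^sub>R b |x b. x \<in> C \<and> b \<in> cball 0 1} = C + cball 0 r" if "0 \<le> r" for r
  proof -
    have ball: "cball (0 :: real ^ 'n) r = (\<lambda>b. r *\<^sub>R b) ` cball 0 1"
    proof (cases "r = 0")
      case False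
      then show ?thesis using that cball_scale[of r "0 :: real ^ 'n" 1] by simp
    qed (auto simp: image_constant_conv)
    show ?thesis unfolding set_plus_def ball by blast
  qed
  have \<kappa>: "?\<kappa> j \<noteq> 0" for j by (metis unit_ball_vol_pos of_nat_0_le_iff less_irrefl)
  have rev: "(\<Sum>j\<le>?d. ?\<kappa> (?d - j) * c j * r ^ (?d - j)) = (\<Sum>j\<le>?d. ?\<kappa> j * c (?d - j) * r ^ j)" for c :: "nat \<Rightarrow> real" and r
    by (rule sum.reindex_bij_witness[of _ "\<lambda>j. ?d - j" "\<lambda>j. ?d - j"]) auto
  show ?thesis
    unfolding intrinsic_volume_def
  proof (rule the_equality)
    let ?c = "\<lambda>j. steiner_coeff C (?d - j) / ?\<kappa> (?d - j)"
    have "measure lebesgue {x + r *\<^sub>R b |x b. x \<in> C \<and> b \<in> cball 0 1} =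
        (\<Sum>j\<le>DIM(real ^ 'n). ?\<kappa> (DIM(real ^ 'n) - j) * ?c j * r ^ (DIM(real ^ 'n) - j))" if "0 \<le> r" for r
      using steiner_formula(2)[OF C that] \<kappa> by (simp only: par[OF that] rev DIM_cart DIM_real mult_1_right) simp
    then show "\<exists>c. c k = ?c k \<and> (\<forall>r\<ge>0. measure lebesgue {x + r *\<^sub>R b |x b. x \<in> C \<and> b \<in> cball 0 1} =
        (\<Sum>j\<le>DIM(real ^ 'n). ?\<kappa> (DIM(real ^ 'n) - j) * c j * r ^ (DIM(real ^ 'n) - j)))"
      by (intro exI[of _ ?c]) blast
  next
    fix v
    assume "\<exists>c. c k = v \<and> (\<forall>r\<ge>0. measure lebesgue {x + r *\<^sub>R b |x b. x \<in> C \<and> b \<in> cball 0 1} =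
        (\<Sum>j\<le>DIM(real ^ 'n). ?\<kappa> (DIM(real ^ 'n) - j) * c j * r ^ (DIM(real ^ 'n) - j)))"
    then obtain c where c: "c k = v" "\<And>r. 0 \<le> r \<Longrightarrow> measure lebesgue (C + cball 0 r) = (\<Sum>j\<le>?d. ?\<kappa> j * c (?d - j) * r ^ j)"
      using par rev by auto
    have "steiner_coeff C (?d - k) = ?\<kappa> (?d - k) * c (?d - (?d - k))"
      using c(2) by (intro steiner_coeff_unique) auto
    then show "v = steiner_coeff C (?d - k) / ?\<kappa> (?d - k)"
      using c(1) k \<kappa>[of "?d - k"] by simp
  qed
qed

subsection \<open>Properties of the intrinsic volumes\<close>

text \<open>The parallel body of \<open>m C\<close> at distance \<open>r\<close> is \<open>m\<close>
  times that of \<open>C\<close> at distance \<open>r / m\<close>; uniqueness of the coefficients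
  does the rest.\<close>

lemma steiner_coeff_scaleR:
  fixes C :: "(real ^ 'n) set"
  assumes C: "compact C" "convex C" "C \<noteq> {}" and m: "0 < m" and j: "j \<le> CARD('n)"
  shows "steiner_coeff ((\<lambda>x. m *\<^sub>R x) ` C) j = m ^ (CARD('n) - j) * steiner_coeff C j"
proof -
  let ?d = "CARD('n)"
  have "measure lebesgue ((\<lambda>x. m *\<^sub>R x) ` C + cball 0 r) = (\<Sum>j\<le>?d. m ^ (?d - j) * steiner_coeff C j * r ^ j)"
    if r: "0 \<le> r" for r
  proof -
    have "cball (0 :: real ^ 'n) r = (\<lambda>x. m *\<^sub>R x) ` cball 0 (r / m)"
      using m by (simp add: cball_scale)
    then have "(\<lambda>x. m *\<^sub>R x) ` C + cball 0 r = (\<lambda>x. m *\<^sub>R x) ` C + (\<lambda>x. m *\<^sub>R x) ` cball 0 (r / m)"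
      by simp
    also have "\<dots> = (\<lambda>x. m *\<^sub>R x) ` (C + cball 0 (r / m))"
    proof (intro equalityI subsetI)
      fix y assume "y \<in> (\<lambda>x. m *\<^sub>R x) ` C + (\<lambda>x. m *\<^sub>R x) ` cball 0 (r / m)"
      then obtain u w where "u \<in> C" "w \<in> cball 0 (r / m)" "y = m *\<^sub>R (u + w)"
        by (auto simp: set_plus_def scaleR_add_right)
      then show "y \<in> (\<lambda>x. m *\<^sub>R x) ` (C + cball 0 (r / m))" by blast
    next
      fix y assume "y \<in> (\<lambda>x. m *\<^sub>R x) ` (C + cball 0 (r / m))"
      then obtain u w where "u \<in> C" "w \<in> cball 0 (r / m)" "y = m *\<^sub>R u + m *\<^sub>R w"
        by (auto simp: set_plus_def scaleR_add_right)
      then show "y \<in> (\<lambda>x. m *\<^sub>R x) ` C + (\<lambda>x. m *\<^sub>R x) ` cball 0 (r / m)" by blast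
    qed
    finally have "measure lebesgue ((\<lambda>x. m *\<^sub>R x) ` C + cball 0 r) = m ^ ?d * (\<Sum>j\<le>?d. steiner_coeff C j * (r / m) ^ j)"
      using measure_scaleR_image[of m "C + cball 0 (r / m)"] m r steiner_formula(2)[OF C, of "r / m"] by simp
    also have "\<dots> = (\<Sum>j\<le>?d. m ^ (?d - j) * steiner_coeff C j * r ^ j)"
      unfolding sum_distrib_left
      by (intro sum.cong refl) (use m in \<open>auto simp: power_divide power_diff divide_simps\<close>)
    finally show ?thesis .
  qed
  then show ?thesis using j steiner_coeff_unique[of "(\<lambda>x. m *\<^sub>R x) ` C" "\<lambda>j. m ^ (?d - j) * steiner_coeff C j" j]
    by simp
qed

lemma steiner_coeff_orthogonal:
  fixes C :: "'a::euclidean_space set" and f :: "'a \<Rightarrow> 'a"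
  assumes f: "orthogonal_transformation f" and C: "compact C" "convex C"
  shows "steiner_coeff (f ` C) j = steiner_coeff C j"
proof -
  have lin: "linear f" using f by (simp add: orthogonal_transformation_linear)
  have "measure lebesgue (f ` C + cball 0 r) = measure lebesgue (C + cball 0 r)" for r
  proof -
    have "f ` cball 0 r = cball 0 r"
      using image_orthogonal_transformation_cball[OF f, of 0 r] lin by (simp add: linear_0)
    then have "f ` C + cball 0 r = f ` C + f ` cball 0 r" by simp
    also have "\<dots> = f ` (C + cball 0 r)"
      using lin by (force simp: set_plus_def linear_add)
    finally show ?thesis
      using measure_orthogonal_image_convex[OF f] C by (simp add: compact_set_plus convex_set_plus)
  qed
  then show ?thesis by (simp add: steiner_coeff_def)
qed

lemma steiner_coeff_0: "steiner_coeff C 0 = measure lebesgue C" if "compact C" "convex C" "C \<noteq> {}"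
  for C :: "(real ^ 'n) set"
proof -
  have "(\<Sum>j\<le>CARD('n). steiner_coeff C j * 0 ^ j) = steiner_coeff C 0"
    by (simp add: sum.atMost_shift)
  then show ?thesis using steiner_formula(2)[OF that, of 0] by (simp add: add_0_right)
qed

text \<open>Adding a segment commutes with forming parallel bodies, so every parallel volume is
  affine in \<open>s\<close>. This takes the place of continuity in the Hausdorff metric when the
  model caps flatten out.\<close>

lemma steiner_coeff_plus_segment_tendsto:
  fixes C :: "'a::euclidean_space set"
  assumes C: "compact C" "convex C"
  shows "((\<lambda>s. steiner_coeff (C + closed_segment 0 (s *\<^sub>R a)) j) \<longlongrightarrow> steiner_coeff C j) (at_right 0)"
proof -
  define v where "v i = measure lebesgue (C + cball 0 (real i))" for i
  define v1 where "v1 i = measure lebesgue ((C + cball 0 (real i)) + closed_segment 0 a)" for i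
  have "steiner_coeff (C + closed_segment 0 (s *\<^sub>R a)) j =
     (\<Sum>i\<le>DIM('a). interp_weight DIM('a) j i * (v i + s * (v1 i - v i)))" if "0 < s" for s
  proof -
    have "C + closed_segment 0 (s *\<^sub>R a) + cball 0 (real i) = (C + cball 0 (real i)) + closed_segment 0 (s *\<^sub>R a)" for i
      by (simp add: ac_simps)
    then show ?thesis
      unfolding steiner_coeff_def v_def v1_def
      using measure_plus_segment[of "C + cball 0 _" s a] C that
      by (simp add: compact_set_plus convex_set_plus)
  qed
  then have "eventually (\<lambda>s. (\<Sum>i\<le>DIM('a). interp_weight DIM('a) j i * (v i + s * (v1 i - v i))) =
     steiner_coeff (C + closed_segment 0 (s *\<^sub>R a)) j) (at_right 0)"
    by (auto simp: eventually_at_filter)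
  moreover have "((\<lambda>s. \<Sum>i\<le>DIM('a). interp_weight DIM('a) j i * (v i + s * (v1 i - v i))) \<longlongrightarrow>
     (\<Sum>i\<le>DIM('a). interp_weight DIM('a) j i * (v i + 0 * (v1 i - v i)))) (at_right 0)"
    by (intro tendsto_intros)
  ultimately show ?thesis
    using Lim_transform_eventually by (force simp: steiner_coeff_def v_def)
qed

lemma unit_ball_vol_nat_pos: "0 < unit_ball_vol (real j)"
  by (rule unit_ball_vol_pos) simp

lemma intrinsic_volume_nonneg:
  fixes C :: "(real ^ 'n) set"
  assumes "compact C" "convex C" "C \<noteq> {}" "k \<le> CARD('n)"
  shows "0 \<le> intrinsic_volume k C"
  using intrinsic_volume_eq_steiner_coeff[OF assms] steiner_formula(1)[OF assms(1-3)]
    unit_ball_vol_nat_pos by (simp add: less_imp_le)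

lemma intrinsic_volume_mono:
  fixes C :: "(real ^ 'n) set"
  assumes "compact C" "convex C" "C \<noteq> {}" "compact C'" "convex C'" "C \<subseteq> C'" "k \<le> CARD('n)"
  shows "intrinsic_volume k C \<le> intrinsic_volume k C'"
proof -
  have "C' \<noteq> {}" using assms by auto
  then show ?thesis
    using intrinsic_volume_eq_steiner_coeff[OF assms(1-3,7)] intrinsic_volume_eq_steiner_coeff[of C' k]
      steiner_formula(3)[OF assms(1-6)] assms less_imp_le[OF unit_ball_vol_nat_pos]
    by (simp add: divide_right_mono)
qed

lemma intrinsic_volume_translation:
  fixes C :: "(real ^ 'n) set"
  assumes "compact C" "convex C" "C \<noteq> {}" "k \<le> CARD('n)"
  shows "intrinsic_volume k ((+) x ` C) = intrinsic_volume k C"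
proof -
  have "(+) x ` C \<noteq> {}" using assms by blast
  from intrinsic_volume_eq_steiner_coeff[OF compact_translation[OF assms(1)] convex_translation[OF assms(2)] this assms(4)]
  show ?thesis unfolding intrinsic_volume_eq_steiner_coeff[OF assms] steiner_coeff_translation .
qed

lemma intrinsic_volume_scaleR:
  fixes C :: "(real ^ 'n) set"
  assumes C: "compact C" "convex C" "C \<noteq> {}" and k: "k \<le> CARD('n)" and m: "0 < m"
  shows "intrinsic_volume k ((\<lambda>x. m *\<^sub>R x) ` C) = m ^ k * intrinsic_volume k C"
proof -
  have "(\<lambda>x. m *\<^sub>R x) ` C \<noteq> {}" using C by blast
  from intrinsic_volume_eq_steiner_coeff[OF compact_scaling[OF C(1)] convex_scaling[OF C(2)] this k]
  show ?thesis unfolding intrinsic_volume_eq_steiner_coeff[OF C k]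
    using steiner_coeff_scaleR[OF C m, of "CARD('n) - k"] k by simp
qed

lemma intrinsic_volume_dim:
  fixes C :: "(real ^ 'n) set"
  assumes C: "compact C" "convex C" "C \<noteq> {}"
  shows "intrinsic_volume CARD('n) C = measure lebesgue C"
  using intrinsic_volume_eq_steiner_coeff[OF C order_refl] steiner_coeff_0[OF C] by simp

lemma intrinsic_volume_orthogonal:
  fixes C :: "(real ^ 'n) set" and f :: "real ^ 'n \<Rightarrow> real ^ 'n"
  assumes f: "orthogonal_transformation f" and C: "compact C" "convex C" "C \<noteq> {}" and k: "k \<le> CARD('n)"
  shows "intrinsic_volume k (f ` C) = intrinsic_volume k C"
proof -
  have lin: "linear f" using f by (simp add: orthogonal_transformation_linear)
  have "compact (f ` C)" "convex (f ` C)" "f ` C \<noteq> {}"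
    using C lin by (auto intro!: compact_continuous_image linear_continuous_on convex_linear_image simp: linear_linear)
  from intrinsic_volume_eq_steiner_coeff[OF this k] show ?thesis
    unfolding intrinsic_volume_eq_steiner_coeff[OF C k] steiner_coeff_orthogonal[OF f C(1,2)] .
qed

lemma intrinsic_volume_plus_segment_tendsto:
  fixes C :: "(real ^ 'n) set"
  assumes C: "compact C" "convex C" "C \<noteq> {}" and k: "k \<le> CARD('n)"
  shows "((\<lambda>s. intrinsic_volume k (C + closed_segment 0 (s *\<^sub>R a))) \<longlongrightarrow> intrinsic_volume k C) (at_right 0)"
proof -
  have eq: "intrinsic_volume k (C + closed_segment 0 (s *\<^sub>R a)) =
     steiner_coeff (C + closed_segment 0 (s *\<^sub>R a)) (CARD('n) - k) / unit_ball_vol (real (CARD('n) - k))" for s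
  proof (rule intrinsic_volume_eq_steiner_coeff[OF _ _ _ k])
    show "C + closed_segment 0 (s *\<^sub>R a) \<noteq> {}" using C by (auto simp: set_plus_def)
  qed (use C in \<open>auto intro: compact_set_plus convex_set_plus\<close>)
  show ?thesis
    unfolding intrinsic_volume_eq_steiner_coeff[OF C k] eq
    by (intro tendsto_divide steiner_coeff_plus_segment_tendsto C tendsto_const)
      (use less_imp_neq[OF unit_ball_vol_nat_pos] in fastforce)
qed

text \<open>The volume of the parallel body of the \<open>t\<close>-fold cube is of exact order \<open>t ^ card J\<close>, which
  singles out one coefficient of the Steiner polynomial.\<close>

lemma intrinsic_volume_cube_pos:
  fixes J :: "'n::finite set"
  defines "Q \<equiv> cbox (0 :: real ^ 'n) (\<chi> i. if i \<in> J then 1 else 0)"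
  shows "0 < intrinsic_volume (card J) Q"
proof -
  let ?d = "CARD('n)" and ?k = "card J"
  let ?q = "\<lambda>t. (\<lambda>x. t *\<^sub>R x) ` Q"
  have k: "?k \<le> ?d" by (simp add: card_mono)
  have "0 \<in> Q" by (simp add: Q_def mem_box_cart)
  then have Q: "compact Q" "convex Q" "Q \<noteq> {}" by (auto simp: Q_def)
  define c where "c j = steiner_coeff Q (?d - j)" for j
  have c: "0 \<le> c j" for j unfolding c_def by (rule steiner_formula(1)[OF Q]) simp
  have q: "x \<in> ?q t \<longleftrightarrow> (\<forall>i. 0 \<le> x $ i \<and> x $ i \<le> (if i \<in> J then t else 0))" if "0 < t" for x t
  proof
    assume "x \<in> ?q t"
    then show "\<forall>i. 0 \<le> x $ i \<and> x $ i \<le> (if i \<in> J then t else 0)"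
      using that by (auto simp: Q_def mem_box_cart mult_le_0_iff) (metis order_antisym)+
  next
    assume "\<forall>i. 0 \<le> x $ i \<and> x $ i \<le> (if i \<in> J then t else 0)"
    then show "x \<in> ?q t" using that
      by (intro image_eqI[of _ _ "(1 / t) *\<^sub>R x"]) (auto simp: Q_def mem_box_cart divide_simps, metis+)
  qed
  have p: "measure lebesgue (?q t + cball 0 1) = (\<Sum>j\<le>?d. c j * t ^ j)" if "0 < t" for t
  proof -
    have "?q t \<noteq> {}" using Q by blast
    from steiner_formula(2)[OF compact_scaling[OF Q(1)] convex_scaling[OF Q(2)] this, of 1]
    have "measure lebesgue (?q t + cball 0 1) = (\<Sum>j\<le>?d. t ^ (?d - j) * steiner_coeff Q j)"
      by (simp add: steiner_coeff_scaleR[OF Q that])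
    also have "\<dots> = (\<Sum>j\<le>?d. c j * t ^ j)"
      by (rule sum.reindex_bij_witness[of _ "\<lambda>j. ?d - j" "\<lambda>j. ?d - j"]) (auto simp: c_def)
    finally show ?thesis .
  qed
  have lm: "?q t + cball 0 1 \<in> lmeasurable" for t
    using Q by (intro lmeasurable_parallel compact_scaling)
  have prodJ: "(\<Prod>i\<in>UNIV. if i \<in> J then x else y) = x ^ ?k * y ^ (?d - ?k)" for x y :: real
  proof -
    have "(\<Prod>i\<in>UNIV. if i \<in> J then x else y) = (\<Prod>i\<in>J. x) * (\<Prod>i\<in>-J. y)"
      by (subst prod.If_cases) auto
    then show ?thesis by (simp add: Compl_eq_Diff_UNIV card_Diff_subset)
  qed
  have up: "(\<Sum>j\<le>?d. c j * t ^ j) \<le> 3 ^ ?k * 2 ^ (?d - ?k) * t ^ ?k" if t: "1 \<le> t" for t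
  proof -
    let ?a = "(\<chi> i. - 1) :: real ^ 'n" and ?b = "(\<chi> i. if i \<in> J then t + 1 else 1) :: real ^ 'n"
    have "?q t + cball 0 1 \<subseteq> cbox ?a ?b"
    proof
      fix x assume "x \<in> ?q t + cball 0 1"
      then obtain y z where "x = y + z" "y \<in> ?q t" "z \<in> cball 0 1" by (rule set_plus_elim)
      then have yz: "y \<in> ?q t" "norm z \<le> 1" "x = y + z" by simp_all
      have "- 1 \<le> x $ i \<and> x $ i \<le> (if i \<in> J then t + 1 else 1)" for i
      proof -
        have "\<bar>z $ i\<bar> \<le> 1" using component_le_norm_cart[of z i] yz by linarith
        moreover have "0 \<le> y $ i \<and> y $ i \<le> (if i \<in> J then t else 0)"
          using yz(1) q[of t y] t by auto
        ultimately show ?thesis by (auto simp: yz(3) abs_le_iff split: if_splits)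
      qed
      then show "x \<in> cbox ?a ?b" by (auto simp: mem_box_cart)
    qed
    then have "measure lebesgue (?q t + cball 0 1) \<le> measure lebesgue (cbox ?a ?b)"
      using lm by (intro measure_mono_fmeasurable) auto
    also have "\<dots> = (\<Prod>i\<in>UNIV. if i \<in> J then t + 2 else 2)"
    proof -
      have "cbox ?a ?b \<noteq> {}" using t by (auto simp: interval_ne_empty_cart)
      from content_cbox_cart[OF this] show ?thesis by (auto intro!: prod.cong)
    qed
    also have "\<dots> = (t + 2) ^ ?k * 2 ^ (?d - ?k)" by (rule prodJ)
    also have "\<dots> \<le> (3 * t) ^ ?k * 2 ^ (?d - ?k)"
      using t by (intro mult_right_mono power_mono) auto
    finally show ?thesis using p[of t] t by (simp add: power_mult_distrib mult_ac)
  qed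
  have low: "(1 / ?d) ^ (?d - ?k) * t ^ ?k \<le> (\<Sum>j\<le>?d. c j * t ^ j)" if t: "0 < t" for t
  proof -
    \<comment> \<open>With \<open>1 / d\<close> in the directions outside \<open>J\<close>, dropping
      these coordinates moves a point by at most 1 in the l1 norm, hence in the Euclidean
      norm.\<close>
    let ?b = "(\<chi> i. if i \<in> J then t else 1 / ?d) :: real ^ 'n"
    have "cbox 0 ?b \<subseteq> ?q t + cball 0 1"
    proof
      fix x assume x: "x \<in> cbox 0 ?b"
      then have xi: "0 \<le> x $ i" "x $ i \<le> (if i \<in> J then t else 1 / ?d)" for i by (auto simp: mem_box_cart)
      define y where "y = (\<chi> i. if i \<in> J then x $ i else 0)"
      have "0 \<le> y $ i \<and> y $ i \<le> (if i \<in> J then t else 0)" for i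
        using xi[of i] by (auto simp: y_def)
      then have "y \<in> ?q t" unfolding q[OF t] by blast
      moreover have "norm (x - y) \<le> 1"
      proof -
        have "\<bar>(x - y) $ i\<bar> \<le> 1 / ?d" for i
          using xi[of i] by (auto simp: y_def split: if_splits)
        then have "(\<Sum>i\<in>UNIV. \<bar>(x - y) $ i\<bar>) \<le> (\<Sum>i\<in>(UNIV :: 'n set). 1 / ?d)"
          by (intro sum_mono)
        then have "norm (x - y) \<le> (\<Sum>i\<in>(UNIV :: 'n set). 1 / ?d)"
          using norm_le_l1_cart[of "x - y"] by linarith
        then show ?thesis by simp
      qed
      ultimately have "y + (x - y) \<in> ?q t + cball 0 1" by (intro set_plus_intro) auto
      then show "x \<in> ?q t + cball 0 1" by simp
    qed
    then have "measure lebesgue (cbox 0 ?b) \<le> measure lebesgue (?q t + cball 0 1)"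
      using lm by (intro measure_mono_fmeasurable) auto
    moreover have "measure lebesgue (cbox 0 ?b) = (\<Prod>i\<in>UNIV. if i \<in> J then t else 1 / ?d)"
    proof -
      have "cbox 0 ?b \<noteq> {}" using t by (auto simp: interval_ne_empty_cart)
      from content_cbox_cart[OF this] show ?thesis by (auto intro!: prod.cong)
    qed
    ultimately show ?thesis using p[OF t] by (simp add: prodJ mult_ac)
  qed
  \<comment> \<open>All \<open>c j\<close> are non-negative, so a single term is bounded by the
    whole sum: no cancellation can hide a power above \<open>t ^ k\<close>.\<close>
  have vanish: "c j = 0" if j: "?k < j" "j \<le> ?d" for j
  proof -
    have le: "c j * t ^ j \<le> 3 ^ ?k * 2 ^ (?d - ?k) * t ^ ?k" if "1 \<le> t" for t
    proof -
      have "c j * t ^ j \<le> (\<Sum>j\<le>?d. c j * t ^ j)"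
        using that c j by (intro member_le_sum) auto
      then show ?thesis using up[OF that] by linarith
    qed
    have "eventually (\<lambda>t. c j \<le> 3 ^ ?k * 2 ^ (?d - ?k) * (t ^ ?k / t ^ j)) at_top"
      using eventually_ge_at_top[of 1]
    proof eventually_elim
      case (elim t)
      then show ?case using le[OF elim] by (simp add: field_simps)
    qed
    moreover have "((\<lambda>t::real. 3 ^ ?k * 2 ^ (?d - ?k) * (t ^ ?k / t ^ j)) \<longlongrightarrow> 3 ^ ?k * 2 ^ (?d - ?k) * 0) at_top"
      using tendsto_power_ratio_at_top[of ?k j] j by (intro tendsto_mult tendsto_const) auto
    ultimately have "c j \<le> 3 ^ ?k * 2 ^ (?d - ?k) * 0"
      by (intro tendsto_lowerbound[of _ _ at_top]) auto
    then show ?thesis using c[of j] by simp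
  qed
  have sum_eq: "(\<Sum>j\<le>?d. c j * t ^ j) = (\<Sum>j\<le>?k. c j * t ^ j)" for t
    using k vanish by (intro sum.mono_neutral_right) auto
  have "((\<lambda>t. \<Sum>j\<le>?k. c j * (t ^ j / t ^ ?k)) \<longlongrightarrow> (\<Sum>j\<le>?k. c j * (if j = ?k then 1 else 0))) at_top"
    by (intro tendsto_intros tendsto_power_ratio_at_top) auto
  moreover have "eventually (\<lambda>t. (1 / ?d) ^ (?d - ?k) \<le> (\<Sum>j\<le>?k. c j * (t ^ j / t ^ ?k))) at_top"
    using eventually_gt_at_top[of 0]
  proof eventually_elim
    case (elim t)
    have "(1 / ?d) ^ (?d - ?k) \<le> (\<Sum>j\<le>?k. c j * t ^ j) / t ^ ?k"
      using low[OF elim] elim by (simp add: sum_eq pos_le_divide_eq)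
    then show ?case by (simp add: sum_divide_distrib)
  qed
  ultimately have "(1 / ?d) ^ (?d - ?k) \<le> (\<Sum>j\<le>?k. c j * (if j = ?k then 1 else 0))"
    by (intro tendsto_lowerbound[of _ _ at_top]) auto
  also have "\<dots> = c ?k" by (simp add: if_distrib[where f="\<lambda>x. _ * x"] cong: if_cong)
  finally have "0 < c ?k" by (rule less_le_trans[rotated]) simp
  then show ?thesis
    unfolding intrinsic_volume_eq_steiner_coeff[OF Q k] c_def using unit_ball_vol_nat_pos by simp
qed

text \<open>A cube spanned by \<open>k\<close> coordinate axes other than \<open>i0\<close>, rotated
  so that the axis \<open>i0\<close> becomes \<open>n\<close>, lies in the hyperplane orthogonal to
  \<open>n\<close>. Points of the unit cube have norm at most \<open>CARD('n)\<close>, so scaling by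
  \<open>\<rho> / CARD('n)\<close> brings it into the disc, and monotonicity transfers
  positivity.\<close>

lemma intrinsic_volume_disc_pos:
  fixes n :: "real ^ 'n"
  assumes n: "norm n = 1" and \<rho>: "0 < \<rho>" and E: "{v. v \<bullet> n = 0 \<and> norm v \<le> \<rho>} \<subseteq> E"
    "compact E" "convex E" and k: "k < CARD('n)"
  shows "0 < intrinsic_volume k E"
proof -
  obtain i0 :: 'n where True by simp
  have "k \<le> card (UNIV - {i0})" using k by (simp add: card_Diff_singleton)
  then obtain J where J: "J \<subseteq> UNIV - {i0}" "card J = k" by (meson obtain_subset_with_card_n)
  define Q where "Q = cbox (0 :: real ^ 'n) (\<chi> i. if i \<in> J then 1 else 0)"
  have "0 \<in> Q" by (simp add: Q_def mem_box_cart)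
  then have Q: "compact Q" "convex Q" "Q \<noteq> {}" by (auto simp: Q_def)
  have "norm (axis i0 1 :: real ^ 'n) = norm n" using n by (simp add: norm_axis_1)
  from orthogonal_transformation_exists[OF this] obtain f :: "real ^ 'n \<Rightarrow> real ^ 'n"
    where f: "orthogonal_transformation f" "f (axis i0 1) = n" .
  define s where "s = \<rho> / CARD('n)"
  have s: "0 < s" using \<rho> by (simp add: s_def)
  let ?S = "f ` ((\<lambda>x. s *\<^sub>R x) ` Q)"
  have S: "compact ((\<lambda>x. s *\<^sub>R x) ` Q)" "convex ((\<lambda>x. s *\<^sub>R x) ` Q)" "(\<lambda>x. s *\<^sub>R x) ` Q \<noteq> {}"
    using Q compact_scaling convex_scaling by blast+
  have lin: "linear f" using f by (simp add: orthogonal_transformation_linear)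
  have S': "compact ?S" "convex ?S" "?S \<noteq> {}"
    using S lin by (auto intro!: compact_continuous_image linear_continuous_on convex_linear_image simp: linear_linear)
  have "?S \<subseteq> E"
  proof (rule subset_trans[OF _ E(1)], clarify)
    fix y assume y: "y \<in> Q"
    then have yi: "0 \<le> y $ i" "y $ i \<le> (if i \<in> J then 1 else 0)" for i by (auto simp: Q_def mem_box_cart)
    have "i0 \<notin> J" using J by blast
    then have "y $ i0 = 0" using yi[of i0] by simp
    then have "f (s *\<^sub>R y) \<bullet> n = 0"
      using f by (metis orthogonal_transformation_def inner_axis inner_scaleR_left mult_zero_right inner_real_def mult_1_right)
    moreover have "norm (f (s *\<^sub>R y)) \<le> \<rho>"
    proof -
      have "norm y \<le> (\<Sum>i\<in>UNIV. \<bar>y $ i\<bar>)" by (rule norm_le_l1_cart)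
      also have "\<dots> \<le> (\<Sum>i\<in>(UNIV :: 'n set). 1)"
      proof (intro sum_mono)
        fix i show "\<bar>y $ i\<bar> \<le> 1" using yi[of i] by (auto split: if_splits)
      qed
      finally have "s * norm y \<le> s * CARD('n)" using s by (intro mult_left_mono) auto
      then show ?thesis using f(1) s \<rho> by (simp add: orthogonal_transformation_norm s_def)
    qed
    ultimately show "f (s *\<^sub>R y) \<bullet> n = 0 \<and> norm (f (s *\<^sub>R y)) \<le> \<rho>" ..
  qed
  have "0 < s ^ k * intrinsic_volume k Q"
    using intrinsic_volume_cube_pos[of J] J s by (simp add: Q_def)
  also have "\<dots> = intrinsic_volume k ?S"
    using intrinsic_volume_orthogonal[OF f(1) S, of k] intrinsic_volume_scaleR[OF Q _ s, of k] k by simp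
  also have "\<dots> \<le> intrinsic_volume k E"
    using intrinsic_volume_mono[OF S' E(2,3) \<open>?S \<subseteq> E\<close>, of k] k by simp
  finally show ?thesis .
qed

section \<open>The model caps\<close>

text \<open>Near a boundary point with outer normal \<open>n\<close> the cap looks like the part of the half-space
  \<open>v \<bullet> n \<ge> 0\<close> cut off by a paraboloid; \<open>\<beta>\<close> is a quadratic form on the tangent space, extended to be
  constant along \<open>n\<close>.\<close>

locale cap_model =
  fixes n :: "real ^ 'n" and \<gamma> :: real and \<beta> :: "real ^ 'n \<Rightarrow> real"
  assumes norm_n: "norm n = 1"
    and \<gamma>_pos: "0 < \<gamma>"
    and \<beta>_cont: "continuous_on UNIV \<beta>"
    and \<beta>_convex: "convex_on UNIV \<beta>"
    and \<beta>_scale: "\<And>t v. \<beta> (t *\<^sub>R v) = t\<^sup>2 * \<beta> v"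
    and \<beta>_shift: "\<And>s v. \<beta> (v + s *\<^sub>R n) = \<beta> v"
    and \<beta>_pos: "\<And>v. v \<bullet> n = 0 \<Longrightarrow> v \<noteq> 0 \<Longrightarrow> 0 < \<beta> v"
begin

definition q :: "real ^ 'n \<Rightarrow> real" where "q v = \<gamma> * (v \<bullet> n) + \<beta> v"

definition S :: "real \<Rightarrow> (real ^ 'n) set" where "S \<tau> = {v. 0 \<le> v \<bullet> n \<and> q v \<le> \<tau>}"

lemma nn: "n \<bullet> n = 1"
  using norm_n by (simp add: dot_square_norm)

lemma \<beta>_0: "\<beta> 0 = 0"
  using \<beta>_scale[of 0 0] by simp

lemma \<beta>_proj: "\<beta> (v - (v \<bullet> n) *\<^sub>R n) = \<beta> v"
  using \<beta>_shift[of v "- (v \<bullet> n)"] by simp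

lemma \<beta>_nonneg: "0 \<le> \<beta> v"
proof -
  let ?w = "v - (v \<bullet> n) *\<^sub>R n"
  have "?w \<bullet> n = 0" using nn by (simp add: inner_diff_left)
  then have "0 \<le> \<beta> ?w" using \<beta>_pos[of ?w] \<beta>_0 by (cases "?w = 0") (auto simp: less_imp_le)
  then show ?thesis by (simp add: \<beta>_proj)
qed

lemma q_0 [simp]: "q 0 = 0"
  by (simp add: q_def \<beta>_0)

lemma q_cont: "continuous_on A q"
  unfolding q_def using continuous_on_subset[OF \<beta>_cont] by (auto intro!: continuous_intros)

lemma q_pos: "0 \<le> v \<bullet> n \<Longrightarrow> v \<noteq> 0 \<Longrightarrow> 0 < q v"
  using \<beta>_pos[of v] \<beta>_nonneg[of v] \<gamma>_pos by (cases "v \<bullet> n = 0") (auto simp: q_def add_pos_nonneg)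

lemma q_nonneg: "0 \<le> v \<bullet> n \<Longrightarrow> 0 \<le> q v"
  using \<beta>_nonneg[of v] \<gamma>_pos by (simp add: q_def)

text \<open>The linear part scales by \<open>t\<close>, the quadratic part by
  \<open>t\<^sup>2 \<le> t\<close>.\<close>

lemma q_scale_le: "0 \<le> t \<Longrightarrow> t \<le> 1 \<Longrightarrow> q (t *\<^sub>R v) \<le> t * q v"
  using mult_right_mono[of "t\<^sup>2" t "\<beta> v"] \<beta>_nonneg[of v]
  by (simp add: q_def \<beta>_scale distrib_left mult.left_commute power2_eq_square mult_left_le)

text \<open>Compactness gives a positive minimum on the half-sphere of radius \<open>r\<close>.
  Shrinking a longer vector onto that sphere does not increase \<open>q\<close>, so the minimum is a
  bound further out as well.\<close>

lemma q_lower_bound: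
  assumes "0 < r"
  obtains m where "0 < m" "\<And>v. 0 \<le> v \<bullet> n \<Longrightarrow> r \<le> norm v \<Longrightarrow> m \<le> q v"
proof -
  let ?K = "sphere 0 r \<inter> {v. 0 \<le> n \<bullet> v}"
  have "compact ?K" by (intro compact_Int_closed compact_sphere closed_halfspace_ge)
  moreover have "r *\<^sub>R n \<in> ?K" using assms norm_n nn by simp
  ultimately obtain w where w: "w \<in> ?K" "\<And>v. v \<in> ?K \<Longrightarrow> q w \<le> q v"
    using continuous_attains_inf[of ?K q] q_cont by blast
  show ?thesis
  proof
    show "0 < q w" using w(1) assms by (intro q_pos) (auto simp: inner_commute)
    fix v assume v: "0 \<le> v \<bullet> n" "r \<le> norm v"
    define t where "t = r / norm v"
    have "0 < norm v" using v assms by linarith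
    then have t: "0 \<le> t" "t \<le> 1" "t * norm v = r" using v assms by (auto simp: t_def)
    have "t *\<^sub>R v \<in> ?K" using t v by (simp add: inner_commute)
    then have "q w \<le> t * q v" using w(2)[of "t *\<^sub>R v"] q_scale_le[OF t(1,2), of v] by linarith
    also have "\<dots> \<le> q v" using t q_nonneg[OF v(1)] by (simp add: mult_left_le_one_le)
    finally show "q w \<le> q v" .
  qed
qed

lemma S_subset_ball:
  assumes "0 < r"
  obtains \<tau>\<^sub>0 where "0 < \<tau>\<^sub>0" "\<And>\<tau>. \<tau> < \<tau>\<^sub>0 \<Longrightarrow> S \<tau> \<subseteq> ball 0 r"
proof -
  obtain m where "0 < m" "\<And>v. 0 \<le> v \<bullet> n \<Longrightarrow> r \<le> norm v \<Longrightarrow> m \<le> q v"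
    using q_lower_bound[OF assms] by blast
  then show ?thesis by (intro that[of m]) (force simp: S_def)+
qed

lemma convex_S: "convex (S \<tau>)"
proof -
  have "convex_on UNIV (\<lambda>v. n \<bullet> v)" by (auto simp: convex_on_def inner_add_right)
  then have "convex_on UNIV (\<lambda>v. \<gamma> * (n \<bullet> v) + \<beta> v)"
    using \<gamma>_pos \<beta>_convex by (intro convex_on_add convex_on_cmul) auto
  then have "convex_on UNIV q" by (simp add: q_def[abs_def] inner_commute)
  have "convex {v. q v \<le> \<tau>}"
  proof (rule convexI)
    fix x y and u v :: real
    assume *: "x \<in> {v. q v \<le> \<tau>}" "y \<in> {v. q v \<le> \<tau>}" "0 \<le> u" "0 \<le> v" "u + v = 1"
    have "q (u *\<^sub>R x + v *\<^sub>R y) \<le> u * q x + v * q y"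
      using \<open>convex_on UNIV q\<close> * by (auto simp: convex_on_def)
    also have "\<dots> \<le> \<tau>" using * by (intro convex_bound_le) auto
    finally show "u *\<^sub>R x + v *\<^sub>R y \<in> {v. q v \<le> \<tau>}" by simp
  qed
  then have "convex ({v. n \<bullet> v \<ge> 0} \<inter> {v. q v \<le> \<tau>})"
    by (intro convex_Int convex_halfspace_ge)
  moreover have "{v. n \<bullet> v \<ge> 0} \<inter> {v. q v \<le> \<tau>} = S \<tau>" by (auto simp: S_def inner_commute)
  ultimately show ?thesis by simp
qed

lemma zero_in_S: "0 \<le> \<tau> \<Longrightarrow> 0 \<in> S \<tau>"
  by (simp add: S_def)

lemma compact_S: "compact (S \<tau>)"
proof -
  have "closed {v. q v \<le> \<tau>}"
    using q_cont[of UNIV] by (intro closed_Collect_le) (auto intro: continuous_intros)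
  then have "closed ({v. n \<bullet> v \<ge> 0} \<inter> {v. q v \<le> \<tau>})" by (intro closed_Int closed_halfspace_ge)
  moreover have "{v. n \<bullet> v \<ge> 0} \<inter> {v. q v \<le> \<tau>} = S \<tau>" by (auto simp: S_def inner_commute)
  moreover have "bounded (S \<tau>)"
  proof -
    obtain \<tau>\<^sub>0 where \<tau>\<^sub>0: "0 < \<tau>\<^sub>0" "\<And>\<tau>. \<tau> < \<tau>\<^sub>0 \<Longrightarrow> S \<tau> \<subseteq> ball 0 1"
      using S_subset_ball[of 1] by auto
    \<comment> \<open>Shrinking by \<open>s\<close> brings the level below
      \<open>\<tau>\<^sub>0\<close>, where the set lies in the unit ball;
      \<open>\<bar>\<tau>\<bar> + 1\<close> is a positive bound for \<tau> of either sign.\<close>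
    define s where "s = min 1 (\<tau>\<^sub>0 / (2 * (\<bar>\<tau>\<bar> + 1)))"
    have s: "0 < s" "s \<le> 1" "s * \<tau> < \<tau>\<^sub>0"
    proof -
      show "0 < s" "s \<le> 1" using \<tau>\<^sub>0(1) by (auto simp: s_def)
      have "s * \<tau> \<le> s * (\<bar>\<tau>\<bar> + 1)" using \<open>0 < s\<close> by (intro mult_left_mono) auto
      also have "\<dots> \<le> \<tau>\<^sub>0 / (2 * (\<bar>\<tau>\<bar> + 1)) * (\<bar>\<tau>\<bar> + 1)" by (intro mult_right_mono) (auto simp: s_def)
      also have "\<dots> = \<tau>\<^sub>0 / 2" by (simp add: divide_simps add_nonneg_eq_0_iff)
      finally show "s * \<tau> < \<tau>\<^sub>0" using \<tau>\<^sub>0(1) by simp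
    qed
    have "norm v \<le> 1 / s" if "v \<in> S \<tau>" for v
    proof -
      have "q (s *\<^sub>R v) \<le> s * \<tau>"
      proof -
        have "s * q v \<le> s * \<tau>" using that s by (intro mult_left_mono) (auto simp: S_def)
        then show ?thesis using q_scale_le[of s v] s by linarith
      qed
      then have "s *\<^sub>R v \<in> S (s * \<tau>)" using that s by (simp add: S_def)
      then have "s *\<^sub>R v \<in> ball 0 1" using \<tau>\<^sub>0(2) s(3) by blast
      then show ?thesis using s by (simp add: field_simps)
    qed
    then show ?thesis by (rule boundedI)
  qed
  ultimately show ?thesis by (simp add: compact_eq_bounded_closed)
qed

text \<open>The limit shape of \<open>S \<tau>\<close> divided by \<open>sqrt \<tau>\<close>. For
  the quadratic form of a boundary point it is an ellipsoid in the tangent space, a solid Dupin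
  indicatrix up to normalisation.\<close>

definition E :: "(real ^ 'n) set" where "E = {v. v \<bullet> n = 0 \<and> \<beta> v \<le> 1}"

lemma E_eq: "E = S 1 \<inter> {v. n \<bullet> v = 0}"
  by (auto simp: E_def S_def q_def inner_commute)

lemma E: "compact E" "convex E" "E \<noteq> {}"
proof -
  show "compact E" unfolding E_eq by (intro compact_Int_closed compact_S closed_hyperplane)
  show "convex E" unfolding E_eq by (intro convex_Int convex_S convex_hyperplane)
  have "0 \<in> E" by (simp add: E_def \<beta>_0)
  then show "E \<noteq> {}" by blast
qed

lemma intrinsic_volume_E_pos: "k < CARD('n) \<Longrightarrow> 0 < intrinsic_volume k E"
proof -
  assume k: "k < CARD('n)"
  have "isCont \<beta> 0" using \<beta>_cont by (simp add: continuous_on_eq_continuous_at)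
  then obtain \<rho> where \<rho>: "0 < \<rho>" "\<And>v. norm v < \<rho> \<Longrightarrow> \<bar>\<beta> v\<bar> < 1"
    unfolding continuous_at_eps_delta by (metis \<beta>_0 diff_zero dist_norm dist_real_def zero_less_one)
  have "{v. v \<bullet> n = 0 \<and> norm v \<le> \<rho> / 2} \<subseteq> E"
  proof
    fix v assume v: "v \<in> {v. v \<bullet> n = 0 \<and> norm v \<le> \<rho> / 2}"
    then have "norm v < \<rho>" using \<rho>(1) by auto
    then show "v \<in> E" using \<rho>(2)[of v] v by (auto simp: E_def)
  qed
  then show ?thesis
    using intrinsic_volume_disc_pos[OF norm_n, of "\<rho> / 2" E k] \<rho>(1) E k by simp
qed

text \<open>\<open>S \<tau>\<close> rises at most \<open>\<tau> / \<gamma>\<close> above the tangent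
  space, which is \<open>sqrt \<tau>\<close> times a segment of length
  \<open>sqrt \<tau> / \<gamma>\<close>.\<close>

lemma S_between:
  assumes \<tau>: "0 < \<tau>"
  shows "(\<lambda>x. sqrt \<tau> *\<^sub>R x) ` E \<subseteq> S \<tau>"
    and "S \<tau> \<subseteq> (\<lambda>x. sqrt \<tau> *\<^sub>R x) ` (E + closed_segment 0 ((sqrt \<tau> / \<gamma>) *\<^sub>R n))"
proof -
  show "(\<lambda>x. sqrt \<tau> *\<^sub>R x) ` E \<subseteq> S \<tau>"
    using \<tau> by (auto simp: E_def S_def q_def \<beta>_scale mult_left_le)
  show "S \<tau> \<subseteq> (\<lambda>x. sqrt \<tau> *\<^sub>R x) ` (E + closed_segment 0 ((sqrt \<tau> / \<gamma>) *\<^sub>R n))"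
  proof
    fix v assume v: "v \<in> S \<tau>"
    let ?w = "v - (v \<bullet> n) *\<^sub>R n"
    define s where "s = (v \<bullet> n) / sqrt \<tau>"
    have "\<beta> v \<le> \<tau>" using v \<gamma>_pos by (auto simp: S_def q_def) (smt (verit) mult_nonneg_nonneg)
    have "\<beta> ((1 / sqrt \<tau>) *\<^sub>R ?w) = \<beta> v / \<tau>"
      unfolding \<beta>_scale \<beta>_proj using \<tau> by (simp add: power_divide)
    then have w: "(1 / sqrt \<tau>) *\<^sub>R ?w \<in> E"
      using \<open>\<beta> v \<le> \<tau>\<close> \<tau> nn by (simp add: E_def inner_diff_left)
    have "\<gamma> * (v \<bullet> n) \<le> \<tau>" using v \<beta>_nonneg[of v] by (simp add: S_def q_def)
    then have "v \<bullet> n \<le> \<tau> / \<gamma>" using \<gamma>_pos by (simp add: field_simps)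
    then have "s \<le> \<tau> / \<gamma> / sqrt \<tau>" unfolding s_def using \<tau> by (intro divide_right_mono) auto
    also have "\<dots> = \<tau> / sqrt \<tau> / \<gamma>" by (simp add: mult.commute)
    also have "\<dots> = sqrt \<tau> / \<gamma>" using \<tau> real_div_sqrt[of \<tau>] by simp
    finally have "0 \<le> s" "s \<le> sqrt \<tau> / \<gamma>" using v \<tau> by (auto simp: s_def S_def)
    then have "(1 / sqrt \<tau>) *\<^sub>R ?w + s *\<^sub>R n \<in> E + closed_segment 0 ((sqrt \<tau> / \<gamma>) *\<^sub>R n)"
      using w \<tau> \<gamma>_pos by (subst mem_set_plus_segment) auto
    moreover have "v = sqrt \<tau> *\<^sub>R ((1 / sqrt \<tau>) *\<^sub>R ?w + s *\<^sub>R n)"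
      using \<tau> by (simp add: scaleR_add_right s_def)
    ultimately show "v \<in> (\<lambda>x. sqrt \<tau> *\<^sub>R x) ` (E + closed_segment 0 ((sqrt \<tau> / \<gamma>) *\<^sub>R n))"
      by (rule image_eqI[rotated])
  qed
qed

text \<open>Homogeneity of degree \<open>k\<close> removes the dilation by
  \<open>sqrt \<tau>\<close> from both inclusions; what separates the two bounds is a segment of
  length \<open>sqrt \<tau> / \<gamma>\<close>, which disappears in the limit.\<close>

lemma intrinsic_volume_S_asymp:
  assumes k: "k < CARD('n)"
  shows "((\<lambda>\<tau>. intrinsic_volume k (S \<tau>) / \<tau> powr (real k / 2)) \<longlongrightarrow> intrinsic_volume k E) (at_right 0)"
proof (rule tendsto_sandwich)
  let ?G = "\<lambda>s. E + closed_segment 0 (s *\<^sub>R n)"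
  have G: "compact (?G s)" "convex (?G s)" "?G s \<noteq> {}" for s
  proof -
    show "compact (?G s)" "convex (?G s)" using E by (auto intro: compact_set_plus convex_set_plus)
    show "?G s \<noteq> {}" using E(3) by (auto simp: set_plus_def)
  qed
  have pw: "sqrt \<tau> ^ k = \<tau> powr (real k / 2)" if "0 < \<tau>" for \<tau>
    using that by (simp add: powr_half_sqrt[symmetric] powr_realpow[symmetric] powr_powr)
  have k': "k \<le> CARD('n)" using k by simp
  have im: "compact ((\<lambda>x. c *\<^sub>R x) ` A)" "convex ((\<lambda>x. c *\<^sub>R x) ` A)" "(\<lambda>x. c *\<^sub>R x) ` A \<noteq> {}"
    if "compact A" "convex A" "A \<noteq> {}" for A :: "(real ^ 'n) set" and c
    using that compact_scaling convex_scaling by blast+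
  have Sne: "S \<tau> \<noteq> {}" if "0 < \<tau>" for \<tau> using zero_in_S[of \<tau>] that by auto
  show "eventually (\<lambda>\<tau>. intrinsic_volume k E \<le> intrinsic_volume k (S \<tau>) / \<tau> powr (real k / 2)) (at_right 0)"
    using eventually_at_right_less[of "0::real"]
  proof eventually_elim
    case (elim \<tau>)
    have "sqrt \<tau> ^ k * intrinsic_volume k E \<le> intrinsic_volume k (S \<tau>)"
      using intrinsic_volume_mono[OF im[OF E] compact_S convex_S S_between(1)[OF elim] k']
        intrinsic_volume_scaleR[OF E k', of "sqrt \<tau>"] elim by simp
    then show ?case using elim by (simp add: pw pos_le_divide_eq mult.commute)
  qed
  show "eventually (\<lambda>\<tau>. intrinsic_volume k (S \<tau>) / \<tau> powr (real k / 2) \<le> intrinsic_volume k (?G (sqrt \<tau> / \<gamma>))) (at_right 0)"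
    using eventually_at_right_less[of "0::real"]
  proof eventually_elim
    case (elim \<tau>)
    have "intrinsic_volume k (S \<tau>) \<le> sqrt \<tau> ^ k * intrinsic_volume k (?G (sqrt \<tau> / \<gamma>))"
      using intrinsic_volume_mono[OF compact_S convex_S Sne[OF elim] im(1,2)[OF G] S_between(2)[OF elim] k']
        intrinsic_volume_scaleR[OF G k', of "sqrt \<tau>"] elim by simp
    then show ?case using elim by (simp add: pw pos_divide_le_eq mult.commute)
  qed
  have "filterlim (\<lambda>\<tau>. sqrt \<tau> / \<gamma>) (at_right 0) (at_right 0)"
    unfolding filterlim_at
  proof
    show "eventually (\<lambda>\<tau>. sqrt \<tau> / \<gamma> \<in> {0<..} \<and> sqrt \<tau> / \<gamma> \<noteq> 0) (at_right 0)"
      using eventually_at_right_less[of "0::real"] by eventually_elim (use \<gamma>_pos in auto)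
    have "((\<lambda>\<tau>. sqrt \<tau> / \<gamma>) \<longlongrightarrow> sqrt 0 / \<gamma>) (at_right 0)"
      using \<gamma>_pos by (intro tendsto_intros) auto
    then show "((\<lambda>\<tau>. sqrt \<tau> / \<gamma>) \<longlongrightarrow> 0) (at_right 0)" by simp
  qed
  from filterlim_compose[OF intrinsic_volume_plus_segment_tendsto[OF E k'] this]
  show "((\<lambda>\<tau>. intrinsic_volume k (?G (sqrt \<tau> / \<gamma>))) \<longlongrightarrow> intrinsic_volume k E) (at_right 0)" .
qed simp

text \<open>The parabolic dilation: factor \<open>sqrt \<tau>\<close> tangentially and
  \<open>\<tau>\<close> along \<open>n\<close>, so that both terms of \<open>q\<close> are
  multiplied by \<open>\<tau>\<close>.\<close>

lemma S_scaled:
  assumes \<tau>: "0 < \<tau>"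
  defines "T \<equiv> \<lambda>v. sqrt \<tau> *\<^sub>R (v - (v \<bullet> n) *\<^sub>R n) + (\<tau> * (v \<bullet> n)) *\<^sub>R n"
  shows "linear T" "inj T" "T ` S 1 = S \<tau>"
proof -
  define T' where "T' v = (1 / sqrt \<tau>) *\<^sub>R (v - (v \<bullet> n) *\<^sub>R n) + ((v \<bullet> n) / \<tau>) *\<^sub>R n" for v
  show "linear T"
    by (rule linearI) (simp_all add: T_def algebra_simps inner_add_left scaleR_add_left)
  have T_eq: "T v = sqrt \<tau> *\<^sub>R (v - (v \<bullet> n) *\<^sub>R n) + (\<tau> * (v \<bullet> n)) *\<^sub>R n" for v
    by (simp add: T_def)
  have Tn: "T v \<bullet> n = \<tau> * (v \<bullet> n)" "T' v \<bullet> n = (v \<bullet> n) / \<tau>" for v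
    using nn by (simp_all add: T_def T'_def inner_add_left inner_diff_left)
  have inv: "T' (T v) = v" "T (T' v) = v" for v
    using \<tau> by (simp_all add: T'_def[of "T v"] T_eq[of "T' v"] Tn) (simp_all add: T_def T'_def algebra_simps)
  show "inj T" by (rule injI) (metis inv(1))
  have \<beta>T: "\<beta> (T v) = \<tau> * \<beta> v" for v
    using \<tau> by (simp add: T_def \<beta>_shift \<beta>_scale \<beta>_proj)
  have qT: "q (T v) = \<tau> * q v" for v
    by (simp add: q_def Tn \<beta>T algebra_simps)
  have TS: "T v \<in> S \<tau> \<longleftrightarrow> v \<in> S 1" for v
    using \<tau> by (simp add: S_def qT Tn zero_le_mult_iff)
  show "T ` S 1 = S \<tau>"
  proof (intro equalityI subsetI)
    fix v assume "v \<in> S \<tau>"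
    then show "v \<in> T ` S 1" using TS[of "T' v"] by (intro image_eqI[of _ _ "T' v"]) (simp_all add: inv)
  qed (use TS in auto)
qed

text \<open>The factor of \<open>T\<close> is found on a unit cube with one edge rotated into
  \<open>n\<close>: there \<open>T\<close> is diagonal with one entry \<open>\<tau>\<close> and
  \<open>d - 1\<close> entries \<open>sqrt \<tau>\<close>, whence the exponent
  \<open>1 + (d - 1) / 2\<close>.\<close>

lemma measure_S:
  assumes \<tau>: "0 < \<tau>"
  shows "measure lebesgue (S \<tau>) = \<tau> powr ((real CARD('n) + 1) / 2) * measure lebesgue (S 1)"
proof -
  define T where "T v = sqrt \<tau> *\<^sub>R (v - (v \<bullet> n) *\<^sub>R n) + (\<tau> * (v \<bullet> n)) *\<^sub>R n" for v
  have T: "linear T" "inj T" "T ` S 1 = S \<tau>"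
    using S_scaled[OF \<tau>] by (simp_all add: T_def[abs_def])
  define c where "c = measure lebesgue (T ` ball 0 1) / measure lebesgue (ball (0 :: real ^ 'n) 1)"
  have c: "measure lebesgue (T ` A) = c * measure lebesgue A" if "compact A" "convex A" for A
    unfolding c_def by (rule measure_linear_image_convex[OF T(1,2) that])
  obtain i0 :: 'n where True by simp
  have "norm (axis i0 1 :: real ^ 'n) = norm n" using norm_n by (simp add: norm_axis_1)
  from orthogonal_transformation_exists[OF this] obtain f :: "real ^ 'n \<Rightarrow> real ^ 'n"
    where f: "orthogonal_transformation f" "f (axis i0 1) = n" .
  have lin: "linear f" using f by (simp add: orthogonal_transformation_linear)
  define D :: "real ^ 'n \<Rightarrow> real ^ 'n" where "D x = (\<chi> i. if i = i0 then \<tau> * x $ i else sqrt \<tau> * x $ i)" for x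
  have fn: "f x \<bullet> n = x $ i0" for x
    using f by (metis orthogonal_transformation_def inner_axis inner_real_def mult_1_right)
  have TD: "T (f x) = f (D x)" for x
  proof -
    have "D x = sqrt \<tau> *\<^sub>R (x - (x $ i0) *\<^sub>R axis i0 1) + (\<tau> * x $ i0) *\<^sub>R axis i0 1"
      by (auto simp: D_def vec_eq_iff axis_def)
    then show ?thesis
      by (simp add: T_def fn lin f(2) linear_add linear_diff linear_scale)
  qed
  define b :: "real ^ 'n" where "b = (\<chi> i. if i = i0 then \<tau> else sqrt \<tau>)"
  have DQ: "D ` cbox 0 1 = cbox 0 b"
  proof (intro equalityI subsetI)
    fix y assume "y \<in> D ` cbox 0 1"
    then show "y \<in> cbox 0 b" using \<tau> by (auto simp: D_def b_def mem_box_cart mult_left_le)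
  next
    fix y assume y: "y \<in> cbox 0 b"
    have yi: "0 \<le> y $ i" "y $ i \<le> (if i = i0 then \<tau> else sqrt \<tau>)" for i
      using y by (auto simp: b_def mem_box_cart)
    let ?x = "(\<chi> i. if i = i0 then y $ i / \<tau> else y $ i / sqrt \<tau>) :: real ^ 'n"
    have "0 \<le> ?x $ i \<and> ?x $ i \<le> 1" for i using yi[of i] \<tau> by (auto split: if_splits)
    then have "?x \<in> cbox 0 1" by (simp add: mem_box_cart)
    moreover have "D ?x = y" using \<tau> by (auto simp: D_def vec_eq_iff)
    ultimately show "y \<in> D ` cbox 0 1" by force
  qed
  have Q: "compact (cbox 0 1 :: (real ^ 'n) set)" "convex (cbox 0 1 :: (real ^ 'n) set)" by auto
  have fQ: "compact (f ` cbox 0 1)" "convex (f ` cbox 0 1)"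
    using lin by (auto intro!: compact_continuous_image linear_continuous_on convex_linear_image simp: linear_linear)
  have "T ` (f ` cbox 0 1) = f ` (D ` cbox 0 1)"
    by (simp add: image_image TD)
  then have "c * measure lebesgue (cbox 0 1 :: (real ^ 'n) set) = measure lebesgue (cbox 0 b)"
    using c[OF fQ] measure_orthogonal_image_convex[OF f(1)] by (simp add: DQ)
  also have "measure lebesgue (cbox 0 b) = (\<Prod>i\<in>UNIV. b $ i)"
  proof -
    have "cbox 0 b \<noteq> {}" using \<tau> by (auto simp: interval_ne_empty_cart b_def)
    from content_cbox_cart[OF this] show ?thesis by simp
  qed
  also have "measure lebesgue (cbox 0 1 :: (real ^ 'n) set) = 1"
  proof -
    have "cbox 0 (1 :: real ^ 'n) \<noteq> {}" by (auto simp: interval_ne_empty_cart)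
    from content_cbox_cart[OF this] show ?thesis by simp
  qed
  also have "(\<Prod>i\<in>UNIV. b $ i) = \<tau> * (\<Prod>i\<in>UNIV - {i0}. b $ i)"
    by (subst prod.remove[of _ i0]) (auto simp: b_def)
  also have "(\<Prod>i\<in>UNIV - {i0}. b $ i) = (\<Prod>i\<in>UNIV - {i0}. sqrt \<tau>)"
    by (intro prod.cong) (auto simp: b_def)
  also have "\<dots> = sqrt \<tau> ^ (CARD('n) - 1)" by (simp add: card_Diff_singleton)
  also have "\<tau> * \<dots> = \<tau> powr ((real CARD('n) + 1) / 2)"
  proof -
    have "sqrt \<tau> ^ (CARD('n) - 1) = \<tau> powr (real (CARD('n) - 1) / 2)"
      using \<tau> by (simp add: powr_half_sqrt[symmetric] powr_realpow[symmetric] powr_powr)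
    moreover have "\<tau> * \<tau> powr x = \<tau> powr (1 + x)" for x using \<tau> by (simp add: powr_add)
    moreover have "1 + real (CARD('n) - 1) / 2 = (real CARD('n) + 1) / 2"
      by (simp add: of_nat_diff Suc_leI field_simps)
    ultimately show ?thesis by (simp only:)
  qed
  finally have "c = \<tau> powr ((real CARD('n) + 1) / 2)" by simp
  then show ?thesis using c[OF compact_S convex_S, of 1] T(3) by simp
qed

lemma measure_S_1_pos: "0 < measure lebesgue (S 1)"
proof -
  have "isCont q 0" using q_cont[of UNIV] by (simp add: continuous_on_eq_continuous_at)
  then obtain \<rho> where \<rho>: "0 < \<rho>" "\<And>v. norm v < \<rho> \<Longrightarrow> \<bar>q v\<bar> < 1"
    unfolding continuous_at_eps_delta by (metis q_0 diff_zero dist_norm dist_real_def zero_less_one)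
  let ?U = "ball 0 \<rho> \<inter> {v. n \<bullet> v > 0}"
  have "open ?U" by (intro open_Int open_ball open_halfspace_gt)
  moreover have "(\<rho> / 2) *\<^sub>R n \<in> ?U" using \<rho>(1) norm_n nn by simp
  moreover have sub: "?U \<subseteq> S 1" using \<rho>(2) by (force simp: S_def inner_commute)
  ultimately have "interior (S 1) \<noteq> {}" using interior_maximal by blast
  then have "\<not> negligible (S 1)" using negligible_convex_interior[OF convex_S] by blast
  then show ?thesis
    using lmeasurable_compact[OF compact_S[of 1]] negligible_iff_measure0 zero_less_measure_iff by blast
qed

theorem intrinsic_volume_S_limit:
  assumes k: "k \<le> CARD('n)"
  shows "\<exists>M>0. ((\<lambda>\<tau>. intrinsic_volume k (S \<tau>) / \<tau> powr cap_exponent CARD('n) k) \<longlongrightarrow> M) (at_right 0)"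
proof (cases "k = CARD('n)")
  case True
  have "eventually (\<lambda>\<tau>. measure lebesgue (S 1) = intrinsic_volume k (S \<tau>) / \<tau> powr cap_exponent CARD('n) k) (at_right 0)"
    using eventually_at_right_less[of "0::real"]
  proof eventually_elim
    case (elim \<tau>)
    have "S \<tau> \<noteq> {}" using zero_in_S[of \<tau>] elim by auto
    then show ?case
      using intrinsic_volume_dim[OF compact_S convex_S, of \<tau>] measure_S[OF elim] True elim
      by (simp add: cap_exponent_def)
  qed
  then have "((\<lambda>\<tau>. intrinsic_volume k (S \<tau>) / \<tau> powr cap_exponent CARD('n) k) \<longlongrightarrow> measure lebesgue (S 1)) (at_right 0)"
    by (intro Lim_transform_eventually[OF tendsto_const])
  then show ?thesis using measure_S_1_pos by blast
next
  case False
  then have "k < CARD('n)" using k by simp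
  then show ?thesis
    using intrinsic_volume_S_asymp[of k] intrinsic_volume_E_pos[of k] False by (auto simp: cap_exponent_def)
qed

end

section \<open>Second-order calculus at a point\<close>

text \<open>The increment \<open>h\<close> and the argument \<open>w\<close> are kept apart: with
  \<open>w\<close> parallel to \<open>h\<close> this gives Taylor's formula, with independent
  vectors the symmetry of the second derivative.\<close>

lemma second_derivative_remainder:
  fixes f' :: "'a::real_normed_vector \<Rightarrow> 'a \<Rightarrow>\<^sub>L real"
  assumes ev: "eventually (\<lambda>y. (f has_derivative blinfun_apply (f' y)) (at y)) (nhds x)"
    and B: "(f' has_derivative B) (at x)" and "0 < e"
  obtains d where "0 < d" "\<And>y. norm (y - x) < d \<Longrightarrow> (f has_derivative blinfun_apply (f' y)) (at y)"
    "\<And>h w. norm h < d \<Longrightarrow> \<bar>f' (x + h) w - f' x w - B h w\<bar> \<le> e * norm h * norm w"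
proof -
  obtain d1 where d1: "0 < d1" "\<And>y. dist y x < d1 \<Longrightarrow> (f has_derivative blinfun_apply (f' y)) (at y)"
    using ev unfolding eventually_nhds_metric by blast
  obtain d2 where d2: "0 < d2" "\<And>y. norm (y - x) < d2 \<Longrightarrow> norm (f' y - f' x - B (y - x)) \<le> e * norm (y - x)"
    using B \<open>0 < e\<close> unfolding has_derivative_at_alt by blast
  have "\<bar>f' (x + h) w - f' x w - B h w\<bar> \<le> e * norm h * norm w" if "norm h < d2" for h w
  proof -
    have "f' (x + h) w - f' x w - B h w = (f' (x + h) - f' x - B h) w"
      by (simp add: blinfun.diff_left)
    also have "\<bar>\<dots>\<bar> \<le> norm (f' (x + h) - f' x - B h) * norm w"
      using norm_blinfun[of "f' (x + h) - f' x - B h" w] by simp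
    also have "\<dots> \<le> e * norm h * norm w"
      using d2(2)[of "x + h"] that by (intro mult_right_mono) auto
    finally show ?thesis .
  qed
  then show ?thesis
    using d1 d2(1) by (intro that[of "min d1 d2"]) (auto simp: dist_norm)
qed

text \<open>\<open>f'\<close> is known to be differentiable at \<open>x\<close> alone, so there is
  no second derivative at intermediate points. Instead the quadratic polynomial is subtracted before
  the mean value theorem is applied along the segment.\<close>

lemma taylor_second_order:
  fixes f' :: "'a::real_normed_vector \<Rightarrow> 'a \<Rightarrow>\<^sub>L real"
  assumes ev: "eventually (\<lambda>y. (f has_derivative blinfun_apply (f' y)) (at y)) (nhds x)"
    and B: "(f' has_derivative B) (at x)" and "0 < e"
  obtains d where "0 < d"
    "\<And>h. norm h < d \<Longrightarrow> \<bar>f (x + h) - f x - f' x h - B h h / 2\<bar> \<le> e * (norm h)\<^sup>2"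
proof -
  obtain d where d: "0 < d" "\<And>y. norm (y - x) < d \<Longrightarrow> (f has_derivative blinfun_apply (f' y)) (at y)"
    "\<And>h w. norm h < d \<Longrightarrow> \<bar>f' (x + h) w - f' x w - B h w\<bar> \<le> e * norm h * norm w"
    using second_derivative_remainder[OF assms] by blast
  have lin: "linear B" using B has_derivative_bounded_linear bounded_linear.linear by blast
  show ?thesis
  proof (rule that[OF d(1)])
    fix h :: 'a assume h: "norm h < d"
    define \<phi> where "\<phi> s = f (x + s *\<^sub>R h) - s * f' x h - s\<^sup>2 / 2 * B h h" for s
    have small: "norm (s *\<^sub>R h) < d" if "0 \<le> s" "s \<le> 1" for s
      using that h mult_left_le_one_le[of "norm h" s] by simp
    have der: "(\<phi> has_real_derivative (f' (x + s *\<^sub>R h) h - f' x h - s * B h h)) (at s)"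
      if s: "0 \<le> s" "s \<le> 1" for s
    proof -
      have "((\<lambda>s. f (x + s *\<^sub>R h)) has_derivative (\<lambda>t. f' (x + s *\<^sub>R h) (t *\<^sub>R h))) (at s)"
      proof -
        have a: "((\<lambda>s. x + s *\<^sub>R h) has_derivative (\<lambda>t. t *\<^sub>R h)) (at s)"
          by (auto intro!: derivative_eq_intros)
        have b: "(f has_derivative blinfun_apply (f' (x + s *\<^sub>R h))) (at (x + s *\<^sub>R h))"
          using small[OF s] by (intro d(2)) simp
        show ?thesis using has_derivative_compose[OF a b] .
      qed
      then have "((\<lambda>s. f (x + s *\<^sub>R h)) has_real_derivative f' (x + s *\<^sub>R h) h) (at s)"
        by (simp add: has_field_derivative_def blinfun.scaleR_right mult.commute[of _ "f' (x + s *\<^sub>R h) h"] mult_commute_abs)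
      then show ?thesis
        unfolding \<phi>_def by (auto intro!: derivative_eq_intros)
    qed
    obtain s where s: "0 < s" "s < 1" "\<phi> 1 - \<phi> 0 = f' (x + s *\<^sub>R h) h - f' x h - s * B h h"
      using MVT2[of 0 1 \<phi> "\<lambda>s. f' (x + s *\<^sub>R h) h - f' x h - s * B h h"] der by auto
    have "\<bar>f' (x + s *\<^sub>R h) h - f' x h - B (s *\<^sub>R h) h\<bar> \<le> e * norm (s *\<^sub>R h) * norm h"
      using small[of s] s by (intro d(3)) auto
    also have "\<dots> \<le> e * norm h * norm h"
      using s \<open>0 < e\<close> by (intro mult_right_mono mult_left_mono) (auto simp: mult_left_le_one_le)
    finally have "\<bar>\<phi> 1 - \<phi> 0\<bar> \<le> e * (norm h)\<^sup>2"
      using s(3) lin by (simp add: linear_scale blinfun.scaleR_left power2_eq_square)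
    then show "\<bar>f (x + h) - f x - f' x h - B h h / 2\<bar> \<le> e * (norm h)\<^sup>2"
      by (simp add: \<phi>_def algebra_simps)
  qed
qed

text \<open>The second difference is the increment over \<open>[0, s]\<close> of
  \<open>\<phi>\<close>, itself a difference in direction \<open>v\<close>. One application of the
  mean value theorem reduces it to two values of \<open>f'\<close>, and the remainder estimate
  applies to each.\<close>

lemma second_difference_bound:
  fixes f' :: "'a::real_normed_vector \<Rightarrow> 'a \<Rightarrow>\<^sub>L real"
  assumes ev: "eventually (\<lambda>y. (f has_derivative blinfun_apply (f' y)) (at y)) (nhds x)"
    and B: "(f' has_derivative B) (at x)" and "0 < e"
  obtains d where "0 < d" "\<And>s. 0 < s \<Longrightarrow> s < d \<Longrightarrow>
    \<bar>f (x + s *\<^sub>R v + s *\<^sub>R w) - f (x + s *\<^sub>R w) - f (x + s *\<^sub>R v) + f x - s\<^sup>2 * B v w\<bar>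
      \<le> e * s\<^sup>2 * (2 * (norm v + norm w) * norm w)"
proof -
  obtain d where d: "0 < d" "\<And>y. norm (y - x) < d \<Longrightarrow> (f has_derivative blinfun_apply (f' y)) (at y)"
    "\<And>h w. norm h < d \<Longrightarrow> \<bar>f' (x + h) w - f' x w - B h w\<bar> \<le> e * norm h * norm w"
    using second_derivative_remainder[OF assms] by blast
  have lin: "linear B" using B has_derivative_bounded_linear bounded_linear.linear by blast
  define N where "N = norm v + norm w"
  have N: "0 \<le> N" by (simp add: N_def)
  \<comment> \<open>This radius ensures \<open>s * N < d\<close>, which keeps both points of
    evaluation in the range of the remainder estimate; the 1 covers \<open>N = 0\<close>.\<close>
  show ?thesis
  proof (rule that[of "d / (N + 1)"])
    show "0 < d / (N + 1)" using d N by simp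
    fix s assume s: "0 < s" "s < d / (N + 1)"
    have sN: "s * N < d"
    proof -
      have "s * N \<le> s * (N + 1)" using s by simp
      also have "\<dots> < d" using s N by (simp add: field_simps)
      finally show ?thesis .
    qed
    have n1: "norm (s *\<^sub>R v + r *\<^sub>R w) \<le> s * N" and n2: "norm (r *\<^sub>R w) \<le> s * N" if "0 \<le> r" "r \<le> s" for r
    proof -
      have r: "r * norm w \<le> s * norm w" using that by (intro mult_right_mono) auto
      show "norm (r *\<^sub>R w) \<le> s * N" using r that s by (simp add: N_def distrib_left add_increasing)
      show "norm (s *\<^sub>R v + r *\<^sub>R w) \<le> s * N"
        using norm_triangle_ineq[of "s *\<^sub>R v" "r *\<^sub>R w"] r that s by (simp add: N_def distrib_left)
    qed
    define \<phi> where "\<phi> r = f (x + s *\<^sub>R v + r *\<^sub>R w) - f (x + r *\<^sub>R w)" for r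
    have line: "((\<lambda>r. f (p + r *\<^sub>R w)) has_real_derivative f' (p + r *\<^sub>R w) w) (at r)"
      if "norm (p + r *\<^sub>R w - x) < d" for p r
    proof -
      have "((\<lambda>r. f (p + r *\<^sub>R w)) has_derivative (\<lambda>t. f' (p + r *\<^sub>R w) (t *\<^sub>R w))) (at r)"
      proof -
        have a: "((\<lambda>r. p + r *\<^sub>R w) has_derivative (\<lambda>t. t *\<^sub>R w)) (at r)"
          by (auto intro!: derivative_eq_intros)
        show ?thesis using has_derivative_compose[OF a d(2)[OF that]] .
      qed
      then show ?thesis
        by (simp add: has_field_derivative_def blinfun.scaleR_right mult_commute_abs)
    qed
    have "(\<phi> has_real_derivative (f' (x + s *\<^sub>R v + r *\<^sub>R w) w - f' (x + r *\<^sub>R w) w)) (at r)"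
      if r: "0 \<le> r" "r \<le> s" for r
      unfolding \<phi>_def using n1[OF r] n2[OF r] sN
      by (intro DERIV_diff line) (auto simp: add.assoc)
    then obtain r where r: "0 < r" "r < s"
      "\<phi> s - \<phi> 0 = s * (f' (x + s *\<^sub>R v + r *\<^sub>R w) w - f' (x + r *\<^sub>R w) w)"
      using MVT2[of 0 s \<phi> "\<lambda>r. f' (x + s *\<^sub>R v + r *\<^sub>R w) w - f' (x + r *\<^sub>R w) w"] s(1) by auto
    let ?a = "f' (x + (s *\<^sub>R v + r *\<^sub>R w)) w - f' x w - B (s *\<^sub>R v + r *\<^sub>R w) w"
    let ?b = "f' (x + r *\<^sub>R w) w - f' x w - B (r *\<^sub>R w) w"
    have e1: "\<bar>?a\<bar> \<le> e * (s * N) * norm w"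
      using d(3)[of "s *\<^sub>R v + r *\<^sub>R w" w] n1[of r] r sN \<open>0 < e\<close>
      by (smt (verit) mult_left_mono mult_right_mono norm_ge_zero)
    have e2: "\<bar>?b\<bar> \<le> e * (s * N) * norm w"
      using d(3)[of "r *\<^sub>R w" w] n2[of r] r sN \<open>0 < e\<close>
      by (smt (verit) mult_left_mono mult_right_mono norm_ge_zero)
    have eq: "\<phi> s - \<phi> 0 - s\<^sup>2 * B v w = s * (?a - ?b)"
      unfolding r(3) using lin
      by (simp add: linear_add linear_scale blinfun.add_left blinfun.scaleR_left power2_eq_square add.assoc algebra_simps)
    have "\<bar>\<phi> s - \<phi> 0 - s\<^sup>2 * B v w\<bar> = s * \<bar>?a - ?b\<bar>"
      unfolding eq using s(1) by (simp add: abs_mult)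
    also have "\<dots> \<le> s * (2 * (e * (s * N) * norm w))"
      using s(1) e1 e2 by (intro mult_left_mono) linarith+
    finally show "\<bar>f (x + s *\<^sub>R v + s *\<^sub>R w) - f (x + s *\<^sub>R w) - f (x + s *\<^sub>R v) + f x - s\<^sup>2 * B v w\<bar>
      \<le> e * s\<^sup>2 * (2 * (norm v + norm w) * norm w)"
      by (simp add: \<phi>_def N_def power2_eq_square mult_ac algebra_simps)
  qed
qed

text \<open>The second difference is symmetric in \<open>v\<close> and \<open>w\<close>, and after
  division by \<open>s\<^sup>2\<close> it approximates both \<open>B v w\<close> and
  \<open>B w v\<close>.\<close>

lemma second_derivative_symmetric:
  fixes f' :: "'a::real_normed_vector \<Rightarrow> 'a \<Rightarrow>\<^sub>L real"
  assumes ev: "eventually (\<lambda>y. (f has_derivative blinfun_apply (f' y)) (at y)) (nhds x)"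
    and B: "(f' has_derivative B) (at x)"
  shows "B v w = B w v"
proof (rule ccontr)
  assume ne: "B v w \<noteq> B w v"
  define C where "C = 2 * (norm v + norm w) * norm w + 2 * (norm w + norm v) * norm v"
  have C: "0 \<le> C" by (simp add: C_def)
  \<comment> \<open>Makes the total error \<open>e * C\<close> less than half of the assumed
    gap.\<close>
  define e where "e = \<bar>B v w - B w v\<bar> / (2 * (C + 1))"
  have e: "0 < e" using ne C by (simp add: e_def)
  obtain d1 where d1: "0 < d1" "\<And>s. 0 < s \<Longrightarrow> s < d1 \<Longrightarrow>
    \<bar>f (x + s *\<^sub>R v + s *\<^sub>R w) - f (x + s *\<^sub>R w) - f (x + s *\<^sub>R v) + f x - s\<^sup>2 * B v w\<bar>
      \<le> e * s\<^sup>2 * (2 * (norm v + norm w) * norm w)"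
    using second_difference_bound[OF ev B e] by blast
  obtain d2 where d2: "0 < d2" "\<And>s. 0 < s \<Longrightarrow> s < d2 \<Longrightarrow>
    \<bar>f (x + s *\<^sub>R w + s *\<^sub>R v) - f (x + s *\<^sub>R v) - f (x + s *\<^sub>R w) + f x - s\<^sup>2 * B w v\<bar>
      \<le> e * s\<^sup>2 * (2 * (norm w + norm v) * norm v)"
    using second_difference_bound[OF ev B e] by blast
  define s where "s = min d1 d2 / 2"
  have s: "0 < s" "s < d1" "s < d2" using d1 d2 by (auto simp: s_def)
  have comm: "x + s *\<^sub>R w + s *\<^sub>R v = x + s *\<^sub>R v + s *\<^sub>R w" by (simp add: add_ac)
  have "\<bar>s\<^sup>2 * B v w - s\<^sup>2 * B w v\<bar> \<le> e * s\<^sup>2 * C"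
    using d1(2)[OF s(1,2)] d2(2)[OF s(1,3)] unfolding C_def comm distrib_left by linarith
  moreover have "s\<^sup>2 * B v w - s\<^sup>2 * B w v = s\<^sup>2 * (B v w - B w v)" by (simp add: right_diff_distrib)
  ultimately have "s\<^sup>2 * \<bar>B v w - B w v\<bar> \<le> s\<^sup>2 * (e * C)"
    by (simp add: abs_mult mult_ac)
  then have "\<bar>B v w - B w v\<bar> \<le> e * C" using s(1) by simp
  also have "\<dots> < \<bar>B v w - B w v\<bar>"
    using C ne by (simp add: e_def divide_simps)
  finally show False by simp
qed

section \<open>Regularity of the norm minus the radial function\<close>

lemma has_derivative_sgn:
  fixes y :: "'a::real_inner"
  assumes "y \<noteq> 0"
  shows "(sgn has_derivative (\<lambda>h. (1 / norm y) *\<^sub>R h - ((1 / norm y) ^ 3 * (h \<bullet> y)) *\<^sub>R y)) (at y)"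
proof -
  have "((\<lambda>y. inverse (norm y) *\<^sub>R y) has_derivative
      (\<lambda>h. inverse (norm y) *\<^sub>R h + (- (inverse (norm y) * (h \<bullet> sgn y) * inverse (norm y))) *\<^sub>R y)) (at y)"
    using assms by (auto intro!: derivative_eq_intros has_derivative_norm)
  moreover have "(\<lambda>y. inverse (norm y) *\<^sub>R y) = (sgn :: 'a \<Rightarrow> 'a)" by (auto simp: sgn_div_norm)
  moreover have "inverse (norm y) *\<^sub>R h + (- (inverse (norm y) * (h \<bullet> sgn y) * inverse (norm y))) *\<^sub>R y =
     (1 / norm y) *\<^sub>R h - ((1 / norm y) ^ 3 * (h \<bullet> y)) *\<^sub>R y" for h
    using assms by (simp add: sgn_div_norm divide_simps power3_eq_cube)
  ultimately show ?thesis by simp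
qed

lemma bounded_bilinear_differentiable:
  assumes "bounded_bilinear bil" "f differentiable (at x)" "g differentiable (at x)"
  shows "(\<lambda>x. bil (f x) (g x)) differentiable (at x)"
  using bounded_bilinear.FDERIV[OF assms(1)] assms(2,3) unfolding differentiable_def by blast

lemma bounded_linear_differentiable:
  assumes "bounded_linear L" "f differentiable (at x)"
  shows "(\<lambda>x. L (f x)) differentiable (at x)"
  using bounded_linear.has_derivative[OF assms(1)] assms(2) unfolding differentiable_def by blast

text \<open>\<open>F'\<close> is written out as an expression in bounded linear maps, so that it
  inherits differentiability from its constituents: \<open>u'\<close> is the derivative of
  \<open>sgn\<close>, and \<open>J\<close> embeds the space into the slice t = 0.\<close>

lemma C2_norm_minus_radial:
  fixes g :: "real \<times> 'a::real_inner \<Rightarrow> real"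
  assumes g: "C2_on_open V g" and x: "x \<noteq> 0" "(0, sgn x) \<in> V"
  obtains F' where
    "eventually (\<lambda>y. ((\<lambda>y. norm y - g (0, sgn y)) has_derivative blinfun_apply (F' y)) (at y)) (nhds x)"
    "F' differentiable (at x)"
proof -
  obtain g' :: "(real \<times> 'a) \<Rightarrow> ((real \<times> 'a) \<Rightarrow>\<^sub>L real)" and g'' where g': "open V"
    "\<And>p. p \<in> V \<Longrightarrow> (g has_derivative blinfun_apply (g' p)) (at p)"
    "\<And>p. p \<in> V \<Longrightarrow> (g' has_derivative blinfun_apply (g'' p)) (at p)"
    using g unfolding C2_on_open_def by blast
  define J :: "'a \<Rightarrow>\<^sub>L (real \<times> 'a)" where "J = Blinfun (\<lambda>h. (0, h))"
  have J: "blinfun_apply J h = (0, h)" for h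
    unfolding J_def by (subst bounded_linear_Blinfun_apply) (auto intro!: bounded_linear_intros)
  define u' :: "'a \<Rightarrow> 'a \<Rightarrow>\<^sub>L 'a" where "u' y = (1 / norm y) *\<^sub>R id_blinfun -
      (1 / norm y) ^ 3 *\<^sub>R (blinfun_scaleR_left y o\<^sub>L blinfun_inner_left y)" for y
  have u': "(sgn has_derivative blinfun_apply (u' y)) (at y)" if "y \<noteq> 0" for y
  proof -
    have "blinfun_apply (u' y) = (\<lambda>h. (1 / norm y) *\<^sub>R h - ((1 / norm y) ^ 3 * (h \<bullet> y)) *\<^sub>R y)"
      by (auto simp: u'_def blinfun.diff_left blinfun.scaleR_left)
    then show ?thesis using has_derivative_sgn[OF that] by simp
  qed
  define F' where "F' y = (1 / norm y) *\<^sub>R blinfun_inner_left y - ((g' (0, sgn y) o\<^sub>L J) o\<^sub>L u' y)" for y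
  show ?thesis
  proof
    have "isCont (\<lambda>y. (0 :: real, sgn y)) x"
      using has_derivative_continuous[OF u'[OF x(1)]] by (intro continuous_Pair continuous_const)
    then have "eventually (\<lambda>y. (0 :: real, sgn y) \<in> V) (nhds x)"
      using g'(1) x(2) by (simp add: continuous_at_open eventually_nhds)
    moreover have "eventually (\<lambda>y. y \<noteq> 0) (nhds x)"
      using x(1) by (intro t1_space_nhds)
    ultimately show "eventually (\<lambda>y. ((\<lambda>y. norm y - g (0, sgn y)) has_derivative blinfun_apply (F' y)) (at y)) (nhds x)"
    proof eventually_elim
      case (elim y)
      have "((\<lambda>y. (0 :: real, sgn y)) has_derivative (\<lambda>h. (0, u' y h))) (at y)"
        by (intro has_derivative_Pair has_derivative_const u' elim)
      then have "((\<lambda>y. g (0, sgn y)) has_derivative (\<lambda>h. g' (0, sgn y) (0, u' y h))) (at y)"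
        using g'(2)[OF elim(1)] by (rule has_derivative_compose)
      from has_derivative_diff[OF has_derivative_norm[OF elim(2)] this]
      have "((\<lambda>y. norm y - g (0, sgn y)) has_derivative (\<lambda>h. h \<bullet> sgn y - g' (0, sgn y) (0, u' y h))) (at y)" .
      moreover have "(\<lambda>h. h \<bullet> sgn y - g' (0, sgn y) (0, u' y h)) = blinfun_apply (F' y)"
        by (auto simp: F'_def blinfun.diff_left blinfun.scaleR_left J sgn_div_norm divide_inverse_commute)
      ultimately show ?case by simp
    qed
    have nd: "(\<lambda>y. 1 / norm y) differentiable (at x)"
      using x(1) by (intro differentiable_divide differentiable_const) auto
    have "(\<lambda>y. g' (0, sgn y)) differentiable (at x)"
    proof -
      have "((\<lambda>y. (0 :: real, sgn y)) has_derivative (\<lambda>h. (0, u' x h))) (at x)"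
        by (intro has_derivative_Pair has_derivative_const u' x)
      then show ?thesis using g'(3)[OF x(2)] has_derivative_compose differentiableI by blast
    qed
    then have gd: "(\<lambda>y. g' (0, sgn y) o\<^sub>L J) differentiable (at x)"
      by (intro bounded_bilinear_differentiable[OF bounded_bilinear_blinfun_compose] differentiable_const)
    have lin: "(\<lambda>y. blinfun_scaleR_left y :: real \<Rightarrow>\<^sub>L 'a) differentiable (at x)"
      "(\<lambda>y::'a. blinfun_inner_left y) differentiable (at x)"
      using bounded_linear_differentiable[OF bounded_linear_blinfun_scaleR_left differentiable_ident]
        bounded_linear_differentiable[OF bounded_linear_blinfun_inner_left differentiable_ident] by auto
    have "u' differentiable (at x)"
      unfolding u'_def[abs_def]
      by (intro differentiable_diff differentiable_scaleR differentiable_const differentiable_power nd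
          bounded_bilinear_differentiable[OF bounded_bilinear_blinfun_compose] lin)
    then show "F' differentiable (at x)"
      unfolding F'_def[abs_def]
      by (intro differentiable_diff differentiable_scaleR nd gd lin
          bounded_bilinear_differentiable[OF bounded_bilinear_blinfun_compose])
  qed
qed

section \<open>The boundary near a tangency point\<close>

text \<open>The radii of points of \<open>K\<close> in a fixed direction form a closed bounded set
  containing 0, so the supremum is attained; convexity fills in all smaller radii.\<close>

lemma mem_iff_le_radial:
  fixes y :: "'a::euclidean_space"
  assumes K: "compact K" "convex K" "0 \<in> K" and y: "y \<noteq> 0"
  shows "y \<in> K \<longleftrightarrow> norm y \<le> radial K (sgn y)"
proof -
  define A where "A = {r. 0 \<le> r \<and> r *\<^sub>R sgn y \<in> K}"
  have yeq: "norm y *\<^sub>R sgn y = y" using y by (simp add: sgn_div_norm)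
  obtain M where M: "\<And>z. z \<in> K \<Longrightarrow> norm z \<le> M"
    using compact_imp_bounded[OF K(1)] by (auto simp: bounded_iff)
  have "bdd_above A"
  proof (rule bdd_aboveI[of _ M])
    fix r assume "r \<in> A"
    then show "r \<le> M" using M[of "r *\<^sub>R sgn y"] y by (simp add: A_def norm_sgn)
  qed
  moreover have "closed A"
  proof -
    have "closed ((\<lambda>r. r *\<^sub>R sgn y) -` K)"
      using K(1) by (intro closed_vimage compact_imp_closed) (auto intro: continuous_intros)
    moreover have "A = {0..} \<inter> (\<lambda>r. r *\<^sub>R sgn y) -` K" by (auto simp: A_def)
    ultimately show ?thesis by (simp add: closed_Int)
  qed
  moreover have "0 \<in> A" using K(3) by (simp add: A_def)
  ultimately have sup: "Sup A \<in> A" "\<And>r. r \<in> A \<Longrightarrow> r \<le> Sup A"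
    using closed_contains_Sup[of A] cSup_upper by auto
  have "norm y \<in> A" if le: "norm y \<le> Sup A"
  proof -
    have "0 < Sup A" using y le by (meson less_le_trans zero_less_norm_iff)
    have "(norm y / Sup A) *\<^sub>R (Sup A *\<^sub>R sgn y) + (1 - norm y / Sup A) *\<^sub>R 0 \<in> K"
      using sup(1) K le \<open>0 < Sup A\<close> by (intro convexD[OF K(2)]) (auto simp: A_def)
    then show ?thesis using \<open>0 < Sup A\<close> by (simp add: A_def)
  qed
  then have "norm y \<in> A \<longleftrightarrow> norm y \<le> Sup A" using sup(2) by blast
  moreover have "norm y \<in> A \<longleftrightarrow> y \<in> K" by (simp add: A_def yeq)
  ultimately show ?thesis by (simp add: radial_def A_def)
qed

lemma supporting_unit_normal:
  fixes K :: "'a::euclidean_space set"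
  assumes "convex K" "interior K \<noteq> {}" "closed K" "y \<in> frontier K"
  obtains m where "norm m = 1" "\<And>z. z \<in> K \<Longrightarrow> (z - y) \<bullet> m \<le> 0"
proof -
  have "y \<in> K" "y \<notin> rel_interior K"
    using assms by (auto simp: frontier_def rel_interior_nonempty_interior)
  from supporting_hyperplane_rel_boundary[OF assms(1) this] obtain a
    where a: "a \<noteq> 0" "\<And>z. z \<in> K \<Longrightarrow> a \<bullet> y \<le> a \<bullet> z" by metis
  show ?thesis
  proof (rule that[of "- sgn a"])
    fix z assume "z \<in> K"
    then have "0 \<le> inverse (norm a) * ((z - y) \<bullet> a)"
      using a(2)[of z] by (intro mult_nonneg_nonneg) (auto simp: inner_diff_left inner_diff_right inner_commute)
    then show "(z - y) \<bullet> - sgn a \<le> 0"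
      by (simp add: sgn_div_norm)
  qed (use a in \<open>simp add: norm_sgn\<close>)
qed

lemma supported_imp_frontier:
  fixes K :: "'a::euclidean_space set"
  assumes "x \<in> K" and n: "norm n = 1" "\<And>y. y \<in> K \<Longrightarrow> (y - x) \<bullet> n \<le> 0"
  shows "x \<in> frontier K"
proof -
  have "x \<notin> interior K"
  proof
    assume "x \<in> interior K"
    then obtain r where r: "0 < r" "cball x r \<subseteq> K" using mem_interior_cball by blast
    then have "x + r *\<^sub>R n \<in> K" using n(1) by (auto simp: subset_iff dist_norm)
    then show False using n(2)[of "x + r *\<^sub>R n"] r n(1) by (simp add: dot_square_norm)
  qed
  then show ?thesis using assms(1) closure_subset by (auto simp: frontier_def)
qed

text \<open>The interface between smoothness and geometry: near \<open>x\<close> the body enters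
  only through the first derivative \<open>F'\<close>, and at \<open>x\<close> through its
  derivative \<open>B\<close> and the curvature.\<close>

locale smooth_boundary_point =
  fixes K :: "(real ^ 'n) set" and x n :: "real ^ 'n"
    and F' :: "real ^ 'n \<Rightarrow> ((real ^ 'n) \<Rightarrow>\<^sub>L real)" and B :: "real ^ 'n \<Rightarrow> ((real ^ 'n) \<Rightarrow>\<^sub>L real)"
  assumes K: "compact K" "convex K" "0 \<in> interior K"
    and xK: "x \<in> K" and norm_n: "norm n = 1" and supp: "\<And>y. y \<in> K \<Longrightarrow> (y - x) \<bullet> n \<le> 0"
    and der: "eventually (\<lambda>y. ((\<lambda>y. norm y - radial K (sgn y)) has_derivative blinfun_apply (F' y)) (at y)) (nhds x)"
    and B: "(F' has_derivative B) (at x)"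
    and curv: "0 < gauss_curvature K x"
begin

definition F :: "real ^ 'n \<Rightarrow> real" where "F y = norm y - radial K (sgn y)"

text \<open>The gradient of \<open>F\<close>, that is \<open>F'\<close> as a vector; its direction
  will be the outer unit normal.\<close>

definition G :: "real ^ 'n \<Rightarrow> real ^ 'n" where "G y = (\<Sum>b\<in>Basis. F' y b *\<^sub>R b)"

lemma n_n: "n \<bullet> n = 1"
  using norm_n by (simp add: dot_square_norm)

lemma inner_Basis_expand: "(\<Sum>b\<in>Basis. (L b :: real) *\<^sub>R b) \<bullet> v = L v"
  if "bounded_linear L" for L and v :: "real ^ 'n"
proof -
  have "L v = L (\<Sum>b\<in>Basis. (v \<bullet> b) *\<^sub>R b)" by (simp add: euclidean_representation)
  also have "\<dots> = (\<Sum>b\<in>Basis. (v \<bullet> b) * L b)"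
    using that by (simp add: bounded_linear.linear linear_sum linear_scale)
  finally show ?thesis
    unfolding inner_sum_left inner_scaleR_left by (simp add: inner_commute mult.commute)
qed

lemma G_inner: "G y \<bullet> v = F' y v"
  unfolding G_def by (rule inner_Basis_expand) (rule blinfun.bounded_linear_right)

lemma x_n_pos: "0 < x \<bullet> n"
proof -
  obtain r where r: "0 < r" "cball 0 r \<subseteq> K" using K(3) mem_interior_cball by blast
  then have "r *\<^sub>R n \<in> K" using norm_n by (auto simp: subset_iff)
  then show ?thesis using supp[of "r *\<^sub>R n"] r n_n by (simp add: inner_diff_left)
qed

lemma neighbourhood:
  obtains \<delta> where "0 < \<delta>" "\<And>y. y \<in> ball x \<delta> \<Longrightarrow> y \<noteq> 0"
    "\<And>y. y \<in> ball x \<delta> \<Longrightarrow> (F has_derivative blinfun_apply (F' y)) (at y)"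
proof -
  obtain d where d: "0 < d" "\<And>y. dist y x < d \<Longrightarrow> (F has_derivative blinfun_apply (F' y)) (at y)"
    using der unfolding eventually_nhds_metric F_def[abs_def] by blast
  have "x \<noteq> 0" using x_n_pos by auto
  then show ?thesis
    using d by (intro that[of "min d (norm x)"]) (auto simp: dist_commute)
qed

lemma mem_iff: "y \<noteq> 0 \<Longrightarrow> y \<in> K \<longleftrightarrow> F y \<le> 0"
  using mem_iff_le_radial[OF K(1,2), of y] K(3) interior_subset by (auto simp: F_def)

context
  fixes \<delta>
  assumes \<delta>: "0 < \<delta>" "\<And>y. y \<in> ball x \<delta> \<Longrightarrow> y \<noteq> 0"
    "\<And>y. y \<in> ball x \<delta> \<Longrightarrow> (F has_derivative blinfun_apply (F' y)) (at y)"
begin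

lemma line_derivative:
  assumes "y \<in> ball x \<delta>"
  shows "((\<lambda>s. F (y + s *\<^sub>R w)) has_real_derivative F' y w) (at 0)"
proof -
  have a: "((\<lambda>s. y + s *\<^sub>R w) has_derivative (\<lambda>t. t *\<^sub>R w)) (at 0)"
    by (auto intro!: derivative_eq_intros)
  have b: "(F has_derivative blinfun_apply (F' y)) (at (y + 0 *\<^sub>R w))" using \<delta>(3)[OF assms] by simp
  from has_derivative_compose[OF a b]
  show ?thesis by (simp add: has_field_derivative_def blinfun.scaleR_right mult_commute_abs)
qed

text \<open>Along a ray the radial term is constant and \<open>F\<close> grows like the norm. In
  particular the gradient vanishes nowhere in the ball.\<close>

lemma F'_self:
  assumes y: "y \<in> ball x \<delta>"
  shows "F' y y = norm y"
proof -
  have "((\<lambda>s. (1 + s) * norm y - radial K (sgn y)) has_real_derivative norm y) (at 0)"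
    by (auto intro!: derivative_eq_intros)
  then have "((\<lambda>s. F (y + s *\<^sub>R y)) has_real_derivative norm y) (at 0)"
  proof (rule has_field_derivative_transform_within_open[where S = "{- 1<..}"])
    fix s :: real assume "s \<in> {- 1<..}"
    then have "y + s *\<^sub>R y = (1 + s) *\<^sub>R y" "0 < 1 + s" by (auto simp: scaleR_left_distrib)
    then show "(1 + s) * norm y - radial K (sgn y) = F (y + s *\<^sub>R y)"
      by (simp add: F_def sgn_scaleR)
  qed auto
  then show ?thesis using DERIV_unique[OF line_derivative[OF y]] by blast
qed

lemma G_nonzero: "y \<in> ball x \<delta> \<Longrightarrow> G y \<noteq> 0"
  using F'_self[of y] G_inner[of y y] \<delta>(2)[of y] by auto

lemma frontier_F: "y \<in> ball x \<delta> \<Longrightarrow> y \<in> frontier K \<Longrightarrow> F y = 0"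
proof (rule ccontr)
  assume y: "y \<in> ball x \<delta>" "y \<in> frontier K" and ne: "F y \<noteq> 0"
  have "y \<in> K" using y(2) K(1) by (meson compact_imp_closed frontier_subset_closed subsetD)
  then have "F y < 0" using mem_iff[OF \<delta>(2)[OF y(1)]] ne by simp
  have "isCont F y" using has_derivative_continuous[OF \<delta>(3)[OF y(1)]] .
  then have "eventually (\<lambda>z. F z < 0) (nhds y)"
    using \<open>F y < 0\<close> by (simp add: isCont_def order_tendstoD eventually_nhds_conv_at)
  moreover have "eventually (\<lambda>z. z \<in> ball x \<delta>) (nhds y)"
    using y(1) by (intro eventually_nhds_in_open) auto
  ultimately have "eventually (\<lambda>z. z \<in> K) (nhds y)"
    by eventually_elim (use mem_iff \<delta>(2) in force)
  then have "y \<in> interior K" by (auto simp: eventually_nhds interior_def subset_iff)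
  with y(2) show False by (simp add: frontier_def)
qed

text \<open>A direction \<open>w\<close> with \<open>G y \<bullet> w < 0\<close> leads into
  \<open>K\<close>, so every supporting normal satisfies \<open>w \<bullet> m \<le> 0\<close> for
  all such \<open>w\<close>. This leaves a single possibility for \<open>m\<close>.\<close>

lemma unit_normal:
  assumes y: "y \<in> ball x \<delta>" "F y = 0" and m: "norm m = 1" "\<And>z. z \<in> K \<Longrightarrow> (z - y) \<bullet> m \<le> 0"
  shows "m = sgn (G y)"
proof -
  have neg: "w \<bullet> m \<le> 0" if w: "G y \<bullet> w < 0" for w
  proof -
    have "F' y w < 0" using w by (simp add: G_inner)
    from DERIV_neg_dec_right[OF line_derivative[OF y(1)] this]
    obtain d where d: "0 < d" "\<And>h. 0 < h \<Longrightarrow> h < d \<Longrightarrow> F (y + h *\<^sub>R w) < F y" by auto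
    define e where "e = (\<delta> - dist x y) / (norm w + 1)"
    have e: "0 < e" using y(1) by (simp add: e_def add_nonneg_pos)
    define h where "h = min d e / 2"
    have h: "0 < h" "h < d" "h < e" using d e by (auto simp: h_def)
    have "h * norm w \<le> h * (norm w + 1)" using h by simp
    also have "\<dots> < e * (norm w + 1)" using h by (intro mult_strict_right_mono) (auto simp: add_nonneg_pos)
    also have "\<dots> = \<delta> - dist x y" by (simp add: e_def add_nonneg_eq_0_iff)
    finally have "dist x (y + h *\<^sub>R w) < \<delta>"
      using dist_triangle[of x "y + h *\<^sub>R w" y] h(1) by (simp add: dist_norm)
    then have "y + h *\<^sub>R w \<in> K" using mem_iff[OF \<delta>(2)] d(2)[OF h(1,2)] y(2) by simp
    then have "h * (w \<bullet> m) \<le> 0" using m(2)[of "y + h *\<^sub>R w"] by simp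
    then show ?thesis using h(1) by (simp add: mult_le_0_iff)
  qed
  let ?g = "G y"
  have g: "?g \<noteq> 0" by (rule G_nonzero[OF y(1)])
  \<comment> \<open>\<open>m\<close> is split into its component along the gradient and the rest
    \<open>p\<close>. Testing with \<open>p - t *\<^sub>R ?g\<close> and letting \<open>t\<close>
    tend to 0 forces \<open>p = 0\<close>.\<close>
  define c where "c = (m \<bullet> ?g) / (?g \<bullet> ?g)"
  define p where "p = m - c *\<^sub>R ?g"
  have pg: "?g \<bullet> p = 0" using g by (simp add: p_def c_def inner_diff_right inner_commute)
  have c0: "0 \<le> m \<bullet> ?g" using neg[of "- ?g"] g by (simp add: inner_commute)
  have "p \<bullet> p \<le> t * (m \<bullet> ?g)" if "0 < t" for t
  proof -
    have "(p - t *\<^sub>R ?g) \<bullet> m \<le> 0"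
      using that g by (intro neg) (simp add: inner_diff_right pg)
    moreover have "p \<bullet> m = p \<bullet> p" using pg by (simp add: p_def inner_diff_right inner_commute)
    ultimately show ?thesis by (simp add: inner_diff_left inner_diff_right inner_commute[of _ m])
  qed
  then have ev: "eventually (\<lambda>t. p \<bullet> p \<le> t * (m \<bullet> ?g)) (at_right 0)"
    by (auto simp: eventually_at_filter)
  have "((\<lambda>t. t * (m \<bullet> ?g)) \<longlongrightarrow> 0 * (m \<bullet> ?g)) (at_right 0)" by (intro tendsto_intros)
  from tendsto_lowerbound[OF this ev] have "p \<bullet> p \<le> 0" by simp
  then have "p = 0" by (metis inner_eq_zero_iff inner_ge_zero order_antisym)
  then have mc: "m = c *\<^sub>R ?g" by (simp add: p_def)
  then have "c \<noteq> 0" using m(1) by auto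
  moreover have "0 \<le> c" using c0 by (simp add: c_def)
  ultimately have "0 < c" by simp
  moreover have "m = sgn m" using m(1) by (simp add: sgn_div_norm)
  ultimately show ?thesis using mc by (metis sgn_scaleR sgn_pos scaleR_one)
qed

lemma x_frontier: "x \<in> frontier K"
  using xK norm_n supp by (rule supported_imp_frontier)

lemma F_x: "F x = 0"
  using frontier_F[OF _ x_frontier] \<delta>(1) by simp

lemma n_eq: "n = sgn (G x)"
  using unit_normal[of x n] F_x \<delta>(1) norm_n supp by simp

text \<open>At boundary points near \<open>x\<close> the definite description has exactly one
  solution; on the frontier the Gauss map thus coincides with a function that is differentiable at
  \<open>x\<close>.\<close>

lemma gauss_map_eq:
  assumes "y \<in> ball x \<delta>" "y \<in> frontier K"
  shows "gauss_map K y = sgn (G y)"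
  unfolding gauss_map_def
proof (rule the_equality)
  have Fy: "F y = 0" using frontier_F[OF assms] .
  obtain m where m: "norm m = 1" "\<And>z. z \<in> K \<Longrightarrow> (z - y) \<bullet> m \<le> 0"
    using supporting_unit_normal[of K y] K assms(2) compact_imp_closed by blast
  then show "norm (sgn (G y)) = 1 \<and> (\<forall>z\<in>K. (z - y) \<bullet> sgn (G y) \<le> 0)"
    using unit_normal[OF assms(1) Fy m] by auto
  show "m = sgn (G y)" if "norm m = 1 \<and> (\<forall>z\<in>K. (z - y) \<bullet> m \<le> 0)" for m
    using unit_normal[OF assms(1) Fy] that by blast
qed

lemma G_x: "G x = norm (G x) *\<^sub>R n"
  unfolding n_eq using G_nonzero[of x] \<delta>(1) by (simp add: sgn_div_norm)

lemma F'_x: "F' x v = norm (G x) * (v \<bullet> n)"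
  using G_inner[of x v] by (subst (asm) G_x) (simp add: inner_commute)

lemma norm_G_x_pos: "0 < norm (G x)"
  using G_nonzero[of x] \<delta>(1) by simp

lemma linear_B: "linear B"
  using B has_derivative_bounded_linear bounded_linear.linear by blast

lemma B_sym: "B v w = B w v"
  by (rule second_derivative_symmetric[OF der B])

lemma B_bilinear:
  "B (v + w) z = B v z + B w z" "B z (v + w) = B z v + B z w"
  "B (v - w) z = B v z - B w z" "B z (v - w) = B z v - B z w"
  "B (t *\<^sub>R v) z = t * B v z" "B z (t *\<^sub>R v) = t * B z v"
  using linear_B by (simp_all add: linear_add linear_diff linear_scale blinfun.bilinear_simps)

text \<open>If \<open>B v v < 0\<close>, bend the tangent line outwards: at
  \<open>x + s v + s^2 \<beta> n\<close> the function \<open>F\<close> is still negative for small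
  \<open>s\<close>, so the point is in \<open>K\<close> although it lies beyond the supporting
  hyperplane.\<close>

lemma B_nonneg:
  assumes v: "v \<bullet> n = 0"
  shows "0 \<le> B v v"
proof (rule ccontr)
  assume "\<not> 0 \<le> B v v"
  then have neg: "B v v < 0" by simp
  define e where "e = - B v v / (8 * ((norm v)\<^sup>2 + 1))"
  have e: "0 < e" unfolding e_def using neg by (intro divide_pos_pos) (auto simp: add_nonneg_pos)
  have ev: "e * (norm v)\<^sup>2 \<le> - B v v / 8"
  proof -
    have "e * (norm v)\<^sup>2 \<le> e * ((norm v)\<^sup>2 + 1)" using e by simp
    also have "\<dots> = - B v v / 8"
      by (simp add: e_def divide_simps add_nonneg_eq_0_iff)
    finally show ?thesis .
  qed
  obtain d where d: "0 < d" "\<And>h. norm h < d \<Longrightarrow> \<bar>F (x + h) - F x - F' x h - B h h / 2\<bar> \<le> e * (norm h)\<^sup>2"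
    using taylor_second_order[OF der B e] unfolding F_def[abs_def] by blast
  \<comment> \<open>The bend costs \<open>- B v v / 4\<close> against the gain
    \<open>B v v / 2\<close>, and \<open>e\<close> was chosen so that the Taylor error takes at most
    \<open>- B v v / 8\<close>; a negative amount remains.\<close>
  define \<beta> where "\<beta> = - B v v / (4 * norm (G x))"
  have \<beta>: "0 < \<beta>" "norm (G x) * \<beta> = - B v v / 4"
    unfolding \<beta>_def using neg norm_G_x_pos by (intro divide_pos_pos, simp_all)
  define w where "w s = v + (s * \<beta>) *\<^sub>R n" for s
  define \<phi> where "\<phi> s = norm (G x) * \<beta> + (B v v + s * (2 * \<beta> * B v n) + s\<^sup>2 * (\<beta>\<^sup>2 * B n n)) / 2 + e * (norm (w s))\<^sup>2" for s
  have "(\<phi> \<longlongrightarrow> norm (G x) * \<beta> + (B v v + 0 * (2 * \<beta> * B v n) + 0\<^sup>2 * (\<beta>\<^sup>2 * B n n)) / 2 + e * (norm (v + (0 * \<beta>) *\<^sub>R n))\<^sup>2) (at_right 0)"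
    unfolding \<phi>_def w_def by (intro tendsto_intros) simp_all
  moreover have "norm (G x) * \<beta> + (B v v + 0 * (2 * \<beta> * B v n) + 0\<^sup>2 * (\<beta>\<^sup>2 * B n n)) / 2 + e * (norm (v + (0 * \<beta>) *\<^sub>R n))\<^sup>2 < 0"
    using ev neg \<beta>(2) by simp
  ultimately have "eventually (\<lambda>s. \<phi> s < 0) (at_right 0)" by (rule order_tendstoD)
  moreover have "((\<lambda>s. norm (s *\<^sub>R w s)) \<longlongrightarrow> norm (0 *\<^sub>R (v + (0 * \<beta>) *\<^sub>R n))) (at_right 0)"
    unfolding w_def by (intro tendsto_intros)
  then have "eventually (\<lambda>s. norm (s *\<^sub>R w s) < min d \<delta>) (at_right 0)"
    by (rule order_tendstoD) (use d \<delta>(1) in simp)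
  ultimately have "eventually (\<lambda>s. False) (at_right (0::real))"
    using eventually_at_right_less[of "0::real"]
  proof eventually_elim
    case (elim s)
    let ?h = "s *\<^sub>R w s"
    have hn: "?h \<bullet> n = s\<^sup>2 * \<beta>" using v n_n by (simp add: w_def inner_add_left power2_eq_square)
    have "B (w s) (w s) = B v v + s * (2 * \<beta> * B v n) + s\<^sup>2 * (\<beta>\<^sup>2 * B n n)"
      unfolding w_def by (simp only: B_bilinear B_sym[of n v]) (simp add: power2_eq_square algebra_simps)
    then have \<phi>: "\<phi> s = norm (G x) * \<beta> + B (w s) (w s) / 2 + e * (norm (w s))\<^sup>2" by (simp add: \<phi>_def)
    have parts: "F' x ?h = s\<^sup>2 * (norm (G x) * \<beta>)" "B ?h ?h = s\<^sup>2 * B (w s) (w s)"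
      "(norm ?h)\<^sup>2 = s\<^sup>2 * (norm (w s))\<^sup>2"
      unfolding F'_x hn by (simp_all add: B_bilinear power_mult_distrib power2_eq_square)
    have "norm ?h < d" using elim(2) by simp
    then have "F (x + ?h) \<le> F' x ?h + B ?h ?h / 2 + e * (norm ?h)\<^sup>2"
      using d(2)[of ?h] F_x by linarith
    also have "\<dots> = s\<^sup>2 * \<phi> s" unfolding parts \<phi> by (simp add: algebra_simps)
    also have "\<dots> < 0" using elim by (simp add: mult_pos_neg)
    finally have "x + ?h \<in> K" using mem_iff[of "x + ?h"] \<delta>(2)[of "x + ?h"] elim(2) by (simp add: dist_norm)
    then have "?h \<bullet> n \<le> 0" using supp[of "x + ?h"] by simp
    then show False using hn elim(3) \<beta>(1) by (simp add: mult_le_0_iff power2_eq_square)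
  qed
  then show False by simp
qed

text \<open>Cauchy-Schwarz for a semidefinite form: otherwise adding a suitable multiple of
  \<open>w\<close> to \<open>v\<close> would make the form negative. The 1 in the denominator of
  \<open>s\<close> covers \<open>B w w = 0\<close>.\<close>

lemma B_zero:
  assumes v: "v \<bullet> n = 0" "B v v = 0" and w: "w \<bullet> n = 0"
  shows "B v w = 0"
proof (rule ccontr)
  assume ne: "B v w \<noteq> 0"
  have c: "0 \<le> B w w" by (rule B_nonneg[OF w])
  define s where "s = - B v w / (B w w + 1)"
  have "0 \<le> B (v + s *\<^sub>R w) (v + s *\<^sub>R w)" using v w by (intro B_nonneg) (simp add: inner_add_left)
  also have "\<dots> = 2 * s * B v w + s\<^sup>2 * B w w"
    by (simp only: B_bilinear v B_sym[of w v]) (simp add: power2_eq_square distrib_left)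
  also have "B v w = - (s * (B w w + 1))" using c by (simp add: s_def)
  also have "2 * s * - (s * (B w w + 1)) + s\<^sup>2 * B w w = - (s\<^sup>2 * (B w w + 2))"
    by (simp add: power2_eq_square algebra_simps)
  finally have "s\<^sup>2 * (B w w + 2) \<le> 0" by simp
  moreover have "0 < s\<^sup>2 * (B w w + 2)" using ne c by (intro mult_pos_pos) (auto simp: s_def)
  ultimately show False by simp
qed

text \<open>On the ray through \<open>y\<close> the function \<open>F\<close> increases strictly, so
  the points just beyond \<open>y\<close> are outside \<open>K\<close>.\<close>

lemma F_zero_frontier:
  assumes "y \<in> ball x \<delta>" "F y = 0"
  shows "y \<in> frontier K"
proof -
  have "y \<in> K" using mem_iff[OF \<delta>(2)[OF assms(1)]] assms(2) by simp
  moreover have "y \<notin> interior K"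
  proof
    assume "y \<in> interior K"
    then obtain r where r: "0 < r" "cball y r \<subseteq> K" using mem_interior_cball by blast
    have y0: "y \<noteq> 0" using \<delta>(2) assms(1) by blast
    define t where "t = r / norm y"
    have t: "0 < t" using r y0 by (simp add: t_def)
    have "(1 + t) *\<^sub>R y \<in> cball y r" using r y0 by (simp add: dist_norm t_def algebra_simps)
    then have "(1 + t) *\<^sub>R y \<in> K" using r by blast
    then have "F ((1 + t) *\<^sub>R y) \<le> 0" using mem_iff[of "(1 + t) *\<^sub>R y"] t y0 by simp
    moreover have "F ((1 + t) *\<^sub>R y) = (1 + t) * norm y - radial K (sgn y)"
      using t by (simp add: F_def sgn_scaleR)
    then have "F ((1 + t) *\<^sub>R y) = F y + t * norm y" by (simp add: F_def distrib_right)
    ultimately show False using assms(2) t y0 by (simp add: mult_le_0_iff)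
  qed
  ultimately show ?thesis using closure_subset by (auto simp: frontier_def)
qed

text \<open>\<open>p\<close> is the boundary point on the ray of \<open>y\<close>. Applied along a
  straight line through \<open>x\<close>, this produces curves in the frontier.\<close>

lemma radial_projection:
  assumes "y \<noteq> 0"
  defines "p \<equiv> y - F y *\<^sub>R sgn y"
  shows "F p = 0"
proof -
  obtain r where r: "0 < r" "cball 0 r \<subseteq> K" using K(3) mem_interior_cball by blast
  have sgn_pos: "sgn (c *\<^sub>R sgn y) = sgn y" if "0 < c" for c
    using that assms(1) by (simp add: sgn_scaleR sgn_div_norm[of "sgn y"] norm_sgn)
  have "r *\<^sub>R sgn y \<in> K" using r assms by (auto simp: subset_iff norm_sgn)
  then have "F (r *\<^sub>R sgn y) \<le> 0" using mem_iff[of "r *\<^sub>R sgn y"] r assms by (simp add: sgn_zero_iff)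
  then have \<rho>: "0 < radial K (sgn y)" using r sgn_pos[OF r(1)] assms by (simp add: F_def norm_sgn)
  have "p = radial K (sgn y) *\<^sub>R sgn y"
    using assms(1) by (simp add: p_def F_def scaleR_diff_left) (simp add: sgn_div_norm)
  then show ?thesis using \<rho> sgn_pos[OF \<rho>] assms(1) by (simp add: F_def norm_sgn)
qed

text \<open>A null vector of the second fundamental form would be a null vector of the differential of the
  Gauss map.\<close>

lemma B_pos:
  assumes v: "v \<bullet> n = 0" "v \<noteq> 0"
  shows "0 < B v v"
proof (rule ccontr)
  assume "\<not> 0 < B v v"
  then have Bv: "B v v = 0" using B_nonneg[OF v(1)] by simp
  have x0: "x \<noteq> 0" using \<delta>(1,2) by simp
  define DG where "DG h = (\<Sum>b\<in>Basis. B h b *\<^sub>R b)" for h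
  have DG: "(G has_derivative DG) (at x)"
    unfolding G_def[abs_def] DG_def[abs_def]
    by (intro has_derivative_sum has_derivative_scaleR_left bounded_linear.has_derivative[OF blinfun.bounded_linear_left] B)
  \<comment> \<open>By \<open>B_zero\<close> the functional \<open>B v\<close> vanishes on the
    tangent space, so \<open>DG v\<close> is a multiple of \<open>n\<close>; the derivative of
    \<open>sgn\<close> at \<open>G x\<close>, which is a multiple of \<open>n\<close> too,
    annihilates it.\<close>
  have DGv: "DG v = B v n *\<^sub>R n"
  proof -
    have "DG v \<bullet> w = (B v n *\<^sub>R n) \<bullet> w" for w
    proof -
      have "B v (w - (w \<bullet> n) *\<^sub>R n) = 0"
        by (rule B_zero[OF v(1) Bv]) (simp add: inner_diff_left n_n)
      then have "B v w = (w \<bullet> n) * B v n" by (simp add: B_bilinear)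
      moreover have "DG v \<bullet> w = B v w"
        unfolding DG_def by (rule inner_Basis_expand) (rule blinfun.bounded_linear_right)
      ultimately show ?thesis by (simp add: inner_commute)
    qed
    then show ?thesis using vector_eq_rdot by blast
  qed
  define DN where "DN h = (1 / norm (G x)) *\<^sub>R DG h - ((1 / norm (G x)) ^ 3 * (DG h \<bullet> G x)) *\<^sub>R G x" for h
  have Gx0: "G x \<noteq> 0" using norm_G_x_pos by simp
  have DN: "((\<lambda>y. sgn (G y)) has_derivative DN) (at x)"
    using has_derivative_compose[OF DG has_derivative_sgn[OF Gx0]] by (simp add: DN_def[abs_def])
  have DNv: "DN v = 0"
  proof -
    define g where "g = norm (G x)"
    have g: "0 < g" "G x = g *\<^sub>R n" using norm_G_x_pos G_x by (simp_all add: g_def)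
    show ?thesis unfolding DN_def DGv g_def[symmetric] using n_n g(1)
      by (simp add: g(2) power3_eq_cube)
  qed
  define W where "W = frechet_derivative (gauss_map K) (at x within frontier K)"
  have "(gauss_map K has_derivative DN) (at x within frontier K)"
  proof (rule has_derivative_transform_within[OF has_derivative_at_withinI[OF DN] \<delta>(1) x_frontier])
    fix y assume "y \<in> frontier K" "dist y x < \<delta>"
    then show "sgn (G y) = gauss_map K y" using gauss_map_eq[of y] by (simp add: dist_commute)
  qed
  from frechet_derivative_works[THEN iffD1, OF differentiableI[OF this]]
  have W: "(gauss_map K has_derivative W) (at x within frontier K)"
    unfolding W_def .
  \<comment> \<open>\<open>W\<close> is a derivative within the frontier, so \<open>W v\<close> is
    accessible only along curves that stay there. Correcting the line \<open>x + s v\<close>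
    radially gives such a curve; its velocity is \<open>v\<close> because \<open>F\<close> has
    derivative 0 in tangential directions.\<close>
  define c where "c s = (x + s *\<^sub>R v) - F (x + s *\<^sub>R v) *\<^sub>R sgn (x + s *\<^sub>R v)" for s
  have c0: "c 0 = x" by (simp add: c_def F_x)
  have dc: "(c has_derivative (\<lambda>s. s *\<^sub>R v)) (at 0)"
  proof -
    have l: "((\<lambda>s. x + s *\<^sub>R v) has_derivative (\<lambda>s. s *\<^sub>R v)) (at 0)"
      by (auto intro!: derivative_eq_intros)
    have "((\<lambda>s. F (x + s *\<^sub>R v)) has_real_derivative 0) (at 0)"
      using line_derivative[of x v] \<delta>(1) v(1) by (simp add: F'_x)
    then have f: "((\<lambda>s. F (x + s *\<^sub>R v)) has_derivative (\<lambda>s. 0)) (at 0)"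
      by (simp add: has_field_derivative_def lambda_zero)
    have "(sgn has_derivative (\<lambda>h. (1 / norm x) *\<^sub>R h - ((1 / norm x) ^ 3 * (h \<bullet> x)) *\<^sub>R x)) (at (x + 0 *\<^sub>R v))"
      using has_derivative_sgn[OF x0] by simp
    note u = has_derivative_compose[OF l this]
    show ?thesis
      unfolding c_def[abs_def] using has_derivative_diff[OF l has_derivative_scaleR[OF f u]]
      by (simp add: F_x)
  qed
  have "isCont c 0" using has_derivative_continuous[OF dc] .
  from topological_tendstoD[OF isContD[OF this] open_ball[of x \<delta>]]
  have "eventually (\<lambda>s. c s \<in> ball x \<delta>) (at 0)" using c0 \<delta>(1) by simp
  then have "eventually (\<lambda>s. c s \<in> ball x \<delta>) (nhds 0)"
    by (simp add: eventually_nhds_conv_at c0 \<delta>(1))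
  moreover have "((\<lambda>s. x + s *\<^sub>R v) \<longlongrightarrow> x + 0 *\<^sub>R v) (at 0)" by (intro tendsto_intros)
  then have "eventually (\<lambda>s. x + s *\<^sub>R v \<noteq> 0) (at 0)"
    using x0 by (intro tendsto_imp_eventually_ne) auto
  then have "eventually (\<lambda>s. x + s *\<^sub>R v \<noteq> 0) (nhds 0)"
    by (simp add: eventually_nhds_conv_at x0)
  ultimately have "eventually (\<lambda>s. c s \<in> ball x \<delta> \<and> x + s *\<^sub>R v \<noteq> 0) (nhds 0)"
    by (rule eventually_conj)
  then obtain e where e: "0 < e" "\<And>s. s \<in> ball 0 e \<Longrightarrow> c s \<in> ball x \<delta>" "\<And>s. s \<in> ball 0 e \<Longrightarrow> x + s *\<^sub>R v \<noteq> 0"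
    unfolding eventually_nhds_metric by (auto simp: dist_commute)
  have cf: "c s \<in> frontier K" if "s \<in> ball 0 e" for s
    using radial_projection[OF e(3)[OF that]] by (intro F_zero_frontier e(2)[OF that]) (simp add: c_def)
  have "((\<lambda>s. gauss_map K (c s)) has_derivative (\<lambda>s. W (s *\<^sub>R v))) (at 0 within ball 0 e)"
  proof (rule has_derivative_in_compose[OF has_derivative_at_withinI[OF dc]])
    have "c ` ball 0 e \<subseteq> frontier K" using cf by blast
    then show "(gauss_map K has_derivative W) (at (c 0) within c ` ball 0 e)"
      unfolding c0 by (rule has_derivative_subset[OF W])
  qed
  moreover have ball0: "at (0::real) within ball 0 e = at 0"
    by (rule at_within_open) (use e(1) in simp_all)
  ultimately have d1: "((\<lambda>s. gauss_map K (c s)) has_derivative (\<lambda>s. W (s *\<^sub>R v))) (at 0)"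
    by simp
  have "((\<lambda>s. sgn (G (c s))) has_derivative (\<lambda>s. DN (s *\<^sub>R v))) (at 0)"
    by (rule has_derivative_compose[OF dc]) (simp add: c0 DN)
  then have d2: "((\<lambda>s. gauss_map K (c s)) has_derivative (\<lambda>s. DN (s *\<^sub>R v))) (at 0)"
  proof (rule has_derivative_transform_within_open)
    show "sgn (G (c s)) = gauss_map K (c s)" if "s \<in> ball 0 e" for s
      using gauss_map_eq[OF e(2)[OF that] cf[OF that]] by simp
  qed (use e(1) in simp_all)
  have "W v = 0"
    using fun_cong[OF has_derivative_unique[OF d1 d2], of 1] DNv by simp
  \<comment> \<open>The endomorphism whose determinant is the Gauss curvature; \<open>v\<close> lies
    in its kernel.\<close>
  define A where "A u = W (u - (u \<bullet> n) *\<^sub>R n) + (u \<bullet> n) *\<^sub>R n" for u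
  have linW: "linear W" using W has_derivative_bounded_linear bounded_linear.linear by blast
  have linA: "linear A"
    by (rule linearI) (simp_all add: A_def linW linear_add linear_diff linear_scale inner_add_left algebra_simps)
  have "A v = A 0" using v \<open>W v = 0\<close> linW by (simp add: A_def linear_0)
  then have "\<not> inj A" using v(2) by (auto simp: inj_def)
  then have "det (matrix A) = 0" using det_nz_iff_inj[OF linA] by blast
  moreover have "gauss_map K x = n" using gauss_map_eq[OF _ x_frontier] \<delta>(1) n_eq by simp
  ultimately have "gauss_curvature K x = 0"
    by (simp add: gauss_curvature_def Let_def W_def A_def[abs_def])
  with curv show False by simp
qed

definition proj :: "real ^ 'n \<Rightarrow> real ^ 'n" where "proj v = v - (v \<bullet> n) *\<^sub>R n"

lemma proj_n: "proj v \<bullet> n = 0"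
  by (simp add: proj_def inner_diff_left n_n)

lemma linear_proj: "linear proj"
  by (rule linearI) (simp_all add: proj_def inner_add_left algebra_simps)

text \<open>Convexity of the form comes from the identity
  \<open>s * t * B (a - b) (a - b) = s * B a a + t * B b b - B c c\<close> for
  \<open>c = s a + t b\<close> and \<open>s + t = 1\<close>. The factor 1/2 is the one in Taylor's
  formula.\<close>

lemma cap_model: "cap_model n (norm (G x)) (\<lambda>v. B (proj v) (proj v) / 2)"
proof
  show "norm n = 1" by (rule norm_n)
  show "0 < norm (G x)" by (rule norm_G_x_pos)
  have "continuous_on UNIV proj" using linear_proj by (intro linear_continuous_on) (simp add: linear_linear)
  moreover have "continuous_on UNIV (\<lambda>v. B (proj v))"
    using linear_continuous_on[OF has_derivative_bounded_linear[OF B]] calculation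
    by (intro continuous_on_compose2[of UNIV B UNIV proj]) auto
  ultimately show "continuous_on UNIV (\<lambda>v. B (proj v) (proj v) / 2)"
    by (intro continuous_on_divide bounded_bilinear.continuous_on[OF bounded_bilinear_blinfun_apply]) auto
  show "convex_on UNIV (\<lambda>v. B (proj v) (proj v) / 2)"
    unfolding convex_on_def
  proof (intro conjI ballI allI impI)
    fix y z and s t :: real assume st: "0 \<le> s" "0 \<le> t" "s + t = 1"
    define a b where "a = proj y" and "b = proj z"
    have s: "s = 1 - t" using st by simp
    have "0 \<le> s * t * B (a - b) (a - b)"
      using st by (intro mult_nonneg_nonneg B_nonneg) (simp_all add: a_def b_def proj_n inner_diff_left)
    also have "\<dots> = s * B a a + t * B b b - B (s *\<^sub>R a + t *\<^sub>R b) (s *\<^sub>R a + t *\<^sub>R b)"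
      by (simp only: B_bilinear B_sym[of b a]) (simp add: s algebra_simps)
    finally show "B (proj (s *\<^sub>R y + t *\<^sub>R z)) (proj (s *\<^sub>R y + t *\<^sub>R z)) / 2
        \<le> s * (B (proj y) (proj y) / 2) + t * (B (proj z) (proj z) / 2)"
      by (simp add: linear_proj linear_add linear_scale a_def b_def)
  qed simp
  show "B (proj (t *\<^sub>R v)) (proj (t *\<^sub>R v)) / 2 = t\<^sup>2 * (B (proj v) (proj v) / 2)" for t v
    by (simp add: linear_proj linear_scale B_bilinear power2_eq_square)
  show "B (proj (v + s *\<^sub>R n)) (proj (v + s *\<^sub>R n)) / 2 = B (proj v) (proj v) / 2" for s v
    by (simp add: proj_def inner_add_left n_n scaleR_left_distrib)
  show "0 < B (proj v) (proj v) / 2" if "v \<bullet> n = 0" "v \<noteq> 0" for v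
    using B_pos[OF that] that by (simp add: proj_def)
qed

text \<open>Let \<open>s\<close> be the normal and \<open>p\<close> the tangential component of
  \<open>v\<close>. Beyond \<open>q\<close>, Taylor's formula leaves an error
  \<open>e * (norm v)\<^sup>2\<close> and the mixed terms of \<open>B v v\<close>. Everything that
  carries a factor \<open>s\<close> is absorbed by \<open>norm (G x) * s\<close>, and
  \<open>e * (norm p)\<^sup>2\<close> by the positive definite form; so the error is relative to
  \<open>q\<close> although \<open>q\<close> is linear along \<open>n\<close> and quadratic
  tangentially.\<close>

lemma F_approx:
  assumes "0 < \<eta>"
  obtains d where "0 < d" "\<And>v. 0 \<le> v \<bullet> n \<Longrightarrow> norm v < d \<Longrightarrow>
     \<bar>F (x + v) - cap_model.q n (norm (G x)) (\<lambda>v. B (proj v) (proj v) / 2) v\<bar>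
       \<le> \<eta> * cap_model.q n (norm (G x)) (\<lambda>v. B (proj v) (proj v) / 2) v"
proof -
  interpret M: cap_model n "norm (G x)" "\<lambda>v. B (proj v) (proj v) / 2" by (rule cap_model)
  obtain m where m: "0 < m" "\<And>v. 0 \<le> v \<bullet> n \<Longrightarrow> 1 \<le> norm v \<Longrightarrow> m \<le> M.q v"
    using M.q_lower_bound[of 1] by auto
  \<comment> \<open>Rescaling to norm 1 turns the bound \<open>m\<close> into a quadratic lower
    bound on the tangent space; with \<open>e = \<eta> * m\<close> it pays for the tangential
    error.\<close>
  have lower: "m * (norm v)\<^sup>2 \<le> B v v / 2" if v: "v \<bullet> n = 0" for v
  proof (cases "v = 0")
    case False
    have "m \<le> M.q ((1 / norm v) *\<^sub>R v)" using v False by (intro m(2)) auto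
    also have "\<dots> = B v v / 2 / (norm v)\<^sup>2"
    proof -
      have "proj v = v" using v by (simp add: proj_def)
      then show ?thesis
        unfolding M.q_def linear_scale[OF linear_proj] using v by (simp add: B_bilinear power2_eq_square)
    qed
    finally show ?thesis using False by (simp add: pos_le_divide_eq)
  qed (simp add: linear_B linear_0)
  define e where "e = \<eta> * m"
  have e: "0 < e" using assms m by (simp add: e_def)
  obtain d where d: "0 < d" "\<And>h. norm h < d \<Longrightarrow> \<bar>F (x + h) - F x - F' x h - B h h / 2\<bar> \<le> e * (norm h)\<^sup>2"
    using taylor_second_order[OF der B e] unfolding F_def[abs_def] by blast
  define L where "L = norm (B n)"
  have L: "0 \<le> L" by (simp add: L_def)
  have Ln: "\<bar>B n h\<bar> \<le> L * norm h" for h using norm_blinfun[of "B n" h] by (simp add: L_def)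
  \<comment> \<open>Makes the factor \<open>e * s + 2 * L * norm v\<close> that multiplies
    \<open>s\<close> in the error at most \<open>\<eta> * norm (G x)\<close>.\<close>
  define d' where "d' = min d (\<eta> * norm (G x) / (e + 2 * L + 1))"
  have d': "0 < d'" "d' \<le> d" "(e + 2 * L) * d' \<le> \<eta> * norm (G x)"
  proof -
    show "0 < d'" using d e L assms norm_G_x_pos by (simp add: d'_def)
    show "d' \<le> d" by (simp add: d'_def)
    have "(e + 2 * L) * d' \<le> (e + 2 * L + 1) * d'" using \<open>0 < d'\<close> by (intro mult_right_mono) auto
    also have "\<dots> \<le> (e + 2 * L + 1) * (\<eta> * norm (G x) / (e + 2 * L + 1))"
      using e L by (intro mult_left_mono) (auto simp: d'_def)
    also have "\<dots> = \<eta> * norm (G x)" using e L by simp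
    finally show "(e + 2 * L) * d' \<le> \<eta> * norm (G x)" .
  qed
  show ?thesis
  proof (rule that[OF d'(1)])
    fix v assume v: "0 \<le> v \<bullet> n" "norm v < d'"
    define s where "s = v \<bullet> n"
    define p where "p = proj v"
    have vp: "v = p + s *\<^sub>R n" by (simp add: p_def s_def proj_def)
    have pn: "p \<bullet> n = 0" by (simp add: p_def proj_n)
    have nv: "(norm v)\<^sup>2 = (norm p)\<^sup>2 + s\<^sup>2"
      unfolding power2_norm_eq_inner vp by (simp add: inner_add_left inner_add_right pn n_n inner_commute[of n p] power2_eq_square)
    have "\<bar>s\<bar> \<le> norm v" using Cauchy_Schwarz_ineq2[of v n] by (simp add: s_def norm_n)
    then have s: "0 \<le> s" "s \<le> norm v" using v by (simp_all add: s_def)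
    have "(norm p)\<^sup>2 \<le> (norm v)\<^sup>2" using nv by simp
    then have p: "norm p \<le> norm v" by (rule power2_le_imp_le) simp
    have Bv: "B v v = B p p + 2 * s * B n p + s * s * B n n"
      unfolding vp by (simp only: B_bilinear B_sym[of p n]) (simp add: algebra_simps)
    have cross: "\<bar>2 * s * B n p + s * s * B n n\<bar> / 2 \<le> s * (2 * L * norm v)"
    proof -
      have "\<bar>2 * s * B n p + s * s * B n n\<bar> \<le> 2 * s * \<bar>B n p\<bar> + s * s * \<bar>B n n\<bar>"
        using s(1) by (intro order_trans[OF abs_triangle_ineq]) (simp add: abs_mult)
      also have "\<dots> \<le> 2 * s * (L * norm v) + s * norm v * L"
      proof (intro add_mono mult_mono)
        show "\<bar>B n p\<bar> \<le> L * norm v" using Ln[of p] mult_left_mono[OF p L] by linarith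
        show "\<bar>B n n\<bar> \<le> L" using Ln[of n] by (simp add: norm_n)
      qed (use s L in auto)
      also have "\<dots> \<le> 2 * (s * (2 * L * norm v))"
        using s L mult_nonneg_nonneg[of "s * norm v" L] by (simp add: algebra_simps)
      finally show ?thesis by simp
    qed
    have qv: "M.q v = norm (G x) * s + B p p / 2" by (simp add: M.q_def s_def p_def)
    have "\<bar>F (x + v) - M.q v\<bar> \<le> \<bar>F (x + v) - F x - F' x v - B v v / 2\<bar> + \<bar>2 * s * B n p + s * s * B n n\<bar> / 2"
    proof -
      have "F (x + v) - M.q v = (F (x + v) - F x - F' x v - B v v / 2) + (2 * s * B n p + s * s * B n n) / 2"
        unfolding qv Bv F'_x F_x by (simp add: s_def add_divide_distrib)
      then show ?thesis using abs_triangle_ineq[of "F (x + v) - F x - F' x v - B v v / 2" "(2 * s * B n p + s * s * B n n) / 2"]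
        by simp
    qed
    also have "\<dots> \<le> e * (norm v)\<^sup>2 + s * (2 * L * norm v)"
      using d(2)[of v] v(2) d'(2) cross by (intro add_mono) auto
    also have "\<dots> = e * (norm p)\<^sup>2 + s * (e * s + 2 * L * norm v)"
      unfolding nv by (simp add: power2_eq_square algebra_simps)
    also have "\<dots> \<le> e * (norm p)\<^sup>2 + s * ((e + 2 * L) * d')"
    proof (intro add_left_mono mult_left_mono)
      have "e * s \<le> e * d'" "2 * L * norm v \<le> 2 * L * d'"
        using s v e L by (auto intro!: mult_left_mono)
      then show "e * s + 2 * L * norm v \<le> (e + 2 * L) * d'" by (simp add: distrib_right)
    qed (rule s)
    also have "\<dots> \<le> e * (norm p)\<^sup>2 + s * (\<eta> * norm (G x))"
      using d'(3) s by (intro add_left_mono mult_left_mono) auto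
    also have "\<dots> = \<eta> * (m * (norm p)\<^sup>2 + norm (G x) * s)" by (simp add: e_def algebra_simps)
    also have "\<dots> \<le> \<eta> * M.q v"
      using lower[OF pn] assms unfolding qv by (intro mult_left_mono) auto
    finally show "\<bar>F (x + v) - M.q v\<bar> \<le> \<eta> * M.q v" .
  qed
qed

end

theorem local_cap_model:
  obtains \<gamma> \<beta> where "cap_model n \<gamma> \<beta>"
    "\<forall>\<eta>>0. \<exists>d>0. \<forall>v. 0 \<le> v \<bullet> n \<longrightarrow> norm v < d \<longrightarrow>
      \<bar>F (x + v) - cap_model.q n \<gamma> \<beta> v\<bar> \<le> \<eta> * cap_model.q n \<gamma> \<beta> v"
proof -
  obtain \<delta> where \<delta>: "0 < \<delta>" "\<And>y. y \<in> ball x \<delta> \<Longrightarrow> y \<noteq> 0"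
    "\<And>y. y \<in> ball x \<delta> \<Longrightarrow> (F has_derivative blinfun_apply (F' y)) (at y)"
    using neighbourhood by blast
  have "\<forall>\<eta>>0. \<exists>d>0. \<forall>v. 0 \<le> v \<bullet> n \<longrightarrow> norm v < d \<longrightarrow>
      \<bar>F (x + v) - cap_model.q n (norm (G x)) (\<lambda>v. B (proj v) (proj v) / 2) v\<bar>
        \<le> \<eta> * cap_model.q n (norm (G x)) (\<lambda>v. B (proj v) (proj v) / 2) v"
  proof (intro allI impI)
    fix \<eta> :: real assume "0 < \<eta>"
    from F_approx[OF \<delta> this] show "\<exists>d>0. \<forall>v. 0 \<le> v \<bullet> n \<longrightarrow> norm v < d \<longrightarrow>
      \<bar>F (x + v) - cap_model.q n (norm (G x)) (\<lambda>v. B (proj v) (proj v) / 2) v\<bar>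
        \<le> \<eta> * cap_model.q n (norm (G x)) (\<lambda>v. B (proj v) (proj v) / 2) v" by blast
  qed
  with cap_model[OF \<delta>] show ?thesis by (rule that)
qed

end

section \<open>Asymptotics of the caps\<close>

lemma radial_pos:
  fixes K :: "'a::euclidean_space set"
  assumes K: "compact K" "convex K" "0 \<in> interior K" and u: "norm u = 1"
  shows "0 < radial K u" "radial K u *\<^sub>R u \<in> K"
proof -
  obtain r where r: "0 < r" "cball 0 r \<subseteq> K" using K(3) mem_interior_cball by blast
  have su: "sgn (c *\<^sub>R u) = u" if "0 < c" for c using that u by (simp add: sgn_scaleR sgn_div_norm)
  have u0: "u \<noteq> 0" using u by auto
  have K0: "0 \<in> K" using K(3) interior_subset by blast
  have "r *\<^sub>R u \<in> K" using r u by (auto simp: subset_iff)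
  then have "r \<le> radial K u"
    using mem_iff_le_radial[OF K(1,2) K0, of "r *\<^sub>R u"] r u0 u su[OF r(1)] by simp
  then show pos: "0 < radial K u" using r by simp
  show "radial K u *\<^sub>R u \<in> K"
    using mem_iff_le_radial[OF K(1,2) K0, of "radial K u *\<^sub>R u"] pos u0 u su[OF pos] by simp
qed

lemma radial_mono:
  fixes K :: "'a::euclidean_space set"
  assumes K: "compact K" "convex K" "0 \<in> interior K" and L: "compact L" "convex L" "K \<subseteq> L" and u: "norm u = 1"
  shows "radial K u \<le> radial L u"
proof -
  have K0: "0 \<in> L" using K(3) L(3) interior_subset by blast
  have "radial K u *\<^sub>R u \<in> L" "0 < radial K u" using radial_pos[OF K u] L by auto
  then show ?thesis
    using mem_iff_le_radial[OF L(1,2) K0, of "radial K u *\<^sub>R u"] u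
    by (cases "u = 0") (auto simp: sgn_scaleR sgn_div_norm)
qed

lemma admissible_deformationD:
  assumes "admissible_deformation K D" "0 \<le> t" "t \<le> 1"
  shows "compact (D t)" "convex (D t)" "K \<subseteq> D t" "D 0 = K"
  using assms by (auto simp: admissible_deformation_def convex_body_def)

lemma admissible_local_extension:
  fixes K :: "'a::euclidean_space set"
  assumes "admissible_deformation K D" "norm u = 1"
  obtains V g where "(0, u) \<in> V" "C2_on_open V g"
    "\<forall>t w. (t, w) \<in> V \<longrightarrow> 0 \<le> t \<longrightarrow> t \<le> 1 \<longrightarrow> norm w = 1 \<longrightarrow> g (t, w) = radial (D t) w"
proof -
  have "C2_on ({0..1} \<times> sphere 0 1) (\<lambda>(t, u). radial (D t) u)"
    using assms by (simp add: admissible_deformation_def)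
  moreover have "(0, u) \<in> {0..1::real} \<times> sphere 0 1" using assms by simp
  ultimately obtain V g where Vg: "(0, u) \<in> V" "C2_on_open V g"
    "\<forall>y\<in>({0..1} \<times> sphere 0 1) \<inter> V. g y = (\<lambda>(t, u). radial (D t) u) y"
    unfolding C2_on_def by blast
  show ?thesis by (rule that[OF Vg(1,2)]) (use Vg(3) in force)
qed

text \<open>The mean value theorem in t is applied to the extension \<open>g\<close>, whose
  derivative is continuous in both variables jointly; this makes the expansion uniform for
  \<open>u\<close> near \<open>u\<^sub>0\<close>. Uniformity matters because a cap spreads over a
  whole neighbourhood of directions, not a single ray. The sign of the speed comes from
  \<open>K \<subseteq> D t\<close>.\<close>

lemma radial_speed_expansion:
  fixes K :: "'a::euclidean_space set"
  assumes K: "compact K" "convex K" "0 \<in> interior K"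
    and adm: "admissible_deformation K D" and u\<^sub>0: "norm u\<^sub>0 = 1"
  shows "\<And>\<eta>. 0 < \<eta> \<Longrightarrow> \<exists>d>0. \<forall>t u. 0 \<le> t \<longrightarrow> t < d \<longrightarrow> norm u = 1 \<longrightarrow> norm (u - u\<^sub>0) < d \<longrightarrow>
      \<bar>radial (D t) u - radial K u - t * radial_speed D u\<^sub>0\<bar> \<le> \<eta> * t"
    and "0 \<le> radial_speed D u\<^sub>0"
proof -
  from admissible_local_extension[OF adm u\<^sub>0] obtain V g where V: "(0, u\<^sub>0) \<in> V" "C2_on_open V g"
    and g0: "\<forall>t w. (t, w) \<in> V \<longrightarrow> 0 \<le> t \<longrightarrow> t \<le> 1 \<longrightarrow> norm w = 1 \<longrightarrow> g (t, w) = radial (D t) w" .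
  note g = g0[rule_format]
  obtain g' :: "(real \<times> 'a) \<Rightarrow> ((real \<times> 'a) \<Rightarrow>\<^sub>L real)" and g'' where g': "open V"
    "\<And>p. p \<in> V \<Longrightarrow> (g has_derivative blinfun_apply (g' p)) (at p)"
    "\<And>p. p \<in> V \<Longrightarrow> (g' has_derivative blinfun_apply (g'' p)) (at p)"
    using V(2) unfolding C2_on_open_def by blast
  define \<sigma> where "\<sigma> = g' (0, u\<^sub>0) (1, 0)"
  have line: "((\<lambda>s. g (s, u)) has_real_derivative g' (s, u) (1, 0)) (at s)" if "(s, u) \<in> V" for s u
  proof -
    have "((\<lambda>s. (s, u)) has_derivative (\<lambda>t. (t, 0))) (at s)"
      by (intro has_derivative_Pair has_derivative_ident has_derivative_const)
    from has_derivative_compose[OF this g'(2)[OF that]]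
    have "((\<lambda>s. g (s, u)) has_derivative (\<lambda>t. g' (s, u) (t, 0))) (at s)" .
    moreover have "(\<lambda>t. g' (s, u) (t, 0)) = (*) (g' (s, u) (1, 0))"
    proof
      fix t show "g' (s, u) (t, 0) = g' (s, u) (1, 0) * t"
        using blinfun.scaleR_right[of "g' (s, u)" t "(1, 0)"] by (simp add: mult.commute)
    qed
    ultimately show ?thesis unfolding has_field_derivative_def by simp
  qed
  obtain r\<^sub>0 where r\<^sub>0: "0 < r\<^sub>0" "ball (0, u\<^sub>0) r\<^sub>0 \<subseteq> V" using g'(1) V(1) openE by blast
  have pair: "(s, u) \<in> ball (0, u\<^sub>0) r" if "\<bar>s\<bar> < r / 2" "norm (u - u\<^sub>0) < r / 2" for s r and u :: 'a
  proof -
    have "norm (s, u - u\<^sub>0) \<le> norm s + norm (u - u\<^sub>0)" by (rule norm_Pair_le)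
    then have "norm ((s, u) - (0, u\<^sub>0)) < r" using that by simp
    then show ?thesis by (simp only: mem_ball dist_norm norm_minus_commute)
  qed
  have "((\<lambda>t. radial (D t) u\<^sub>0) has_vector_derivative \<sigma>) (at 0 within {0..1})"
  proof (rule has_vector_derivative_transform_within)
    show "((\<lambda>s. g (s, u\<^sub>0)) has_vector_derivative \<sigma>) (at 0 within {0..1})"
      using line[OF V(1)] by (auto simp: \<sigma>_def has_real_derivative_iff_has_vector_derivative intro: has_vector_derivative_at_within)
    show "0 < r\<^sub>0 / 2" using r\<^sub>0 by simp
    fix t :: real assume t: "t \<in> {0..1}" "dist t 0 < r\<^sub>0 / 2"
    then have "(t, u\<^sub>0) \<in> V" using pair[of t r\<^sub>0 u\<^sub>0] r\<^sub>0 by auto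
    then show "g (t, u\<^sub>0) = radial (D t) u\<^sub>0" using t u\<^sub>0 by (intro g) auto
  qed simp
  then have \<sigma>: "radial_speed D u\<^sub>0 = \<sigma>"
    unfolding radial_speed_def by (intro vector_derivative_within_closed_interval) auto
  show exp: "\<exists>d>0. \<forall>t u. 0 \<le> t \<longrightarrow> t < d \<longrightarrow> norm u = 1 \<longrightarrow> norm (u - u\<^sub>0) < d \<longrightarrow>
      \<bar>radial (D t) u - radial K u - t * radial_speed D u\<^sub>0\<bar> \<le> \<eta> * t" if \<eta>: "0 < \<eta>" for \<eta>
  proof -
    have "isCont g' (0, u\<^sub>0)" using has_derivative_continuous[OF g'(3)[OF V(1)]] .
    then obtain r\<^sub>1 where r\<^sub>1: "0 < r\<^sub>1" "\<And>p. dist p (0, u\<^sub>0) < r\<^sub>1 \<Longrightarrow> dist (g' p) (g' (0, u\<^sub>0)) < \<eta>"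
      using \<eta> unfolding continuous_at_eps_delta by blast
    \<comment> \<open>Bounding each component by half a radius bounds the norm of the pair by the
      radius; the 1 keeps \<open>t\<close> within the unit interval.\<close>
    define d where "d = min 1 (min r\<^sub>0 r\<^sub>1 / 2)"
    have d: "0 < d" "d \<le> 1" "d \<le> r\<^sub>0 / 2" "d \<le> r\<^sub>1 / 2" using r\<^sub>0 r\<^sub>1 by (auto simp: d_def)
    have "\<bar>radial (D t) u - radial K u - t * \<sigma>\<bar> \<le> \<eta> * t"
      if t: "0 \<le> t" "t < d" and u: "norm u = 1" "norm (u - u\<^sub>0) < d" for t u
    proof (cases "t = 0")
      case True then show ?thesis using admissible_deformationD(4)[OF adm, of 0] by simp
    next
      case False
      have inV: "(s, u) \<in> V" if "0 \<le> s" "s \<le> t" for s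
        using that t u d r\<^sub>0 pair[of s r\<^sub>0 u] by auto
      obtain s where s: "0 < s" "s < t" "g (t, u) - g (0, u) = (t - 0) * g' (s, u) (1, 0)"
        using MVT2[of 0 t "\<lambda>s. g (s, u)" "\<lambda>s. g' (s, u) (1, 0)"] False t line inV by auto
      have "g (t, u) = radial (D t) u" "g (0, u) = radial K u"
        using g inV t u d admissible_deformationD(4)[OF adm, of 0] by auto
      moreover have "\<bar>g' (s, u) (1, 0) - \<sigma>\<bar> \<le> \<eta>"
      proof -
        have "dist (s, u) (0, u\<^sub>0) < r\<^sub>1" using pair[of s r\<^sub>1 u] s t u d by (simp add: dist_commute)
        then have "norm (g' (s, u) - g' (0, u\<^sub>0)) \<le> \<eta>" using r\<^sub>1(2)[of "(s, u)"] by (simp add: dist_norm)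
        moreover have "\<bar>g' (s, u) (1, 0) - \<sigma>\<bar> \<le> norm (g' (s, u) - g' (0, u\<^sub>0)) * norm (1 :: real, 0 :: 'a)"
          using norm_blinfun[of "g' (s, u) - g' (0, u\<^sub>0)" "(1, 0)"] by (simp add: \<sigma>_def blinfun.diff_left)
        ultimately show ?thesis by (simp add: norm_Pair)
      qed
      then have "t * \<bar>g' (s, u) (1, 0) - \<sigma>\<bar> \<le> t * \<eta>" using t by (intro mult_left_mono)
      moreover have "t * g' (s, u) (1, 0) - t * \<sigma> = t * (g' (s, u) (1, 0) - \<sigma>)" by (simp add: right_diff_distrib)
      ultimately show ?thesis using s(3) t by (simp add: abs_mult mult.commute)
    qed
    then show ?thesis using d(1) unfolding \<sigma> by blast
  qed
  show "0 \<le> radial_speed D u\<^sub>0"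
  proof (rule field_le_epsilon)
    fix \<eta> :: real assume "0 < \<eta>"
    then obtain d where d: "0 < d" "\<And>t u. 0 \<le> t \<Longrightarrow> t < d \<Longrightarrow> norm u = 1 \<Longrightarrow> norm (u - u\<^sub>0) < d \<Longrightarrow>
      \<bar>radial (D t) u - radial K u - t * radial_speed D u\<^sub>0\<bar> \<le> \<eta> * t" using exp by meson
    define t where "t = min 1 (d / 2)"
    have t: "0 < t" "t \<le> 1" "t < d" using d(1) by (auto simp: t_def)
    have "radial K u\<^sub>0 \<le> radial (D t) u\<^sub>0"
      using admissible_deformationD[OF adm, of t] t by (intro radial_mono K u\<^sub>0) auto
    moreover have "\<bar>radial (D t) u\<^sub>0 - radial K u\<^sub>0 - t * radial_speed D u\<^sub>0\<bar> \<le> \<eta> * t"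
      using d(2)[of t u\<^sub>0] t u\<^sub>0 d(1) by simp
    ultimately have "0 \<le> t * (radial_speed D u\<^sub>0 + \<eta>)" by (simp add: algebra_simps)
    then show "0 \<le> radial_speed D u\<^sub>0 + \<eta>" using t(1) by (simp add: zero_le_mult_iff)
  qed
qed

text \<open>Since \<open>D 0 = K\<close>, the slice t = 0 of the local extension is the radial
  function of \<open>K\<close>; so the deformation supplies the two derivatives of \<open>F\<close>
  at \<open>x\<close>.\<close>

lemma smooth_boundary_point_exists:
  fixes K :: "(real ^ 'n) set"
  assumes "C2plus_convex_body K" and K0: "0 \<in> interior K" and adm: "admissible_deformation K D"
    and x: "x \<in> K" and n: "norm n = 1" "\<And>y. y \<in> K \<Longrightarrow> (y - x) \<bullet> n \<le> 0"
  shows "\<exists>F' B. smooth_boundary_point K x n F' B"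
proof -
  have K: "compact K" "convex K"
    using assms(1) by (auto simp: C2plus_convex_body_def convex_body_def)
  have "x \<in> frontier K" using x n by (rule supported_imp_frontier)
  then have "x \<noteq> 0" using K0 by (auto simp: frontier_def)
  have curv: "0 < gauss_curvature K x"
    using assms(1) \<open>x \<in> frontier K\<close> by (auto simp: C2plus_convex_body_def)
  have "norm (sgn x) = 1" using \<open>x \<noteq> 0\<close> by (simp add: norm_sgn)
  from admissible_local_extension[OF adm this] obtain V g where V: "(0, sgn x) \<in> V" "C2_on_open V g"
    and g0: "\<forall>t w. (t, w) \<in> V \<longrightarrow> 0 \<le> t \<longrightarrow> t \<le> 1 \<longrightarrow> norm w = 1 \<longrightarrow> g (t, w) = radial (D t) w" .
  note g = g0[rule_format]
  from C2_norm_minus_radial[OF V(2) \<open>x \<noteq> 0\<close> V(1)] obtain F' where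
    F': "eventually (\<lambda>y. ((\<lambda>y. norm y - g (0, sgn y)) has_derivative blinfun_apply (F' y)) (at y)) (nhds x)"
    "F' differentiable (at x)" .
  have "((\<lambda>y. (0 :: real, sgn y)) \<longlongrightarrow> (0, sgn x)) (at x)"
    using has_derivative_continuous[OF has_derivative_sgn[OF \<open>x \<noteq> 0\<close>]]
    by (intro tendsto_Pair tendsto_const) (simp add: isCont_def)
  moreover have "open V" using V(2) by (simp add: C2_on_open_def)
  ultimately have "eventually (\<lambda>y. (0 :: real, sgn y) \<in> V) (at x)" using V(1) by (rule topological_tendstoD)
  then have "eventually (\<lambda>y. (0 :: real, sgn y) \<in> V) (nhds x)"
    using V(1) by (simp add: eventually_nhds_conv_at)
  moreover have "eventually (\<lambda>y. y \<noteq> 0) (nhds x)"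
    using \<open>x \<noteq> 0\<close> by (intro t1_space_nhds)
  ultimately have "eventually (\<lambda>y. (0 :: real, sgn y) \<in> V \<and> y \<noteq> 0) (nhds x)" by (rule eventually_conj)
  then have "eventually (\<lambda>y. norm y - g (0, sgn y) = norm y - radial K (sgn y)) (nhds x)"
    by eventually_elim (use g admissible_deformationD(4)[OF adm, of 0] in \<open>auto simp: norm_sgn\<close>)
  then obtain U where U: "open U" "x \<in> U" "\<And>y. y \<in> U \<Longrightarrow> norm y - g (0, sgn y) = norm y - radial K (sgn y)"
    unfolding eventually_nhds by blast
  have "eventually (\<lambda>y. ((\<lambda>y. norm y - radial K (sgn y)) has_derivative blinfun_apply (F' y)) (at y)) (nhds x)"
    using F'(1) eventually_nhds_in_open[OF U(1,2)]
  proof eventually_elim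
    case (elim y)
    show ?case by (rule has_derivative_transform_within_open[OF elim(1) U(1) elim(2) U(3)])
  qed
  moreover obtain B where "(F' has_derivative B) (at x)" using F'(2) by (auto simp: differentiable_def)
  ultimately have "smooth_boundary_point K x n F' B"
    using K K0 x n curv by unfold_locales
  then show ?thesis by blast
qed

context smooth_boundary_point
begin

text \<open>\<open>x + v\<close> lies in \<open>D \<epsilon>\<close> iff \<open>F (x + v)\<close> is
  at most the increase of the radial function in its direction. The first is \<open>q v\<close> up
  to \<open>\<eta> * q v\<close>, the second \<open>\<epsilon> * \<sigma>\<close> up to
  \<open>\<eta> * \<epsilon>\<close>, and both errors are traded for replacing \<sigma> by
  \<tau>.\<close>

lemma cap_sandwich:
  assumes model: "cap_model n \<gamma> \<beta>"
    and approx: "\<And>\<eta>. 0 < \<eta> \<Longrightarrow> \<exists>d>0. \<forall>v. 0 \<le> v \<bullet> n \<longrightarrow> norm v < d \<longrightarrow>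
      \<bar>F (x + v) - cap_model.q n \<gamma> \<beta> v\<bar> \<le> \<eta> * cap_model.q n \<gamma> \<beta> v"
    and adm: "admissible_deformation K D"
  defines "C \<equiv> \<lambda>\<epsilon>. {v. x + v \<in> D \<epsilon> \<and> 0 \<le> v \<bullet> n}" and "\<sigma> \<equiv> radial_speed D (sgn x)"
  shows "\<And>\<tau>. 0 < \<tau> \<Longrightarrow> \<tau> < \<sigma> \<Longrightarrow> eventually (\<lambda>\<epsilon>. cap_model.S n \<gamma> \<beta> (\<tau> * \<epsilon>) \<subseteq> C \<epsilon>) (at_right 0)"
    and "\<And>\<tau>. \<sigma> < \<tau> \<Longrightarrow> eventually (\<lambda>\<epsilon>. C \<epsilon> \<subseteq> cap_model.S n \<gamma> \<beta> (\<tau> * \<epsilon>)) (at_right 0)"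
proof -
  interpret M: cap_model n \<gamma> \<beta> by (rule model)
  have x0: "x \<noteq> 0" using x_n_pos by auto
  have sx: "norm (sgn x) = 1" using x0 by (simp add: norm_sgn)
  have K0: "0 \<in> K" using K(3) interior_subset by blast
  have \<sigma>0: "0 \<le> \<sigma>" unfolding \<sigma>_def by (rule radial_speed_expansion(2)[OF K adm sx])
  have loc: "\<exists>d>0. d \<le> 1 \<and> (\<forall>\<epsilon> v. 0 \<le> \<epsilon> \<longrightarrow> \<epsilon> < d \<longrightarrow> norm v < d \<longrightarrow> 0 \<le> v \<bullet> n \<longrightarrow>
      ((1 + \<eta>) * M.q v \<le> (\<sigma> - \<eta>) * \<epsilon> \<longrightarrow> x + v \<in> D \<epsilon>) \<and>
      (x + v \<in> D \<epsilon> \<longrightarrow> (1 - \<eta>) * M.q v \<le> (\<sigma> + \<eta>) * \<epsilon>))" if \<eta>: "0 < \<eta>" for \<eta>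
  proof -
    obtain d\<^sub>1 where d\<^sub>1: "0 < d\<^sub>1" "\<And>v. 0 \<le> v \<bullet> n \<Longrightarrow> norm v < d\<^sub>1 \<Longrightarrow> \<bar>F (x + v) - M.q v\<bar> \<le> \<eta> * M.q v"
      using approx[OF \<eta>] by blast
    obtain d\<^sub>2 where d\<^sub>2: "0 < d\<^sub>2" "\<And>t u. 0 \<le> t \<Longrightarrow> t < d\<^sub>2 \<Longrightarrow> norm u = 1 \<Longrightarrow> norm (u - sgn x) < d\<^sub>2 \<Longrightarrow>
      \<bar>radial (D t) u - radial K u - t * \<sigma>\<bar> \<le> \<eta> * t"
      using radial_speed_expansion(1)[OF K adm sx \<eta>] unfolding \<sigma>_def by meson
    have "isCont sgn x" using has_derivative_continuous[OF has_derivative_sgn[OF x0]] .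
    then obtain d\<^sub>3 where d\<^sub>3: "0 < d\<^sub>3" "\<And>y. dist y x < d\<^sub>3 \<Longrightarrow> dist (sgn y) (sgn x) < d\<^sub>2"
      using d\<^sub>2(1) unfolding continuous_at_eps_delta by blast
    define d where "d = min (min d\<^sub>1 d\<^sub>2) (min (min d\<^sub>3 (norm x)) 1)"
    have d: "0 < d" "d \<le> 1" "d \<le> d\<^sub>1" "d \<le> d\<^sub>2" "d \<le> d\<^sub>3" "d \<le> norm x" using d\<^sub>1 d\<^sub>2 d\<^sub>3 x0 by (auto simp: d_def)
    show ?thesis
    proof (rule exI[of _ d], intro conjI allI impI d(1,2))
      fix \<epsilon> v assume *: "0 \<le> \<epsilon>" "\<epsilon> < d" "norm v < d" "0 \<le> v \<bullet> n"
      define y where "y = x + v"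
      have y0: "y \<noteq> 0"
      proof
        assume "y = 0"
        then have "v = - x" by (simp add: y_def eq_neg_iff_add_eq_0 add.commute)
        then show False using * d by simp
      qed
      have D: "compact (D \<epsilon>)" "convex (D \<epsilon>)" "0 \<in> D \<epsilon>"
        using admissible_deformationD[OF adm, of \<epsilon>] * d K0 by auto
      have "norm (sgn y - sgn x) < d\<^sub>2" using d\<^sub>3(2)[of y] * d by (simp add: y_def dist_norm)
      then have e: "\<bar>radial (D \<epsilon>) (sgn y) - radial K (sgn y) - \<epsilon> * \<sigma>\<bar> \<le> \<eta> * \<epsilon>"
        using y0 * d by (intro d\<^sub>2(2)) (auto simp: norm_sgn)
      have m: "x + v \<in> D \<epsilon> \<longleftrightarrow> F y \<le> radial (D \<epsilon>) (sgn y) - radial K (sgn y)"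
        using mem_iff_le_radial[OF D y0] by (simp add: F_def y_def)
      have a: "\<bar>F y - M.q v\<bar> \<le> \<eta> * M.q v" unfolding y_def using * d by (intro d\<^sub>1(2)) auto
      show "x + v \<in> D \<epsilon>" if "(1 + \<eta>) * M.q v \<le> (\<sigma> - \<eta>) * \<epsilon>"
        using that a e unfolding m distrib_right left_diff_distrib by (simp add: mult.commute) 
      show "(1 - \<eta>) * M.q v \<le> (\<sigma> + \<eta>) * \<epsilon>" if "x + v \<in> D \<epsilon>"
        using that a e unfolding m distrib_right left_diff_distrib by (simp add: mult.commute)
    qed
  qed
  show "eventually (\<lambda>\<epsilon>. M.S (\<tau> * \<epsilon>) \<subseteq> C \<epsilon>) (at_right 0)" if \<tau>: "0 < \<tau>" "\<tau> < \<sigma>" for \<tau>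
  proof -
    \<comment> \<open>Solves \<open>(1 + \<eta>) * \<tau> = \<sigma> - \<eta>\<close>, so the local
      criterion for membership becomes \<open>q v \<le> \<tau> * \<epsilon>\<close>.\<close>
    define \<eta> where "\<eta> = (\<sigma> - \<tau>) / (\<tau> + 1)"
    have \<eta>: "0 < \<eta>" "(1 + \<eta>) * \<tau> = \<sigma> - \<eta>" using \<tau> by (auto simp: \<eta>_def field_simps)
    obtain d where d: "0 < d" "d \<le> 1" "\<And>\<epsilon> v. 0 \<le> \<epsilon> \<Longrightarrow> \<epsilon> < d \<Longrightarrow> norm v < d \<Longrightarrow> 0 \<le> v \<bullet> n \<Longrightarrow>
      (1 + \<eta>) * M.q v \<le> (\<sigma> - \<eta>) * \<epsilon> \<Longrightarrow> x + v \<in> D \<epsilon>"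
      using loc[OF \<eta>(1)] by meson
    obtain \<tau>\<^sub>0 where \<tau>\<^sub>0: "0 < \<tau>\<^sub>0" "\<And>\<tau>. \<tau> < \<tau>\<^sub>0 \<Longrightarrow> M.S \<tau> \<subseteq> ball 0 d" using M.S_subset_ball[OF d(1)] by blast
    have "eventually (\<lambda>\<epsilon>. \<epsilon> \<in> {0<..<min d (\<tau>\<^sub>0 / \<tau>)}) (at_right 0)"
      using d \<tau>\<^sub>0(1) \<tau> by (intro eventually_at_right_real) simp
    then show ?thesis
    proof eventually_elim
      case (elim \<epsilon>)
      then have \<epsilon>: "0 < \<epsilon>" "\<epsilon> < d" "\<tau> * \<epsilon> < \<tau>\<^sub>0" using \<tau> by (auto simp: field_simps)
      show ?case
      proof
        fix v assume v: "v \<in> M.S (\<tau> * \<epsilon>)"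
        then have "norm v < d" "0 \<le> v \<bullet> n" "M.q v \<le> \<tau> * \<epsilon>" using \<tau>\<^sub>0(2)[OF \<epsilon>(3)] by (auto simp: M.S_def)
        moreover have "(1 + \<eta>) * M.q v \<le> (1 + \<eta>) * (\<tau> * \<epsilon>)"
          using calculation \<eta>(1) by (intro mult_left_mono) auto
        moreover have "(1 + \<eta>) * (\<tau> * \<epsilon>) = (\<sigma> - \<eta>) * \<epsilon>" using \<eta>(2) by (simp add: mult.assoc[symmetric])
        ultimately show "v \<in> C \<epsilon>" using d(3)[of \<epsilon> v] \<epsilon> by (simp add: C_def)
      qed
    qed
  qed
  show "eventually (\<lambda>\<epsilon>. C \<epsilon> \<subseteq> M.S (\<tau> * \<epsilon>)) (at_right 0)" if \<tau>: "\<sigma> < \<tau>" for \<tau>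
  proof -
    have \<tau>0: "0 < \<tau>" using \<tau> \<sigma>0 by simp
    \<comment> \<open>Solves \<open>(1 - \<eta>) * \<tau> = \<sigma> + \<eta>\<close>; here
      \<open>\<eta> < 1\<close> because \<open>\<sigma> \<ge> 0\<close>.\<close>
    define \<eta> where "\<eta> = (\<tau> - \<sigma>) / (\<tau> + 1)"
    have \<eta>: "0 < \<eta>" "\<eta> < 1" "(1 - \<eta>) * \<tau> = \<sigma> + \<eta>" using \<tau> \<sigma>0 by (auto simp: \<eta>_def field_simps)
    obtain d where d: "0 < d" "d \<le> 1" "\<And>\<epsilon> v. 0 \<le> \<epsilon> \<Longrightarrow> \<epsilon> < d \<Longrightarrow> norm v < d \<Longrightarrow> 0 \<le> v \<bullet> n \<Longrightarrow>
      x + v \<in> D \<epsilon> \<Longrightarrow> (1 - \<eta>) * M.q v \<le> (\<sigma> + \<eta>) * \<epsilon>"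
      using loc[OF \<eta>(1)] by meson
    have d2: "0 < d / 2" using d by simp
    obtain m where m: "0 < m" "\<And>v. 0 \<le> v \<bullet> n \<Longrightarrow> d / 2 \<le> norm v \<Longrightarrow> m \<le> M.q v"
      using M.q_lower_bound[OF d2] by blast
    have "eventually (\<lambda>\<epsilon>. \<epsilon> \<in> {0<..<min d (m / \<tau>)}) (at_right 0)"
      using d m(1) \<tau>0 by (intro eventually_at_right_real) simp
    then show ?thesis
    proof eventually_elim
      case (elim \<epsilon>)
      then have \<epsilon>: "0 < \<epsilon>" "\<epsilon> < d" "\<tau> * \<epsilon> < m" using \<tau>0 by (auto simp: field_simps)
      have near: "M.q v \<le> \<tau> * \<epsilon>" if v: "v \<in> C \<epsilon>" "norm v < d" for v
      proof -
        have "(1 - \<eta>) * M.q v \<le> (\<sigma> + \<eta>) * \<epsilon>" using d(3)[of \<epsilon> v] v \<epsilon> by (simp add: C_def)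
        also have "\<dots> = (1 - \<eta>) * (\<tau> * \<epsilon>)" using \<eta>(3) by (simp add: mult.assoc[symmetric])
        finally show ?thesis using \<eta>(2) by simp
      qed
      show ?case
      proof
        fix v assume v: "v \<in> C \<epsilon>"
        have "norm v < d"
        proof (rule ccontr)
          assume "\<not> norm v < d"
          then have nv: "d \<le> norm v" "0 < norm v" using d by auto
          \<comment> \<open>The local estimate reaches only vectors shorter than \<open>d\<close>. A
            longer one is pulled back to norm \<open>d / 2\<close>: it stays in the cap, since
            \<open>D \<epsilon>\<close> is convex and contains \<open>x\<close>, but there
            \<open>q\<close> is at least \<open>m\<close>, which exceeds
            \<open>\<tau> * \<epsilon>\<close>.\<close>
          define t where "t = d / 2 / norm v"
          have t: "0 \<le> t" "t \<le> 1" "t * norm v = d / 2" using nv d(1) by (auto simp: t_def divide_simps)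
          have D: "convex (D \<epsilon>)" "x \<in> D \<epsilon>"
            using admissible_deformationD[OF adm, of \<epsilon>] \<epsilon> d xK by auto
          have "t *\<^sub>R (x + v) + (1 - t) *\<^sub>R x \<in> D \<epsilon>"
            using D t v by (intro convexD) (auto simp: C_def)
          moreover have "t *\<^sub>R (x + v) + (1 - t) *\<^sub>R x = x + t *\<^sub>R v" by (simp add: algebra_simps)
          ultimately have "t *\<^sub>R v \<in> C \<epsilon>" using v t by (simp add: C_def)
          moreover have "norm (t *\<^sub>R v) = d / 2" using t by simp
          ultimately have "M.q (t *\<^sub>R v) \<le> \<tau> * \<epsilon>" "m \<le> M.q (t *\<^sub>R v)"
            using near[of "t *\<^sub>R v"] m(2)[of "t *\<^sub>R v"] d2 by (auto simp: C_def)
          then show False using \<epsilon>(3) by simp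
        qed
        from near[OF v this] show "v \<in> M.S (\<tau> * \<epsilon>)" using v by (simp add: C_def M.S_def)
      qed
    qed
  qed
qed

text \<open>\<open>M\<close> comes from the model caps alone and is fixed before \<open>D\<close>.
  As the level \<tau> may approach \<sigma> from either side, continuity of \<open>powr\<close>
  closes the gap.\<close>

theorem cap_intrinsic_volume_limit:
  assumes k: "1 \<le> k" "k \<le> CARD('n)"
  shows "\<exists>M>0. \<forall>D. admissible_deformation K D \<longrightarrow>
    ((\<lambda>\<epsilon>. intrinsic_volume k (D \<epsilon> \<inter> {y. 0 \<le> (y - x) \<bullet> n}) / \<epsilon> powr cap_exponent CARD('n) k) \<longlongrightarrow>
       M * radial_speed D (sgn x) powr cap_exponent CARD('n) k) (at_right 0)"
proof -
  from local_cap_model obtain \<gamma> \<beta> where model: "cap_model n \<gamma> \<beta>"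
    and "\<forall>\<eta>>0. \<exists>d>0. \<forall>v. 0 \<le> v \<bullet> n \<longrightarrow> norm v < d \<longrightarrow>
      \<bar>F (x + v) - cap_model.q n \<gamma> \<beta> v\<bar> \<le> \<eta> * cap_model.q n \<gamma> \<beta> v" .
  note approx = this(2)[rule_format]
  interpret M: cap_model n \<gamma> \<beta> by (rule model)
  define \<alpha> where "\<alpha> = cap_exponent CARD('n) k"
  have \<alpha>: "0 < \<alpha>" using k by (simp add: \<alpha>_def cap_exponent_def)
  obtain M where M: "0 < M" "((\<lambda>\<tau>. intrinsic_volume k (M.S \<tau>) / \<tau> powr \<alpha>) \<longlongrightarrow> M) (at_right 0)"
    using M.intrinsic_volume_S_limit[OF k(2)] unfolding \<alpha>_def by blast
  have scaled: "((\<lambda>\<epsilon>. intrinsic_volume k (M.S (\<tau> * \<epsilon>)) / \<epsilon> powr \<alpha>) \<longlongrightarrow> M * \<tau> powr \<alpha>) (at_right 0)"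
    if \<tau>: "0 < \<tau>" for \<tau>
  proof -
    have "filterlim (\<lambda>\<epsilon>. \<tau> * \<epsilon>) (at_right 0) (at_right 0)"
      unfolding filterlim_at
    proof
      show "eventually (\<lambda>\<epsilon>. \<tau> * \<epsilon> \<in> {0<..} \<and> \<tau> * \<epsilon> \<noteq> 0) (at_right 0)"
        using eventually_at_right_less[of "0::real"] by eventually_elim (use \<tau> in auto)
      have "((\<lambda>\<epsilon>. \<tau> * \<epsilon>) \<longlongrightarrow> \<tau> * 0) (at_right 0)" by (intro tendsto_intros)
      then show "((\<lambda>\<epsilon>. \<tau> * \<epsilon>) \<longlongrightarrow> 0) (at_right 0)" by simp
    qed
    from tendsto_mult[OF filterlim_compose[OF M(2) this] tendsto_const[of "\<tau> powr \<alpha>"]]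
    have "((\<lambda>\<epsilon>. intrinsic_volume k (M.S (\<tau> * \<epsilon>)) / (\<tau> * \<epsilon>) powr \<alpha> * \<tau> powr \<alpha>) \<longlongrightarrow> M * \<tau> powr \<alpha>) (at_right 0)" .
    moreover have "eventually (\<lambda>\<epsilon>. intrinsic_volume k (M.S (\<tau> * \<epsilon>)) / (\<tau> * \<epsilon>) powr \<alpha> * \<tau> powr \<alpha> =
        intrinsic_volume k (M.S (\<tau> * \<epsilon>)) / \<epsilon> powr \<alpha>) (at_right 0)"
      using eventually_at_right_less[of "0::real"] by eventually_elim (use \<tau> in \<open>simp add: powr_mult\<close>)
    ultimately show ?thesis by (rule Lim_transform_eventually)
  qed
  show ?thesis
  proof (rule exI[of _ M], intro conjI allI impI M(1))
    fix D assume adm: "admissible_deformation K D"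
    define \<sigma> where "\<sigma> = radial_speed D (sgn x)"
    define C where "C \<epsilon> = {v. x + v \<in> D \<epsilon> \<and> 0 \<le> v \<bullet> n}" for \<epsilon>
    have x0: "x \<noteq> 0" using x_n_pos by auto
    have \<sigma>0: "0 \<le> \<sigma>" unfolding \<sigma>_def
      using x0 by (intro radial_speed_expansion(2)[OF K adm]) (simp add: norm_sgn)
    have low: "eventually (\<lambda>\<epsilon>. M.S (\<tau> * \<epsilon>) \<subseteq> C \<epsilon>) (at_right 0)" if "0 < \<tau>" "\<tau> < \<sigma>" for \<tau>
      using cap_sandwich(1)[OF model approx adm] that unfolding C_def \<sigma>_def by blast
    have up: "eventually (\<lambda>\<epsilon>. C \<epsilon> \<subseteq> M.S (\<tau> * \<epsilon>)) (at_right 0)" if "\<sigma> < \<tau>" for \<tau>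
      using cap_sandwich(2)[OF model approx adm] that unfolding C_def \<sigma>_def by blast
    have trans: "D \<epsilon> \<inter> {y. 0 \<le> (y - x) \<bullet> n} = (+) x ` C \<epsilon>" for \<epsilon>
    proof (intro equalityI subsetI)
      fix y assume "y \<in> D \<epsilon> \<inter> {y. 0 \<le> (y - x) \<bullet> n}"
      then show "y \<in> (+) x ` C \<epsilon>" by (intro image_eqI[of _ _ "y - x"]) (auto simp: C_def)
    qed (auto simp: C_def)
    have C: "compact (C \<epsilon>)" "convex (C \<epsilon>)" "C \<epsilon> \<noteq> {}" if "0 \<le> \<epsilon>" "\<epsilon> \<le> 1" for \<epsilon>
    proof -
      note D = admissible_deformationD[OF adm that]
      have half: "{y. 0 \<le> (y - x) \<bullet> n} = {y. n \<bullet> y \<ge> n \<bullet> x}" by (auto simp: inner_diff_left inner_diff_right inner_commute)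
      have "C \<epsilon> = (+) (- x) ` ((+) x ` C \<epsilon>)" by (simp add: image_image)
      then have eq: "C \<epsilon> = (+) (- x) ` (D \<epsilon> \<inter> {y. n \<bullet> y \<ge> n \<bullet> x})" unfolding trans[symmetric] half .
      show "compact (C \<epsilon>)" unfolding eq
        by (intro compact_translation compact_Int_closed closed_halfspace_ge D)
      show "convex (C \<epsilon>)" unfolding eq
        by (intro convex_translation convex_Int convex_halfspace_ge D)
      show "C \<epsilon> \<noteq> {}" using D(3) xK by (auto simp: C_def intro!: exI[of _ 0])
    qed
    have S: "compact (M.S \<tau>)" "convex (M.S \<tau>)" for \<tau> by (rule M.compact_S M.convex_S)+
    have Sne: "M.S \<tau> \<noteq> {}" if "0 \<le> \<tau>" for \<tau> using M.zero_in_S[OF that] by auto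
    have small: "eventually (\<lambda>\<epsilon>. 0 < \<epsilon> \<and> \<epsilon> \<le> 1) (at_right (0::real))"
      using eventually_at_right_real[of 0 "1::real"] by (auto elim!: eventually_mono)
    have "((\<lambda>\<epsilon>. intrinsic_volume k (C \<epsilon>) / \<epsilon> powr \<alpha>) \<longlongrightarrow> M * \<sigma> powr \<alpha>) (at_right 0)"
    proof (rule order_tendstoI)
      fix a assume a: "a < M * \<sigma> powr \<alpha>"
      show "eventually (\<lambda>\<epsilon>. a < intrinsic_volume k (C \<epsilon>) / \<epsilon> powr \<alpha>) (at_right 0)"
      \<comment> \<open>For \<open>\<sigma> = 0\<close> no level fits between 0 and \<sigma>; the
        limit is then 0 and non-negativity is the lower bound.\<close>
      proof (cases "\<sigma> = 0")
        case True
        then have "a < 0" using a \<alpha> by simp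
        show ?thesis using small
        proof eventually_elim
          case (elim \<epsilon>)
          then have "0 \<le> intrinsic_volume k (C \<epsilon>)" using k by (intro intrinsic_volume_nonneg C) auto
          then have "0 \<le> intrinsic_volume k (C \<epsilon>) / \<epsilon> powr \<alpha>" by simp
          then show ?case using \<open>a < 0\<close> by linarith
        qed
      next
        case False
        then have "0 < \<sigma>" using \<sigma>0 by simp
        have "((\<lambda>\<tau>. M * \<tau> powr \<alpha>) \<longlongrightarrow> M * \<sigma> powr \<alpha>) (at_left \<sigma>)"
          using \<open>0 < \<sigma>\<close> by (intro tendsto_intros) auto
        then have "eventually (\<lambda>\<tau>. a < M * \<tau> powr \<alpha>) (at_left \<sigma>)" using a by (rule order_tendstoD)
        moreover have "eventually (\<lambda>\<tau>. \<tau> \<in> {0<..<\<sigma>}) (at_left \<sigma>)"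
          using \<open>0 < \<sigma>\<close> by (rule eventually_at_left_real)
        ultimately have "eventually (\<lambda>\<tau>. a < M * \<tau> powr \<alpha> \<and> \<tau> \<in> {0<..<\<sigma>}) (at_left \<sigma>)"
          by (rule eventually_conj)
        then obtain \<tau> where \<tau>: "a < M * \<tau> powr \<alpha>" "0 < \<tau>" "\<tau> < \<sigma>"
          using eventually_happens[of _ "at_left \<sigma>"] by (auto simp: trivial_limit_at_left_real)
        have "eventually (\<lambda>\<epsilon>. a < intrinsic_volume k (M.S (\<tau> * \<epsilon>)) / \<epsilon> powr \<alpha>) (at_right 0)"
          using scaled[OF \<tau>(2)] \<tau>(1) by (rule order_tendstoD)
        then show ?thesis using low[OF \<tau>(2,3)] small
        proof eventually_elim
          case (elim \<epsilon>)
          have "intrinsic_volume k (M.S (\<tau> * \<epsilon>)) \<le> intrinsic_volume k (C \<epsilon>)"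
            using elim \<tau> k by (intro intrinsic_volume_mono S Sne C) auto
          then have "intrinsic_volume k (M.S (\<tau> * \<epsilon>)) / \<epsilon> powr \<alpha> \<le> intrinsic_volume k (C \<epsilon>) / \<epsilon> powr \<alpha>"
            by (intro divide_right_mono) auto
          then show ?case using elim(1) by linarith
        qed
      qed
    next
      fix b assume b: "M * \<sigma> powr \<alpha> < b"
      \<comment> \<open>The base may be 0, where continuity of \<open>powr\<close> from the right
        relies on \<open>\<alpha> > 0\<close>.\<close>
      have "((\<lambda>\<tau>. \<tau> powr \<alpha>) \<longlongrightarrow> \<sigma> powr \<alpha>) (at_right \<sigma>)"
      proof (rule tendsto_powr')
        have "eventually (\<lambda>\<tau>. 0 \<le> \<tau>) (at_right \<sigma>)"
          using eventually_at_right_less[of \<sigma>] by eventually_elim (use \<sigma>0 in auto)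
        then show "\<sigma> \<noteq> 0 \<or> 0 < \<alpha> \<and> eventually (\<lambda>\<tau>. 0 \<le> \<tau>) (at_right \<sigma>)" using \<alpha> by blast
      qed (rule tendsto_ident_at tendsto_const)+
      then have "((\<lambda>\<tau>. M * \<tau> powr \<alpha>) \<longlongrightarrow> M * \<sigma> powr \<alpha>) (at_right \<sigma>)"
        by (rule tendsto_mult[OF tendsto_const])
      then have "eventually (\<lambda>\<tau>. M * \<tau> powr \<alpha> < b) (at_right \<sigma>)" using b by (rule order_tendstoD)
      then have "eventually (\<lambda>\<tau>. M * \<tau> powr \<alpha> < b \<and> \<sigma> < \<tau>) (at_right \<sigma>)"
        using eventually_at_right_less[of \<sigma>] by (rule eventually_conj)
      then obtain \<tau> where \<tau>: "M * \<tau> powr \<alpha> < b" "\<sigma> < \<tau>"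
        using eventually_happens[of _ "at_right \<sigma>"] by (auto simp: trivial_limit_at_right_real)
      have \<tau>0: "0 < \<tau>" using \<tau> \<sigma>0 by simp
      have "eventually (\<lambda>\<epsilon>. intrinsic_volume k (M.S (\<tau> * \<epsilon>)) / \<epsilon> powr \<alpha> < b) (at_right 0)"
        using scaled[OF \<tau>0] \<tau>(1) by (rule order_tendstoD)
      then show "eventually (\<lambda>\<epsilon>. intrinsic_volume k (C \<epsilon>) / \<epsilon> powr \<alpha> < b) (at_right 0)"
        using up[OF \<tau>(2)] small
      proof eventually_elim
        case (elim \<epsilon>)
        have "intrinsic_volume k (C \<epsilon>) \<le> intrinsic_volume k (M.S (\<tau> * \<epsilon>))"
          using elim k by (intro intrinsic_volume_mono S C) auto
        then have "intrinsic_volume k (C \<epsilon>) / \<epsilon> powr \<alpha> \<le> intrinsic_volume k (M.S (\<tau> * \<epsilon>)) / \<epsilon> powr \<alpha>"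
          by (intro divide_right_mono) auto
        then show ?case using elim(1) by linarith
      qed
    qed
    moreover have "eventually (\<lambda>\<epsilon>. intrinsic_volume k (C \<epsilon>) / \<epsilon> powr \<alpha> =
        intrinsic_volume k (D \<epsilon> \<inter> {y. 0 \<le> (y - x) \<bullet> n}) / \<epsilon> powr \<alpha>) (at_right 0)"
      using small
    proof eventually_elim
      case (elim \<epsilon>)
      show ?case unfolding trans using intrinsic_volume_translation[OF C k(2), of \<epsilon> x] elim by simp
    qed
    ultimately show "((\<lambda>\<epsilon>. intrinsic_volume k (D \<epsilon> \<inter> {y. 0 \<le> (y - x) \<bullet> n}) / \<epsilon> powr cap_exponent CARD('n) k) \<longlongrightarrow>
       M * radial_speed D (sgn x) powr cap_exponent CARD('n) k) (at_right 0)"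
      unfolding \<alpha>_def \<sigma>_def by (rule Lim_transform_eventually)
  qed
qed

end

section \<open>Tangent hyperplanes, outer half-spaces and the conclusion\<close>

lemma tangent_hyperplane_normal:
  fixes K :: "'a::euclidean_space set"
  assumes K: "convex K" "0 \<in> interior K" and H: "tangent_hyperplane K H"
  obtains x n where "x \<in> K" "norm n = 1" "H = {y. (y - x) \<bullet> n = 0}" "\<forall>y\<in>K. (y - x) \<bullet> n \<le> 0"
proof -
  obtain a b where ab: "a \<noteq> 0" "H = {x. a \<bullet> x = b}" and H': "H \<inter> K \<noteq> {}" "H \<inter> interior K = {}"
    using H by (auto simp: tangent_hyperplane_def hyperplane_def)
  obtain x where x: "x \<in> K" "a \<bullet> x = b" using H' ab by blast
  have "b \<noteq> 0" using H'(2) K(2) ab by auto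
  \<comment> \<open>\<open>b\<close> is nonzero because the interior point 0 is not on
    \<open>H\<close>; its sign turns the normal away from the origin.\<close>
  define n where "n = sgn b *\<^sub>R sgn a"
  define c where "c = sgn b / norm a"
  have c: "c \<noteq> 0" "n = c *\<^sub>R a" using ab \<open>b \<noteq> 0\<close> by (auto simp: c_def n_def sgn_div_norm sgn_zero_iff divide_inverse mult.commute)
  have nH: "H = {y. (y - x) \<bullet> n = 0}"
    unfolding ab(2) x(2)[symmetric] c(2) using c(1) by (auto simp: inner_diff_left inner_diff_right inner_commute)
  have "0 < x \<bullet> n"
  proof -
    have "x \<bullet> n = \<bar>b\<bar> / norm a"
      unfolding c(2) c_def using x(2) by (simp add: inner_commute abs_sgn)
    then show ?thesis using ab \<open>b \<noteq> 0\<close> by simp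
  qed
  have "(y - x) \<bullet> n \<le> 0" if y: "y \<in> K" for y
  proof (rule ccontr)
    assume "\<not> (y - x) \<bullet> n \<le> 0"
    then have yn: "x \<bullet> n < y \<bullet> n" by (simp add: inner_diff_left)
    \<comment> \<open>If \<open>y\<close> lay beyond \<open>H\<close>, shrinking it towards the
      interior point 0 until it meets \<open>H\<close> would give an interior point of
      \<open>K\<close> on \<open>H\<close>.\<close>
    define t where "t = (x \<bullet> n) / (y \<bullet> n)"
    have t: "0 < t" "t < 1" using yn \<open>0 < x \<bullet> n\<close> by (auto simp: t_def)
    have "y - (1 - t) *\<^sub>R (y - 0) \<in> interior K"
      using t y by (intro mem_interior_convex_shrink K) auto
    moreover have "y - (1 - t) *\<^sub>R (y - 0) = t *\<^sub>R y" by (simp add: algebra_simps)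
    moreover have "t *\<^sub>R y \<in> H" unfolding nH using yn \<open>0 < x \<bullet> n\<close> by (simp add: inner_diff_left t_def)
    ultimately show False using H'(2) by auto
  qed
  moreover have "norm n = 1" using ab \<open>b \<noteq> 0\<close> by (simp add: n_def norm_sgn)
  ultimately show ?thesis using that x(1) nH by blast
qed

text \<open>A hyperplane determines its normal up to a nonzero factor \<open>c\<close>, and a
  negative \<open>c\<close> would give the side that contains \<open>K\<close>.\<close>

lemma outer_halfspace_eq:
  fixes K :: "'a::euclidean_space set"
  assumes K0: "0 \<in> interior K" and n: "norm n = 1" and supp: "\<And>y. y \<in> K \<Longrightarrow> (y - x) \<bullet> n \<le> 0"
  shows "outer_halfspace K {y. (y - x) \<bullet> n = 0} = {y. 0 \<le> (y - x) \<bullet> n}"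
  unfolding outer_halfspace_def
proof (rule the_equality)
  have nn: "n \<bullet> n = 1" using n by (simp add: dot_square_norm)
  obtain r where r: "0 < r" "cball 0 r \<subseteq> K" using K0 mem_interior_cball by blast
  then have "r *\<^sub>R n \<in> K" "0 \<in> K" using n by (auto simp: subset_iff)
  then have xn: "0 < x \<bullet> n" using supp[of "r *\<^sub>R n"] r(1) nn by (simp add: inner_diff_left)
  have "closed_halfspace_of {y. (y - x) \<bullet> n = 0} {y. 0 \<le> (y - x) \<bullet> n}"
    unfolding closed_halfspace_of_def
    by (intro exI[of _ n] exI[of _ "n \<bullet> x"]) (use n in \<open>auto simp: inner_diff_left inner_diff_right inner_commute\<close>)
  moreover have "0 \<notin> {y. 0 \<le> (y - x) \<bullet> n}" using xn by simp
  ultimately show "closed_halfspace_of {y. (y - x) \<bullet> n = 0} {y. 0 \<le> (y - x) \<bullet> n} \<and> \<not> K \<subseteq> {y. 0 \<le> (y - x) \<bullet> n}"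
    using \<open>0 \<in> K\<close> by blast
  fix P assume P: "closed_halfspace_of {y. (y - x) \<bullet> n = 0} P \<and> \<not> K \<subseteq> P"
  then obtain a b where ab: "a \<noteq> 0" "{y. (y - x) \<bullet> n = 0} = {y. a \<bullet> y = b}" "P = {y. a \<bullet> y \<ge> b}"
    unfolding closed_halfspace_of_def by blast
  have mem: "a \<bullet> y = b" if "(y - x) \<bullet> n = 0" for y using ab(2) that by blast
  have bx: "b = a \<bullet> x" using mem[of x] by simp
  define w where "w = a - (a \<bullet> n) *\<^sub>R n"
  have wn: "w \<bullet> n = 0" using nn by (simp add: w_def inner_diff_left)
  then have "a \<bullet> w = 0" using mem[of "x + w"] bx by (simp add: inner_add_right)
  then have "w \<bullet> w = 0" using wn by (simp add: w_def inner_diff_left inner_commute)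
  then have a: "a = (a \<bullet> n) *\<^sub>R n" by (simp add: w_def)
  define c where "c = a \<bullet> n"
  have ac: "a = c *\<^sub>R n" using a by (simp add: c_def)
  have c0: "c \<noteq> 0" using ab(1) ac by auto
  have P_eq: "P = {y. 0 \<le> c * ((y - x) \<bullet> n)}"
    unfolding ab(3) bx ac by (auto simp: inner_diff_left inner_diff_right inner_commute right_diff_distrib)
  have "0 < c"
  proof (rule ccontr)
    assume "\<not> 0 < c"
    then have "K \<subseteq> P" unfolding P_eq using supp by (auto intro: mult_nonpos_nonpos)
    with P show False by blast
  qed
  then show "P = {y. 0 \<le> (y - x) \<bullet> n}" unfolding P_eq by (auto simp: zero_le_mult_iff)
qed

text \<open>The order of the quantifiers is the point: one \<open>M\<close> serves all deformations
  of \<open>K\<close>, so the limits for two of them can be compared. If there is no deformation,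
  the claim is vacuous and any positive \<open>M\<close> will do.\<close>

theorem cap_ratio_limit:
  fixes K :: "(real ^ 'n) set"
  assumes KC: "C2plus_convex_body K" "0 \<in> interior K" and k: "1 \<le> k" "k \<le> CARD('n)"
    and x: "x \<in> K" and n: "norm n = 1" "\<And>y. y \<in> K \<Longrightarrow> (y - x) \<bullet> n \<le> 0"
  shows "\<exists>M>0. \<forall>D. admissible_deformation K D \<longrightarrow>
    (cap_ratio k K D {y. (y - x) \<bullet> n = 0} \<longlongrightarrow> M * radial_speed D (sgn x) powr cap_exponent CARD('n) k) (at_right 0)"
proof (cases "\<exists>D. admissible_deformation K D")
  case True
  then obtain F' B where "smooth_boundary_point K x n F' B"
    using smooth_boundary_point_exists[OF KC _ x n] by blast
  then interpret smooth_boundary_point K x n F' B .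
  have "outer_halfspace K {y. (y - x) \<bullet> n = 0} = {y. 0 \<le> (y - x) \<bullet> n}"
    using outer_halfspace_eq[OF KC(2) n] by blast
  then have "cap_ratio k K D {y. (y - x) \<bullet> n = 0} =
    (\<lambda>\<epsilon>. intrinsic_volume k (D \<epsilon> \<inter> {y. 0 \<le> (y - x) \<bullet> n}) / \<epsilon> powr cap_exponent CARD('n) k)" for D
    by (simp add: cap_ratio_def[abs_def])
  then show ?thesis using cap_intrinsic_volume_limit[OF k] by simp
qed (use zero_less_one in blast)

theorem theorem4:
  fixes K :: "(real ^ 'n) set" and k :: nat
  assumes "CARD('n) \<ge> 2" and "1 \<le> k" and "k \<le> CARD('n)"
    and "C2plus_convex_body K" and "0 \<in> interior K"
  shows "(\<forall>D. admissible_deformation K D \<longrightarrow>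
            (\<forall>H. tangent_hyperplane K H \<longrightarrow>
               (\<exists>m\<ge>0. (cap_ratio k K D H \<longlongrightarrow> m) (at_right 0)))) \<and>
         (\<forall>D E. admissible_deformation K D \<longrightarrow> admissible_deformation K E \<longrightarrow>
            (\<forall>H. tangent_hyperplane K H \<longrightarrow> cap_limit k K D H = cap_limit k K E H) \<longrightarrow>
            (\<forall>u\<in>sphere 0 1. radial_speed D u = radial_speed E u))"
proof (intro conjI allI impI ballI)
  have K: "compact K" "convex K"
    using assms(4) by (auto simp: C2plus_convex_body_def convex_body_def)
  let ?\<alpha> = "cap_exponent CARD('n) k"
  note limit = cap_ratio_limit[OF assms(4,5,2,3)]
  show "\<exists>m\<ge>0. (cap_ratio k K D H \<longlongrightarrow> m) (at_right 0)"
    if adm: "admissible_deformation K D" and H: "tangent_hyperplane K H" for D H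
  proof -
    from tangent_hyperplane_normal[OF K(2) assms(5) H] obtain x n
      where xn: "x \<in> K" "norm n = 1" "H = {y. (y - x) \<bullet> n = 0}" "\<forall>y\<in>K. (y - x) \<bullet> n \<le> 0" .
    obtain M where M: "0 < M" "\<And>D. admissible_deformation K D \<Longrightarrow>
      (cap_ratio k K D H \<longlongrightarrow> M * radial_speed D (sgn x) powr ?\<alpha>) (at_right 0)"
      using limit[OF xn(1,2) xn(4)[rule_format]] unfolding xn(3) by blast
    show ?thesis
      by (rule exI[of _ "M * radial_speed D (sgn x) powr ?\<alpha>"]) (use M adm in auto)
  qed
  show "radial_speed D u = radial_speed E u"
    if adm: "admissible_deformation K D" "admissible_deformation K E"
      and eq: "\<forall>H. tangent_hyperplane K H \<longrightarrow> cap_limit k K D H = cap_limit k K E H"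
      and u: "u \<in> sphere 0 1" for D E u
  proof -
    have u1: "norm u = 1" using u by simp
    \<comment> \<open>Every direction is seen by some tangent hyperplane: \<open>x\<close> is the
      boundary point on the ray of \<open>u\<close>, and a supporting hyperplane there compares the
      two speeds at \<open>u\<close>.\<close>
    define x where "x = radial K u *\<^sub>R u"
    have r: "0 < radial K u" "x \<in> K" unfolding x_def by (rule radial_pos[OF K assms(5) u1])+
    have sx: "sgn x = u" using r(1) u1 by (simp add: x_def sgn_scaleR sgn_div_norm)
    have "x \<notin> interior K"
    proof
      assume "x \<in> interior K"
      then obtain e where e: "0 < e" "cball x e \<subseteq> K" using mem_interior_cball by blast
      define s where "s = radial K u + e"
      have s: "0 < s" using e r by (simp add: s_def)
      have "s *\<^sub>R u \<in> cball x e" using u1 e by (simp add: x_def s_def dist_norm scaleR_left_distrib)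
      then have "s *\<^sub>R u \<in> K" using e by blast
      moreover have "sgn (s *\<^sub>R u) = u" "s *\<^sub>R u \<noteq> 0" "norm (s *\<^sub>R u) = s"
        using s u1 by (auto simp: sgn_scaleR sgn_div_norm)
      moreover have "0 \<in> K" using assms(5) interior_subset by blast
      ultimately have "s \<le> radial K u" using mem_iff_le_radial[OF K, of "s *\<^sub>R u"] by simp
      then show False using e by (simp add: s_def)
    qed
    then have "x \<in> frontier K" using r(2) closure_subset by (auto simp: frontier_def)
    then obtain n where n: "norm n = 1" "\<And>z. z \<in> K \<Longrightarrow> (z - x) \<bullet> n \<le> 0"
      using supporting_unit_normal[of K x] K assms(5) compact_imp_closed by blast
    define H where "H = {y. (y - x) \<bullet> n = 0}"
    have "tangent_hyperplane K H"
      unfolding tangent_hyperplane_def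
    proof (intro conjI)
      show "hyperplane H" unfolding hyperplane_def H_def
        by (intro exI[of _ n] exI[of _ "n \<bullet> x"]) (use n in \<open>auto simp: inner_diff_left inner_diff_right inner_commute\<close>)
      have "x \<in> H" by (simp add: H_def)
      then show "H \<inter> K \<noteq> {}" using r(2) by blast
      \<comment> \<open>A point of \<open>K\<close> on \<open>H\<close> is supported by the same
        normal as \<open>x\<close>, so it cannot be interior.\<close>
      have "y \<in> frontier K" if "y \<in> H" "y \<in> interior K" for y
      proof (rule supported_imp_frontier[OF _ n(1)])
        show "(z - y) \<bullet> n \<le> 0" if "z \<in> K" for z
          using n(2)[OF that] \<open>y \<in> H\<close> by (simp add: H_def inner_diff_left)
      qed (use \<open>y \<in> interior K\<close> interior_subset in blast)
      then show "H \<inter> interior K = {}" by (auto simp: frontier_def)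
    qed
    then have lim_eq: "cap_limit k K D H = cap_limit k K E H" using eq by blast
    obtain M where M: "0 < M" "\<And>D. admissible_deformation K D \<Longrightarrow>
      (cap_ratio k K D H \<longlongrightarrow> M * radial_speed D u powr ?\<alpha>) (at_right 0)"
      using limit[OF r(2) n] unfolding H_def sx by blast
    have "cap_limit k K D H = M * radial_speed D u powr ?\<alpha>" if "admissible_deformation K D" for D
      unfolding cap_limit_def by (rule tendsto_Lim[OF _ M(2)[OF that]]) (simp add: trivial_limit_at_right_real)
    then have "radial_speed D u powr ?\<alpha> = radial_speed E u powr ?\<alpha>" using lim_eq adm M(1) by simp
    moreover have "0 < ?\<alpha>" using assms(2) by (simp add: cap_exponent_def)
    moreover have "0 \<le> radial_speed D u" "0 \<le> radial_speed E u"
      using radial_speed_expansion(2)[OF K assms(5) _ u1] adm by blast+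
    \<comment> \<open>\<open>powr\<close> with a positive exponent is injective on the non-negative
      reals, the value 0 included; this is where the sign of the speeds enters.\<close>
    moreover have "(c powr ?\<alpha>) powr (1 / ?\<alpha>) = c" if "0 \<le> c" for c
      using that \<open>0 < ?\<alpha>\<close> by (simp add: powr_powr)
    ultimately show ?thesis by metis
  qed
qed

end
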